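(* Let $r>0$ and consider the 6-dimensional solvable metric Lie algebras $\mathfrak{s}_1,\ldots,\mathfrak{s}_{13}$ listed in the context, each endowed with the Einstein inner product $h=\sum_{i=1}^6(e^i)^2$. Then: (1) there are no half-flat $\mathrm{SU}(3)$-structures inducing the Einstein metric $h$ on the rank 1 solvable metric Lie algebras $\mathfrak{s}_i$, $i=1,\ldots,9$, and on the rank 2 solvable metric Lie algebra $\mathfrak{s}_{12}$ (for all parameters $0\le s\le t\le 1$); (2) there are no coupled $\mathrm{SU}(3)$-structures inducing the Einstein metric $h$ on the rank 2 metric Lie algebras $\mathfrak{s}_{10}$ (for all parameters $0\le t\le\frac{1}{\sqrt{22}}$) and $\mathfrak{s}_{11}$ and on the rank 3 metric Lie algebra $\mathfrak{s}_{13}$.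
   Context: Stable forms. Let $V$ be a 6-dimensional real vector space. A 2-form $\omega$ on $V$ is stable if and only if $\omega^3\neq 0$. Let $A:\Lambda^5(V^* )\to V\otimes\Lambda^6(V^* )$ be the isomorphism $A(\gamma)=v\otimes\Omega$ where $i_v\Omega=\gamma$. For $\rho\in\Lambda^3(V^* )$ put $K_\rho:V\to V\otimes\Lambda^6(V^* )$, $K_\rho(v)=A((i_v\rho)\wedge\rho)$, and $\lambda(\rho)=\frac16\mathrm{tr}K_\rho^2\in(\Lambda^6(V^* ))^{\otimes 2}$. A 3-form $\rho$ is stable if and only if $\lambda(\rho)\neq 0$. Orient $V$ so that $\omega^3$ is positive, and let $\sqrt{|\lambda(\rho)|}\in\Lambda^6(V^* )$ be the corresponding positive volume form; then $J_\rho=-\frac{1}{\sqrt{|\lambda(\rho)|}}K_\rho$ is an almost complex structure when $\lambda(\rho)<0$. $\mathrm{SU}(3)$-structures. An $\mathrm{SU}(3)$-structure on a 6-dimensional real Lie algebra $\mathfrak{s}$ is a pair $(\omega,\psi_+)\in\Lambda^2(\mathfrak{s}^* )\times\Lambda^3(\mathfrak{s}^* )$ of stable forms with $\lambda(\psi_+)<0$, which are compatible ($\omega\wedge\psi_+=0$), satisfy the normalization condition $\psi_+\wedge\psi_-=\frac23\omega^3$, where $J=J_{\psi_+}$ and $\psi_-=J^*\psi_+$, and are such that $\omega(\cdot,J\cdot)$ is an inner product; this is the inner product (metric) induced by $(\omega,\psi_+)$. With $d$ the Chevalley-Eilenberg differential of $\mathfrak{s}$, the structure is half-flat if $d\psi_+=0$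 and $d(\omega\wedge\omega)=0$; a half-flat structure is coupled if $d\omega=c\,\psi_+$ for some $c\in\mathbb{R}\setminus\{0\}$. The metric Lie algebras. Each has a basis $(e_1,\ldots,e_6)$ with dual basis $(e^1,\ldots,e^6)$, orthonormal for $h=\sum_i(e^i)^2$, which is Einstein with $\mathrm{Ric}(h)=-r^2h$. Write $e^{ij}=e^i\wedge e^j$. The rank is the dimension of the orthogonal complement of $[\mathfrak{s},\mathfrak{s}]$. The structure equations $(de^1,de^2,de^3,de^4,de^5,de^6)$ are: $\mathfrak{s}_1$: $\left(\frac{r}{2\sqrt{2}}e^{16},\ \frac{r}{2\sqrt{2}}e^{26},\ \frac{r}{2\sqrt{2}}e^{36},\ \frac{r}{2\sqrt{2}}e^{46},\ -\frac{r}{\sqrt{2}}e^{12}-\frac{r}{\sqrt{2}}e^{34}+\frac{r}{\sqrt{2}}e^{56},\ 0\right)$ $\mathfrak{s}_2$: $\left(2r\sqrt{\frac{2}{105}}e^{16},\ r\sqrt{\frac{3}{70}}e^{26},\ -\frac{2r}{\sqrt{7}}e^{12}+r\sqrt{\frac{7}{30}}e^{36},\ 2r\sqrt{\frac{3}{70}}e^{46},\ -r\sqrt{\frac27}e^{14}-\frac{2r}{\sqrt{7}}e^{23}+r\sqrt{\frac{10}{21}}e^{56},\ 0\right)$ $\mathfrak{s}_3$: $\left(\frac{r}{\sqrt{55}}e^{16},\ \frac{2r}{\sqrt{55}}e^{26},\ -r\sqrt{\frac{6}{11}}e^{12}+\frac{3r}{\sqrt{55}}e^{36},\ -r\sqrt{\frac{6}{11}}e^{13}+\frac{4r}{\sqrt{55}}e^{46},\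 -\frac{2r}{\sqrt{11}}e^{14}-\frac{2r}{\sqrt{11}}e^{23}+\frac{5r}{\sqrt{55}}e^{56},\ 0\right)$ $\mathfrak{s}_4$: $\left(\frac{r\sqrt{6}}{30}e^{16},\ \frac{3r\sqrt{6}}{20}e^{26},\ -\frac{r}{\sqrt{2}}e^{12}+\frac{11r\sqrt{6}}{60}e^{36},\ -r\sqrt{\frac23}e^{13}+\frac{13r\sqrt{6}}{60}e^{46},\ -\frac{r}{\sqrt{2}}e^{14}+\frac{r\sqrt{6}}{4}e^{56},\ 0\right)$ $\mathfrak{s}_5$: $\left(\frac{r}{3\sqrt{2}}e^{16},\ \frac{r}{2\sqrt{2}}e^{26},\ \frac{r}{2\sqrt{2}}e^{36},\ -\frac{r}{\sqrt{2}}e^{12}+\frac{5r}{6\sqrt{2}}e^{46},\ -\frac{r}{\sqrt{2}}e^{13}+\frac{5r}{6\sqrt{2}}e^{56},\ 0\right)$ $\mathfrak{s}_6$: $\left(\frac{r}{2\sqrt{6}}e^{16},\ \frac{r}{2\sqrt{6}}e^{26},\ -r\sqrt{\frac23}e^{12}+\frac{r}{\sqrt{6}}e^{36},\ -\frac{r}{\sqrt{2}}e^{13}+r\frac{\sqrt{6}}{4}e^{46},\ -\frac{r}{\sqrt{2}}e^{23}+r\frac{\sqrt{6}}{4}e^{56},\ 0\right)$ $\mathfrak{s}_7$: $\left(\frac{r}{\sqrt{39}}e^{16},\ \frac{2r}{\sqrt{39}}e^{26},\ -r\sqrt{\frac23}e^{12}+\frac{3r}{\sqrt{39}}e^{36},\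 -r\sqrt{\frac23}e^{13}+\frac{4r}{\sqrt{39}}e^{46},\ \frac{3r}{\sqrt{39}}e^{56},\ 0\right)$ $\mathfrak{s}_8$: $\left(r\sqrt{\frac{2}{21}}e^{16},\ r\sqrt{\frac{2}{21}}e^{26},\ -r\sqrt{\frac23}e^{12}+2r\sqrt{\frac{2}{21}}e^{36},\ r\sqrt{\frac{3}{14}}e^{46},\ r\sqrt{\frac{3}{14}}e^{56},\ 0\right)$ $\mathfrak{s}_9$: $\left(\frac{r}{\sqrt{5}}e^{16},\ \frac{r}{\sqrt{5}}e^{26},\ \frac{r}{\sqrt{5}}e^{36},\ \frac{r}{\sqrt{5}}e^{46},\ \frac{r}{\sqrt{5}}e^{56},\ 0\right)$ $\mathfrak{s}_{10}$ (parameter $0\le t\le\frac{1}{\sqrt{22}}$): $\left(\frac{2r}{\sqrt{33}}e^{15}+rt\,e^{16}+r\sqrt{\frac12-11t^2}\,e^{26},\ \frac{2r}{\sqrt{33}}e^{25}+r\sqrt{\frac12-11t^2}\,e^{16}+rt\,e^{26},\ -r\sqrt{\frac23}e^{12}+\frac{4r}{\sqrt{33}}e^{35}+2rt\,e^{36},\ \frac{3r}{\sqrt{33}}e^{45}-4rt\,e^{46},\ 0,\ 0\right)$ $\mathfrak{s}_{11}$: $\left(\frac{r}{\sqrt{30}}e^{15}+\frac{3r}{\sqrt{30}}e^{16},\ \frac{2r}{\sqrt{30}}e^{25}-\frac{4r}{\sqrt{30}}e^{26},\ -r\sqrt{\frac23}e^{12}+\frac{3r}{\sqrt{30}}e^{35}-\frac{r}{\sqrt{30}}e^{36},\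 -r\sqrt{\frac23}e^{13}+\frac{4r}{\sqrt{30}}e^{45}+\frac{2r}{\sqrt{30}}e^{46},\ 0,\ 0\right)$ $\mathfrak{s}_{12}$ (parameters $0\le s\le t\le 1$): $\left(\frac{r}{2}e^{15}+r\frac{1+s+t}{2\sqrt{1+t^2+s^2}}e^{16},\ \frac{r}{2}e^{25}+r\frac{1-s-t}{2\sqrt{1+t^2+s^2}}e^{26},\ \frac{r}{2}e^{35}+r\frac{t-s-1}{2\sqrt{1+t^2+s^2}}e^{36},\ \frac{r}{2}e^{45}+r\frac{s-t-1}{2\sqrt{1+t^2+s^2}}e^{46},\ 0,\ 0\right)$ $\mathfrak{s}_{13}$: $\left(\frac{r}{\sqrt{3}}e^{14}-\frac{2r}{\sqrt{6}}e^{16},\ \frac{r}{\sqrt{3}}e^{24}+\frac{r}{\sqrt{2}}e^{25}+\frac{r}{\sqrt{6}}e^{26},\ \frac{r}{\sqrt{3}}e^{34}-\frac{r}{\sqrt{2}}e^{35}+\frac{r}{\sqrt{6}}e^{36},\ 0,\ 0,\ 0\right)$ *)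

theory Defs
  imports "HOL-Analysis.Analysis" "HOL-Library.Function_Algebras"
begin

section \<open>Exterior forms on a 6-dimensional vector space\<close>

text \<open>A form is a function on lists of vectors; a \<open>k\<close>-form vanishes on lists of length other
  than \<open>k\<close>, so that equality of forms is equality of functions. Sums of forms and the zero
  form are the pointwise ones of \<^theory>\<open>HOL-Library.Function_Algebras\<close>.\<close>

type_synonym vec6 = "real^6"
type_synonym form = "vec6 list \<Rightarrow> real"

definition Forms :: "nat \<Rightarrow> form set" where
  "Forms k = {\<alpha>.
     (\<forall>xs. length xs \<noteq> k \<longrightarrow> \<alpha> xs = 0) \<and>
     (\<forall>xs ys. length xs + 1 + length ys = k \<longrightarrow> linear (\<lambda>x. \<alpha> (xs @ x # ys))) \<and>
     (\<forall>xs. length xs = k \<and> \<not> distinct xs \<longrightarrow> \<alpha> xs = 0)}"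

definition scale_form :: "real \<Rightarrow> form \<Rightarrow> form" (infixr "\<cdot>" 75) where
  "c \<cdot> \<alpha> = (\<lambda>xs. c * \<alpha> xs)"

text \<open>Shuffle formula. For a \<open>p\<close>-form and a \<open>q\<close>-form only subsets \<open>I\<close> of size \<open>p\<close> contribute, and
  only on lists of length \<open>p + q\<close>. The normalisation is the one with
  \<open>(e\<^sup>i \<and> e\<^sup>j)(x, y) = x\<^sub>i y\<^sub>j - x\<^sub>j y\<^sub>i\<close>.\<close>

definition shuffle_sign :: "nat set \<Rightarrow> real" where
  "shuffle_sign I = (-1) ^ card {(i, j). i \<in> I \<and> j \<notin> I \<and> j < i}"

definition wedge :: "form \<Rightarrow> form \<Rightarrow> form" (infixr "\<^bold>\<and>" 80) where
  "\<alpha> \<^bold>\<and> \<beta> = (\<lambda>xs. \<Sum>I\<in>Pow {..<length xs}.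
      shuffle_sign I * \<alpha> (nths xs I) * \<beta> (nths xs (- I)))"

definition interior_prod :: "vec6 \<Rightarrow> form \<Rightarrow> form" where
  "interior_prod v \<alpha> = (\<lambda>xs. \<alpha> (v # xs))"

definition pullback :: "(vec6 \<Rightarrow> vec6) \<Rightarrow> form \<Rightarrow> form" where
  "pullback f \<alpha> = (\<lambda>xs. \<alpha> (map f xs))"

text \<open>The Chevalley-Eilenberg differential of a bracket:
  \<open>d\<alpha>(x\<^sub>0, \<dots>, x\<^sub>k) = \<Sum>\<^sub>i\<^sub><\<^sub>j (-1)\<^sup>i\<^sup>+\<^sup>j \<alpha>([x\<^sub>i, x\<^sub>j], x\<^sub>0, \<dots>)\<close> with \<open>x\<^sub>i\<close> and \<open>x\<^sub>j\<close> omitted from the tail.\<close>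

definition ce_diff :: "(vec6 \<Rightarrow> vec6 \<Rightarrow> vec6) \<Rightarrow> form \<Rightarrow> form" where
  "ce_diff br \<alpha> = (\<lambda>xs. \<Sum>(i, j) \<in> {(i, j). i < j \<and> j < length xs}.
      (-1) ^ (i + j) * \<alpha> (br (xs ! i) (xs ! j) # nths xs (- {i, j})))"


section \<open>Stable forms and SU(3)-structures\<close>

text \<open>Elements of \<open>V \<otimes> \<Lambda>\<^sup>6(V\<^sup>*)\<close> are the \<open>V\<close>-valued 6-forms; elements of
  \<open>\<Lambda>\<^sup>6(V\<^sup>*) \<otimes> \<Lambda>\<^sup>6(V\<^sup>*)\<close> are functions of two lists of vectors.\<close>

definition vtensor :: "vec6 \<Rightarrow> form \<Rightarrow> (vec6 list \<Rightarrow> vec6)" where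
  "vtensor v \<Omega> = (\<lambda>xs. \<Omega> xs *\<^sub>R v)"

definition tensor2 :: "form \<Rightarrow> form \<Rightarrow> (vec6 list \<Rightarrow> vec6 list \<Rightarrow> real)" where
  "tensor2 \<Omega> \<Omega>' = (\<lambda>xs ys. \<Omega> xs * \<Omega>' ys)"

definition isoA :: "form \<Rightarrow> (vec6 list \<Rightarrow> vec6)" where
  "isoA \<gamma> = (THE T. \<exists>v. \<exists>\<Omega>\<in>Forms 6. \<Omega> \<noteq> 0 \<and> interior_prod v \<Omega> = \<gamma> \<and> T = vtensor v \<Omega>)"

definition Kmap :: "form \<Rightarrow> vec6 \<Rightarrow> (vec6 list \<Rightarrow> vec6)" where
  "Kmap \<rho> v = isoA (interior_prod v \<rho> \<^bold>\<and> \<rho>)"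

text \<open>The square of \<open>K\<^sub>\<rho>\<close> is the composition
  \<open>V \<rightarrow> V \<otimes> \<Lambda>\<^sup>6 \<rightarrow> V \<otimes> \<Lambda>\<^sup>6 \<otimes> \<Lambda>\<^sup>6\<close>; its trace over \<open>V\<close> is evaluated on the \<open>\<Lambda>\<^sup>6\<close>-arguments
  \<open>xs\<close> and \<open>ys\<close>.\<close>

definition lam :: "form \<Rightarrow> (vec6 list \<Rightarrow> vec6 list \<Rightarrow> real)" where
  "lam \<rho> = (\<lambda>xs ys. 1/6 * trace (matrix (\<lambda>v. Kmap \<rho> (Kmap \<rho> v xs) ys)))"

definition lam_neg :: "form \<Rightarrow> bool" where
  "lam_neg \<rho> \<longleftrightarrow> (\<exists>\<Omega>\<in>Forms 6. \<Omega> \<noteq> 0 \<and> lam \<rho> = - tensor2 \<Omega> \<Omega>)"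

definition stable2 :: "form \<Rightarrow> bool" where
  "stable2 \<omega> \<longleftrightarrow> \<omega> \<in> Forms 2 \<and> \<omega> \<^bold>\<and> \<omega> \<^bold>\<and> \<omega> \<noteq> 0"

definition stable3 :: "form \<Rightarrow> bool" where
  "stable3 \<rho> \<longleftrightarrow> \<rho> \<in> Forms 3 \<and> lam \<rho> \<noteq> 0"

text \<open>The volume form \<open>\<mu>\<close>, positive for the orientation given by the volume form \<open>\<tau>\<close>, with
  \<open>\<mu> \<otimes> \<mu> = |\<lambda>(\<rho>)|\<close>.\<close>

definition sqrt_abs_lam :: "form \<Rightarrow> form \<Rightarrow> form" where
  "sqrt_abs_lam \<tau> \<rho> = (THE \<mu>. \<mu> \<in> Forms 6 \<and> (\<exists>c>0. \<mu> = c \<cdot> \<tau>) \<and>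
      (lam \<rho> = tensor2 \<mu> \<mu> \<or> lam \<rho> = - tensor2 \<mu> \<mu>))"

text \<open>\<open>J\<^sub>\<rho> v = - K\<^sub>\<rho> v / \<mu>\<close> with \<open>\<mu>\<close> the volume form above.\<close>

definition Jmap :: "form \<Rightarrow> form \<Rightarrow> vec6 \<Rightarrow> vec6" where
  "Jmap \<tau> \<rho> v = (THE w. Kmap \<rho> v = - vtensor w (sqrt_abs_lam \<tau> \<rho>))"

definition su3_J :: "form \<Rightarrow> form \<Rightarrow> vec6 \<Rightarrow> vec6" where
  "su3_J \<omega> \<psi> = Jmap (\<omega> \<^bold>\<and> \<omega> \<^bold>\<and> \<omega>) \<psi>"

definition psi_minus :: "form \<Rightarrow> form \<Rightarrow> form" where
  "psi_minus \<omega> \<psi> = pullback (su3_J \<omega> \<psi>) \<psi>"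

definition induced_metric :: "form \<Rightarrow> form \<Rightarrow> vec6 \<Rightarrow> vec6 \<Rightarrow> real" where
  "induced_metric \<omega> \<psi> = (\<lambda>x y. \<omega> [x, su3_J \<omega> \<psi> y])"

definition inner_product :: "(vec6 \<Rightarrow> vec6 \<Rightarrow> real) \<Rightarrow> bool" where
  "inner_product g \<longleftrightarrow> bilinear g \<and> (\<forall>x y. g x y = g y x) \<and> (\<forall>x. x \<noteq> 0 \<longrightarrow> g x x > 0)"

definition su3_structure :: "form \<Rightarrow> form \<Rightarrow> bool" where
  "su3_structure \<omega> \<psi> \<longleftrightarrow>
     stable2 \<omega> \<and> stable3 \<psi> \<and> lam_neg \<psi> \<and>
     \<omega> \<^bold>\<and> \<psi> = 0 \<and>
     \<psi> \<^bold>\<and> psi_minus \<omega> \<psi> = (2/3) \<cdot> (\<omega> \<^bold>\<and> \<omega> \<^bold>\<and> \<omega>) \<and>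
     inner_product (induced_metric \<omega> \<psi>)"

definition half_flat :: "(vec6 \<Rightarrow> vec6 \<Rightarrow> vec6) \<Rightarrow> form \<Rightarrow> form \<Rightarrow> bool" where
  "half_flat br \<omega> \<psi> \<longleftrightarrow>
     su3_structure \<omega> \<psi> \<and> ce_diff br \<psi> = 0 \<and> ce_diff br (\<omega> \<^bold>\<and> \<omega>) = 0"

definition coupled :: "(vec6 \<Rightarrow> vec6 \<Rightarrow> vec6) \<Rightarrow> form \<Rightarrow> form \<Rightarrow> bool" where
  "coupled br \<omega> \<psi> \<longleftrightarrow> half_flat br \<omega> \<psi> \<and> (\<exists>c. c \<noteq> 0 \<and> ce_diff br \<omega> = c \<cdot> \<psi>)"


section \<open>The metric Lie algebras\<close>

text \<open>The basis \<open>(e\<^sub>1, \<dots>, e\<^sub>6)\<close> is the standard basis of \<^typ>\<open>real^6\<close>; in the index type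
  the numeral \<open>6\<close> denotes the same element as \<open>0\<close>.\<close>

definition cov :: "6 \<Rightarrow> form" where
  "cov i = (\<lambda>xs. case xs of [x] \<Rightarrow> x $ i | _ \<Rightarrow> 0)"

definition cov2 :: "6 \<Rightarrow> 6 \<Rightarrow> form" where
  "cov2 i j = cov i \<^bold>\<and> cov j"

definition std_metric :: "vec6 \<Rightarrow> vec6 \<Rightarrow> real" where
  "std_metric = (\<lambda>x y. \<Sum>i\<in>UNIV. cov i [x] * cov i [y])"

text \<open>A Lie algebra is given by its structure equations \<open>de\<^sup>k = D k\<close>; as
  \<open>de\<^sup>k(x, y) = - e\<^sup>k([x, y])\<close>, they determine the bracket.\<close>

definition struct_eqs :: "form \<Rightarrow> form \<Rightarrow> form \<Rightarrow> form \<Rightarrow> form \<Rightarrow> form \<Rightarrow> 6 \<Rightarrow> form" where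
  "struct_eqs a1 a2 a3 a4 a5 a6 = (\<lambda>k.
     if k = 1 then a1 else if k = 2 then a2 else if k = 3 then a3 else
     if k = 4 then a4 else if k = 5 then a5 else a6)"

definition bracket :: "(6 \<Rightarrow> form) \<Rightarrow> vec6 \<Rightarrow> vec6 \<Rightarrow> vec6" where
  "bracket D x y = (\<chi> k. - D k [x, y])"

definition s1 :: "real \<Rightarrow> 6 \<Rightarrow> form" where
  "s1 r = struct_eqs
     ((r / (2 * sqrt 2)) \<cdot> cov2 1 6)
     ((r / (2 * sqrt 2)) \<cdot> cov2 2 6)
     ((r / (2 * sqrt 2)) \<cdot> cov2 3 6)
     ((r / (2 * sqrt 2)) \<cdot> cov2 4 6)
     ((- (r / sqrt 2)) \<cdot> cov2 1 2 + (- (r / sqrt 2)) \<cdot> cov2 3 4 + (r / sqrt 2) \<cdot> cov2 5 6)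
     0"

definition s2 :: "real \<Rightarrow> 6 \<Rightarrow> form" where
  "s2 r = struct_eqs
     ((2 * r * sqrt (2/105)) \<cdot> cov2 1 6)
     ((r * sqrt (3/70)) \<cdot> cov2 2 6)
     ((- (2 * r / sqrt 7)) \<cdot> cov2 1 2 + (r * sqrt (7/30)) \<cdot> cov2 3 6)
     ((2 * r * sqrt (3/70)) \<cdot> cov2 4 6)
     ((- (r * sqrt (2/7))) \<cdot> cov2 1 4 + (- (2 * r / sqrt 7)) \<cdot> cov2 2 3
        + (r * sqrt (10/21)) \<cdot> cov2 5 6)
     0"

definition s3 :: "real \<Rightarrow> 6 \<Rightarrow> form" where
  "s3 r = struct_eqs
     ((r / sqrt 55) \<cdot> cov2 1 6)
     ((2 * r / sqrt 55) \<cdot> cov2 2 6)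
     ((- (r * sqrt (6/11))) \<cdot> cov2 1 2 + (3 * r / sqrt 55) \<cdot> cov2 3 6)
     ((- (r * sqrt (6/11))) \<cdot> cov2 1 3 + (4 * r / sqrt 55) \<cdot> cov2 4 6)
     ((- (2 * r / sqrt 11)) \<cdot> cov2 1 4 + (- (2 * r / sqrt 11)) \<cdot> cov2 2 3
        + (5 * r / sqrt 55) \<cdot> cov2 5 6)
     0"

definition s4 :: "real \<Rightarrow> 6 \<Rightarrow> form" where
  "s4 r = struct_eqs
     ((r * sqrt 6 / 30) \<cdot> cov2 1 6)
     ((3 * r * sqrt 6 / 20) \<cdot> cov2 2 6)
     ((- (r / sqrt 2)) \<cdot> cov2 1 2 + (11 * r * sqrt 6 / 60) \<cdot> cov2 3 6)
     ((- (r * sqrt (2/3))) \<cdot> cov2 1 3 + (13 * r * sqrt 6 / 60) \<cdot> cov2 4 6)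
     ((- (r / sqrt 2)) \<cdot> cov2 1 4 + (r * sqrt 6 / 4) \<cdot> cov2 5 6)
     0"

definition s5 :: "real \<Rightarrow> 6 \<Rightarrow> form" where
  "s5 r = struct_eqs
     ((r / (3 * sqrt 2)) \<cdot> cov2 1 6)
     ((r / (2 * sqrt 2)) \<cdot> cov2 2 6)
     ((r / (2 * sqrt 2)) \<cdot> cov2 3 6)
     ((- (r / sqrt 2)) \<cdot> cov2 1 2 + (5 * r / (6 * sqrt 2)) \<cdot> cov2 4 6)
     ((- (r / sqrt 2)) \<cdot> cov2 1 3 + (5 * r / (6 * sqrt 2)) \<cdot> cov2 5 6)
     0"

definition s6 :: "real \<Rightarrow> 6 \<Rightarrow> form" where
  "s6 r = struct_eqs
     ((r / (2 * sqrt 6)) \<cdot> cov2 1 6)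
     ((r / (2 * sqrt 6)) \<cdot> cov2 2 6)
     ((- (r * sqrt (2/3))) \<cdot> cov2 1 2 + (r / sqrt 6) \<cdot> cov2 3 6)
     ((- (r / sqrt 2)) \<cdot> cov2 1 3 + (r * (sqrt 6 / 4)) \<cdot> cov2 4 6)
     ((- (r / sqrt 2)) \<cdot> cov2 2 3 + (r * (sqrt 6 / 4)) \<cdot> cov2 5 6)
     0"

definition s7 :: "real \<Rightarrow> 6 \<Rightarrow> form" where
  "s7 r = struct_eqs
     ((r / sqrt 39) \<cdot> cov2 1 6)
     ((2 * r / sqrt 39) \<cdot> cov2 2 6)
     ((- (r * sqrt (2/3))) \<cdot> cov2 1 2 + (3 * r / sqrt 39) \<cdot> cov2 3 6)
     ((- (r * sqrt (2/3))) \<cdot> cov2 1 3 + (4 * r / sqrt 39) \<cdot> cov2 4 6)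
     ((3 * r / sqrt 39) \<cdot> cov2 5 6)
     0"

definition s8 :: "real \<Rightarrow> 6 \<Rightarrow> form" where
  "s8 r = struct_eqs
     ((r * sqrt (2/21)) \<cdot> cov2 1 6)
     ((r * sqrt (2/21)) \<cdot> cov2 2 6)
     ((- (r * sqrt (2/3))) \<cdot> cov2 1 2 + (2 * r * sqrt (2/21)) \<cdot> cov2 3 6)
     ((r * sqrt (3/14)) \<cdot> cov2 4 6)
     ((r * sqrt (3/14)) \<cdot> cov2 5 6)
     0"

definition s9 :: "real \<Rightarrow> 6 \<Rightarrow> form" where
  "s9 r = struct_eqs
     ((r / sqrt 5) \<cdot> cov2 1 6)
     ((r / sqrt 5) \<cdot> cov2 2 6)
     ((r / sqrt 5) \<cdot> cov2 3 6)
     ((r / sqrt 5) \<cdot> cov2 4 6)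
     ((r / sqrt 5) \<cdot> cov2 5 6)
     0"

definition s10 :: "real \<Rightarrow> real \<Rightarrow> 6 \<Rightarrow> form" where
  "s10 r t = struct_eqs
     ((2 * r / sqrt 33) \<cdot> cov2 1 5 + (r * t) \<cdot> cov2 1 6 + (r * sqrt (1/2 - 11 * t^2)) \<cdot> cov2 2 6)
     ((2 * r / sqrt 33) \<cdot> cov2 2 5 + (r * sqrt (1/2 - 11 * t^2)) \<cdot> cov2 1 6 + (r * t) \<cdot> cov2 2 6)
     ((- (r * sqrt (2/3))) \<cdot> cov2 1 2 + (4 * r / sqrt 33) \<cdot> cov2 3 5 + (2 * r * t) \<cdot> cov2 3 6)
     ((3 * r / sqrt 33) \<cdot> cov2 4 5 + (- (4 * r * t)) \<cdot> cov2 4 6)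
     0
     0"

definition s11 :: "real \<Rightarrow> 6 \<Rightarrow> form" where
  "s11 r = struct_eqs
     ((r / sqrt 30) \<cdot> cov2 1 5 + (3 * r / sqrt 30) \<cdot> cov2 1 6)
     ((2 * r / sqrt 30) \<cdot> cov2 2 5 + (- (4 * r / sqrt 30)) \<cdot> cov2 2 6)
     ((- (r * sqrt (2/3))) \<cdot> cov2 1 2 + (3 * r / sqrt 30) \<cdot> cov2 3 5
        + (- (r / sqrt 30)) \<cdot> cov2 3 6)
     ((- (r * sqrt (2/3))) \<cdot> cov2 1 3 + (4 * r / sqrt 30) \<cdot> cov2 4 5
        + (2 * r / sqrt 30) \<cdot> cov2 4 6)
     0
     0"

definition s12 :: "real \<Rightarrow> real \<Rightarrow> real \<Rightarrow> 6 \<Rightarrow> form" where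
  "s12 r s t = struct_eqs
     ((r / 2) \<cdot> cov2 1 5 + (r * ((1 + s + t) / (2 * sqrt (1 + t^2 + s^2)))) \<cdot> cov2 1 6)
     ((r / 2) \<cdot> cov2 2 5 + (r * ((1 - s - t) / (2 * sqrt (1 + t^2 + s^2)))) \<cdot> cov2 2 6)
     ((r / 2) \<cdot> cov2 3 5 + (r * ((t - s - 1) / (2 * sqrt (1 + t^2 + s^2)))) \<cdot> cov2 3 6)
     ((r / 2) \<cdot> cov2 4 5 + (r * ((s - t - 1) / (2 * sqrt (1 + t^2 + s^2)))) \<cdot> cov2 4 6)
     0
     0"

definition s13 :: "real \<Rightarrow> 6 \<Rightarrow> form" where
  "s13 r = struct_eqs
     ((r / sqrt 3) \<cdot> cov2 1 4 + (- (2 * r / sqrt 6)) \<cdot> cov2 1 6)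
     ((r / sqrt 3) \<cdot> cov2 2 4 + (r / sqrt 2) \<cdot> cov2 2 5 + (r / sqrt 6) \<cdot> cov2 2 6)
     ((r / sqrt 3) \<cdot> cov2 3 4 + (- (r / sqrt 2)) \<cdot> cov2 3 5 + (r / sqrt 6) \<cdot> cov2 3 6)
     0
     0
     0"


section \<open>Consistency of the structure equations\<close>

lemma cov_apply [simp]: "cov i [x] = x $ i"
  by (simp add: cov_def)

lemma cov_eq_0: "length xs \<noteq> 1 \<Longrightarrow> cov i xs = 0"
  by (auto simp: cov_def split: list.splits)

lemma cov2_apply [simp]: "cov2 i j [x, y] = x $ i * y $ j - x $ j * y $ i"
proof -
  have P: "Pow {..<length [x, y]} = {{}, {0}, {1}, {0, 1}}"
    by (auto simp: lessThan_Suc Pow_insert)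
  have "{(i, j). i \<in> {0::nat} \<and> j \<notin> {0} \<and> j < i} = {}"
    by auto
  then have s0: "shuffle_sign {0} = 1"
    unfolding shuffle_sign_def by (simp only: card.empty power_0)
  have "{(i, j). i \<in> {1::nat} \<and> j \<notin> {1} \<and> j < i} = {(1, 0)}"
    by auto
  then have s1: "shuffle_sign {Suc 0} = -1"
    by (simp add: shuffle_sign_def)
  show ?thesis
    unfolding cov2_def wedge_def P
    by (simp add: s0 s1 nths_Cons cov_eq_0)
qed

lemma std_metric_eq_inner: "std_metric = inner"
  by (intro ext) (simp add: std_metric_def inner_vec_def)

text \<open>The bracket has the prescribed structure equations.\<close>

lemma ce_diff_bracket_cov:
  assumes "D k \<in> Forms 2"
  shows "ce_diff (bracket D) (cov k) = D k"
proof
  fix xs :: "vec6 list"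
  show "ce_diff (bracket D) (cov k) xs = D k xs"
  proof (cases "length xs = 2")
    case True
    then obtain x y where xs: "xs = [x, y]"
      by (auto simp: length_Suc_conv numeral_2_eq_2)
    have "{(i, j). i < j \<and> j < length xs} = {(0, 1)}"
      by (auto simp: xs)
    then show ?thesis
      by (simp add: ce_diff_def xs nths_Cons bracket_def)
  next
    case False
    have "cov k (br (xs ! i) (xs ! j) # nths xs (- {i, j})) = 0"
      if "i < j" "j < length xs" for br i j
    proof -
      have "{n. n < length xs \<and> n \<in> - {i, j}} = {..<length xs} - {i, j}"
        by auto
      then have "length (nths xs (- {i, j})) = length xs - 2"
        using that by (simp add: length_nths card_Diff_subset)
      then show ?thesis
        using that False by (intro cov_eq_0) auto
    qed
    then have "ce_diff (bracket D) (cov k) xs = 0"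
      unfolding ce_diff_def by (intro sum.neutral) auto
    moreover have "D k xs = 0"
      using assms False by (auto simp: Forms_def)
    ultimately show ?thesis
      by simp
  qed
qed

end

theory Submission
  imports Defs
begin

text \<open>Two facts collide. The first is a rigidity of SU(3)-structures inducing a given metric. Then
  \<open>J\<close> is orthogonal and \<open>\<omega>(x, y) = \<langle>J x, y\<rangle>\<close>, and in a unitary frame \<open>\<psi>\<close> is the real part of a
  multiple of \<open>dz\<^sup>1 \<and> dz\<^sup>2 \<and> dz\<^sup>3\<close>. Hence there is \<open>\<kappa> > 0\<close> with
  \<open>|\<psi>(x, y, \<cdot>)|\<^sup>2 = \<kappa> (|x|\<^sup>2 |y|\<^sup>2 - \<langle>x, y\<rangle>\<^sup>2 - \<omega>(x, y)\<^sup>2)\<close> for all \<open>x\<close>, \<open>y\<close> (\<open>pair_identity\<close>).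
  Summing over \<open>y\<close>, the contractions of \<open>\<psi>\<close> with the six unit vectors \<open>e\<^sub>i\<close> all have the same norm.
  The second is that \<open>d\<psi> = 0\<close>, or \<open>d\<omega> = c \<psi>\<close>, distributes \<open>\<psi>\<close> unevenly over the basis.

  \<^item> Rank one. Write \<open>\<psi> = \<sigma> + \<tau> \<and> e\<^sup>6\<close> with \<open>\<sigma>\<close>, \<open>\<tau>\<close> on the nilradical. All eigenvalues of \<open>ad e\<^sub>6\<close> on
    the nilradical have the same sign, so closedness expresses each coefficient of \<open>\<sigma>\<close> through
    \<open>\<tau>\<close> (\<open>rank_one_closed\<close>). The result is that \<open>\<sigma>\<close> is too small compared to \<open>\<tau>\<close>: there are weights
    \<open>p\<^sub>i\<close> with negative sum for which \<open>\<Sum> (p\<^sub>i + p\<^sub>j + p\<^sub>k) \<psi>\<^sub>i\<^sub>j\<^sub>k\<^sup>2\<close> is nonnegative on closed forms, whereas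
    equality of the norms makes it \<open>2 \<kappa> \<Sum> p\<^sub>i\<close> (\<open>su3_weighted_gram\<close>). For \<open>\<ss>\<^sub>6\<close> a multiple of the
    inequality \<open>|\<psi>(e\<^sub>1, e\<^sub>2, \<cdot>)|\<^sup>2 \<le> \<kappa>\<close> has to be added.
  \<^item> Rank two, nilradical abelian. The same comparison, now between \<open>e\<^sub>5\<close>, \<open>e\<^sub>6\<close> and the nilradical,
    leaves \<open>\<psi>\<^sub>1\<^sub>2\<^sub>5\<close> and \<open>\<psi>\<^sub>1\<^sub>2\<^sub>6\<close> as the only coefficients with index \<open>1\<close>, so that
    \<open>|\<psi>(e\<^sub>1, e\<^sub>2, \<cdot>)|\<^sup>2 = 2 \<kappa>\<close>, twice what is possible.
  \<^item> Coupled, rank two. The identities hold for \<open>d\<omega>\<close> with some \<open>K\<close> in place of \<open>\<kappa>\<close>. From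
    \<open>d(\<omega> \<and> \<omega>) = 0\<close> one gets \<open>\<omega>(e\<^sub>5, e\<^sub>6) = 0\<close>, and then the part of \<open>d\<omega>\<close> on the span of
    \<open>e\<^sub>1, \<dots>, e\<^sub>4\<close> has squared norm \<open>K\<close>. That part comes from the structure constants of the nilradical
    alone, which are too small (\<open>coupled_rank_two\<close>).
  \<^item> Coupled, rank three. Counting the identities over all pairs determines the coefficients
    \<open>\<omega>\<^sub>1\<^sub>2\<^sup>2 = \<omega>\<^sub>1\<^sub>3\<^sup>2 = \<omega>\<^sub>2\<^sub>3\<^sup>2 = 1/3\<close>, and these values contradict the Cauchy-Schwarz inequality.

  Before any of this, \<open>J\<close> has to be extracted from its definition by unique descriptions. That needs
  products of alternating forms to be alternating, \<open>\<Lambda>\<^sup>6\<close> to be one-dimensional, and every 5-form to be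
  \<open>i\<^sub>v \<mu>\<close> for a fixed volume form \<open>\<mu>\<close>. The outcome is \<open>i\<^sub>x \<psi> \<and> \<psi> = - i\<^bsub>J x\<^esub> \<mu>\<close> for all \<open>x\<close>, which is the only
  property of \<open>K\<^sub>\<psi>\<close>, besides the trace of its square, that enters afterwards.\<close>

section \<open>The Leibniz rule for interior products\<close>

text \<open>Weaker than being a \<open>p\<close>-form, but enough for the sign \<open>(-1)\<^sup>p\<close> in the Leibniz rule; that products of
  alternating forms are alternating is then a consequence of the rule.\<close>

definition homogeneous :: "nat \<Rightarrow> form \<Rightarrow> bool" where
  "homogeneous p \<alpha> \<longleftrightarrow> (\<forall>xs. length xs \<noteq> p \<longrightarrow> \<alpha> xs = 0)"

text \<open>The new position \<open>0\<close> lies outside the shifted set and precedes all its elements, so it adds one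
  inversion for each of them.\<close>

lemma shuffle_sign_Suc_image:
  assumes "finite I"
  shows "shuffle_sign (Suc ` I) = (-1) ^ card I * shuffle_sign I"
proof -
  have eq: "{(i, j). i \<in> Suc ` I \<and> j \<notin> Suc ` I \<and> j < i} =
      (\<lambda>i. (Suc i, 0)) ` I \<union> map_prod Suc Suc ` {(i, j). i \<in> I \<and> j \<notin> I \<and> j < i}"
    (is "?L = ?A \<union> ?B")
  proof (intro set_eqI iffI)
    fix z assume "z \<in> ?L"
    then obtain i j where z: "z = (Suc i, j)" "i \<in> I" "j \<notin> Suc ` I" "j < Suc i" by auto
    show "z \<in> ?A \<union> ?B"
      using z by (cases j) (auto simp: image_iff)
  qed auto
  have fin: "finite {(i, j). i \<in> I \<and> j \<notin> I \<and> j < i}"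
    by (rule finite_subset[of _ "Sigma I (\<lambda>i. {..<i})"]) (use assms in auto)
  have "card ?L = card ?A + card ?B"
    unfolding eq by (rule card_Un_disjoint) (use assms fin in auto)
  also have "card ?A = card I"
    by (rule card_image) (auto simp: inj_on_def)
  also have "card ?B = card {(i, j). i \<in> I \<and> j \<notin> I \<and> j < i}"
    by (rule card_image) (auto simp: inj_on_def)
  finally show ?thesis
    by (simp add: shuffle_sign_def power_add)
qed

lemma shuffle_sign_insert_0: "shuffle_sign (insert 0 (Suc ` I)) = shuffle_sign I"
proof -
  have eq: "{(i, j). i \<in> insert 0 (Suc ` I) \<and> j \<notin> insert 0 (Suc ` I) \<and> j < i} =
      map_prod Suc Suc ` {(i, j). i \<in> I \<and> j \<notin> I \<and> j < i}" (is "?L = ?B")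
  proof (intro set_eqI iffI)
    fix z assume "z \<in> ?L"
    then obtain i j where z: "z = (Suc i, j)" "i \<in> I" "j \<notin> Suc ` I" "j < Suc i" "j \<noteq> 0" by auto
    show "z \<in> ?B"
      using z by (cases j) (auto simp: image_iff)
  qed auto
  have "card ?B = card {(i, j). i \<in> I \<and> j \<notin> I \<and> j < i}"
    by (rule card_image) (auto simp: inj_on_def)
  with eq show ?thesis
    by (simp add: shuffle_sign_def)
qed

lemma sum_Pow_lessThan_Suc:
  fixes f :: "nat set \<Rightarrow> real"
  shows "(\<Sum>I\<in>Pow {..<Suc n}. f I) =
    (\<Sum>I\<in>Pow {..<n}. f (insert 0 (Suc ` I))) + (\<Sum>I\<in>Pow {..<n}. f (Suc ` I))"
proof -
  have P: "Pow {..<Suc n} = (\<lambda>I. insert 0 (Suc ` I)) ` Pow {..<n} \<union> (`) Suc ` Pow {..<n}"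
    unfolding lessThan_Suc_eq_insert_0 Pow_insert image_Pow_surj[OF refl, symmetric]
    by (auto simp: image_image)
  have "inj_on (\<lambda>I. insert 0 (Suc ` I)) (Pow {..<n})"
    by (rule inj_onI) (metis Diff_insert_absorb imageE inj_Suc inj_image_eq_iff nat.distinct(1))
  moreover have "inj_on ((`) Suc) (Pow {..<n})"
    by (simp add: inj_on_image_Pow)
  ultimately show ?thesis
    unfolding P by (subst sum.union_disjoint) (auto simp: sum.reindex)
qed

lemma wedge_Nil: "(\<alpha> \<^bold>\<and> \<beta>) [] = \<alpha> [] * \<beta> []"
  by (simp add: wedge_def shuffle_sign_def)

text \<open>Split the shuffles of \<open>x # xs\<close> according to whether \<open>x\<close> goes to the left or to the right factor; going
  right, it passes the \<open>p\<close> arguments of \<open>\<alpha>\<close>. All later evaluations and the closure properties of the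
  product rest on this recursion instead of on sums over subsets.\<close>

lemma wedge_Cons:
  assumes "homogeneous p \<alpha>"
  shows "(\<alpha> \<^bold>\<and> \<beta>) (x # xs) =
    (interior_prod x \<alpha> \<^bold>\<and> \<beta>) xs + (-1) ^ p * (\<alpha> \<^bold>\<and> interior_prod x \<beta>) xs"
proof -
  have fin: "finite I" if "I \<in> Pow {..<n}" for I and n :: nat
    using that by (auto intro: finite_subset)
  have sets: "{j. Suc j \<in> insert 0 (Suc ` I)} = I" "{j. Suc j \<in> Suc ` I} = I"
    "{j. Suc j \<in> - insert 0 (Suc ` I)} = - I" "{j. Suc j \<in> - (Suc ` I)} = - I" for I
    by auto
  have len: "length (nths xs I) = card I" if "I \<in> Pow {..<length xs}" for I
    using that by (auto simp: length_nths intro: arg_cong[where f=card])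
  have "shuffle_sign (Suc ` I) * \<alpha> (nths xs I) * b = (-1) ^ p * (shuffle_sign I * \<alpha> (nths xs I) * b)"
    if I: "I \<in> Pow {..<length xs}" for I b
    using fin[OF I] len[OF I] assms
    by (cases "card I = p") (auto simp: shuffle_sign_Suc_image homogeneous_def)
  then have "(\<Sum>I\<in>Pow {..<length xs}. shuffle_sign (Suc ` I) * \<alpha> (nths xs I) * \<beta> (x # nths xs (- I))) =
      (\<Sum>I\<in>Pow {..<length xs}. (-1) ^ p * (shuffle_sign I * \<alpha> (nths xs I) * \<beta> (x # nths xs (- I))))"
    by (intro sum.cong) auto
  then show ?thesis
    unfolding wedge_def length_Cons sum_Pow_lessThan_Suc shuffle_sign_insert_0 interior_prod_def nths_Cons sets
    by (simp add: sum_distrib_left)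
qed

section \<open>Alternating forms\<close>

lemma linear_cmult:
  fixes f :: "'a::real_vector \<Rightarrow> real"
  assumes "linear f"
  shows "linear (\<lambda>x. c * f x)" and "linear (\<lambda>x. f x * c)"
  using assms by (simp_all add: linear_iff algebra_simps)

lemma Forms_length: "\<alpha> \<in> Forms k \<Longrightarrow> length xs \<noteq> k \<Longrightarrow> \<alpha> xs = 0"
  by (simp add: Forms_def)

lemma Forms_homogeneous: "\<alpha> \<in> Forms k \<Longrightarrow> homogeneous k \<alpha>"
  by (simp add: homogeneous_def Forms_length)

lemma Forms_alternating: "\<alpha> \<in> Forms k \<Longrightarrow> \<not> distinct xs \<Longrightarrow> \<alpha> xs = 0"
  unfolding Forms_def by blast

lemma Forms_linear:
  assumes "\<alpha> \<in> Forms k"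
  shows "linear (\<lambda>x. \<alpha> (xs @ x # ys))"
proof (cases "length xs + 1 + length ys = k")
  case True
  then show ?thesis
    using assms unfolding Forms_def by blast
next
  case False
  then have "(\<lambda>x. \<alpha> (xs @ x # ys)) = (\<lambda>x. 0)"
    using assms by (auto simp: Forms_length)
  then show ?thesis
    by (simp add: linear_zero)
qed

lemma Forms_linear_hd: "\<alpha> \<in> Forms k \<Longrightarrow> linear (\<lambda>x. \<alpha> (x # ys))"
  using Forms_linear[of \<alpha> k "[]" ys] by simp

lemma Forms_swap:
  assumes "\<alpha> \<in> Forms k"
  shows "\<alpha> (us @ x # y # vs) = - \<alpha> (us @ y # x # vs)"
proof -
  have l1: "\<alpha> (us @ (a + b) # c # vs) = \<alpha> (us @ a # c # vs) + \<alpha> (us @ b # c # vs)" for a b c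
    by (rule linear_add[OF Forms_linear[OF assms]])
  have l2: "\<alpha> (us @ c # (a + b) # vs) = \<alpha> (us @ c # a # vs) + \<alpha> (us @ c # b # vs)" for a b c
    using linear_add[OF Forms_linear[OF assms, of "us @ [c]" vs], of a b] by simp
  have "\<alpha> (us @ z # z # vs) = 0" for z
    by (rule Forms_alternating[OF assms]) simp
  from this[of "x + y"] this[of x] this[of y] show ?thesis
    unfolding l1 l2 by simp
qed

lemma interior_prod_Forms:
  assumes "\<alpha> \<in> Forms (Suc k)"
  shows "interior_prod x \<alpha> \<in> Forms k"
proof -
  have "linear (\<lambda>y. \<alpha> (x # xs @ y # ys))" for xs ys
    using Forms_linear[OF assms, of "x # xs" ys] by simp
  then show ?thesis
    unfolding Forms_def[of k] interior_prod_def
    by (auto simp: Forms_length[OF assms] Forms_alternating[OF assms])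
qed

lemma interior_prod_Forms_0: "\<alpha> \<in> Forms 0 \<Longrightarrow> interior_prod x \<alpha> = 0"
  by (auto simp: interior_prod_def Forms_length)

lemma interior_prod_twice: "\<alpha> \<in> Forms k \<Longrightarrow> interior_prod x (interior_prod x \<alpha>) = 0"
  by (auto simp: interior_prod_def Forms_alternating)

lemma Forms_zero: "0 \<in> Forms k"
  by (auto simp: Forms_def linear_zero)

lemma Forms_add: "\<alpha> \<in> Forms k \<Longrightarrow> \<beta> \<in> Forms k \<Longrightarrow> \<alpha> + \<beta> \<in> Forms k"
  by (auto simp: Forms_def intro: linear_compose_add)

lemma Forms_scale: "\<alpha> \<in> Forms k \<Longrightarrow> c \<cdot> \<alpha> \<in> Forms k"
  by (auto simp: Forms_def scale_form_def intro: linear_cmult)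

lemma Forms_diff_scale: "\<alpha> \<in> Forms k \<Longrightarrow> \<beta> \<in> Forms k \<Longrightarrow> (\<lambda>xs. \<alpha> xs - c * \<beta> xs) \<in> Forms k"
  using Forms_add[OF _ Forms_scale, of \<alpha> k \<beta> "-c"]
  by (simp add: scale_form_def plus_fun_def)

text \<open>Alternation in all arguments follows from alternation in the first two together with that of
  the interior products: a repetition of the first argument further down is moved to the second place by
  one swap.\<close>

lemma Forms_SucI:
  assumes lin: "\<And>ys. linear (\<lambda>x. \<alpha> (x # ys))"
    and int: "\<And>x. interior_prod x \<alpha> \<in> Forms k"
    and alt: "\<And>x. interior_prod x (interior_prod x \<alpha>) = 0"
    and nil: "\<alpha> [] = 0"
  shows "\<alpha> \<in> Forms (Suc k)"
proof -
  have c: "\<alpha> (x # xs) = interior_prod x \<alpha> xs" for x xs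
    by (simp add: interior_prod_def)
  have sw: "\<alpha> (x # y # zs) = - \<alpha> (y # x # zs)" for x y zs
  proof -
    have l2: "linear (\<lambda>y. \<alpha> (x # y # zs))" for x
      unfolding c[of x] by (rule Forms_linear_hd[OF int])
    have z: "\<alpha> (z # z # zs) = 0" for z
      using fun_cong[OF alt, of z zs] by (simp add: interior_prod_def)
    have "\<alpha> ((x + y) # (x + y) # zs) = \<alpha> (x # x # zs) + \<alpha> (x # y # zs) + \<alpha> (y # x # zs) + \<alpha> (y # y # zs)"
      by (simp add: linear_add[OF lin] linear_add[OF l2])
    then show ?thesis
      by (simp add: z)
  qed
  have dup: "\<alpha> (x # us @ x # vs) = 0" for x us vs
  proof (cases us)
    case Nil
    then show ?thesis
      using fun_cong[OF alt, of x vs] by (simp add: interior_prod_def)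
  next
    case (Cons y us')
    then have "\<alpha> (x # us @ x # vs) = - interior_prod y \<alpha> (x # us' @ x # vs)"
      by (simp add: sw[of x y] interior_prod_def)
    then show ?thesis
      by (simp add: Forms_alternating[OF int])
  qed
  show ?thesis
    unfolding Forms_def
  proof (intro CollectI conjI allI impI)
    fix xs :: "vec6 list" assume "length xs \<noteq> Suc k"
    then show "\<alpha> xs = 0"
      by (cases xs) (auto simp: nil c Forms_length[OF int])
  next
    fix xs ys :: "vec6 list"
    show "linear (\<lambda>x. \<alpha> (xs @ x # ys))"
      using Forms_linear[OF int] by (cases xs) (simp_all add: lin, simp add: c)
  next
    fix xs :: "vec6 list" assume xs: "length xs = Suc k \<and> \<not> distinct xs"
    then obtain x ys where x: "xs = x # ys"
      by (cases xs) auto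
    show "\<alpha> xs = 0"
    proof (cases "x \<in> set ys")
      case True
      then show ?thesis
        using dup by (auto simp: x dest!: split_list)
    next
      case False
      then show ?thesis
        using xs by (simp add: x c Forms_alternating[OF int])
    qed
  qed
qed

section \<open>Products of alternating forms\<close>

lemma wedge_length:
  assumes "homogeneous p \<alpha>" "homogeneous q \<beta>" "length xs \<noteq> p + q"
  shows "(\<alpha> \<^bold>\<and> \<beta>) xs = 0"
proof -
  have "\<alpha> (nths xs I) = 0 \<or> \<beta> (nths xs (- I)) = 0" if "I \<in> Pow {..<length xs}" for I
  proof -
    have "{i. i < length xs \<and> i \<in> I} = I" "{i. i < length xs \<and> i \<in> - I} = {..<length xs} - I"
      using that by auto
    then have "length (nths xs I) = card I" "length (nths xs (- I)) = length xs - card I"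
      using that by (auto simp: length_nths card_Diff_subset finite_subset)
    moreover have "card I \<le> length xs"
      using that card_mono[of "{..<length xs}" I] by auto
    ultimately show ?thesis
      using assms by (cases "card I = p") (auto simp: homogeneous_def)
  qed
  then show ?thesis
    unfolding wedge_def by (intro sum.neutral) auto
qed

lemma linear_wedge_left:
  assumes "\<And>zs. linear (\<lambda>x. f x zs)"
  shows "linear (\<lambda>x. (f x \<^bold>\<and> \<beta>) ys)"
  unfolding wedge_def mult.assoc
  by (intro linear_compose_sum ballI linear_cmult) (use assms in auto)

lemma linear_wedge_right:
  assumes "\<And>zs. linear (\<lambda>x. f x zs)"
  shows "linear (\<lambda>x. (\<alpha> \<^bold>\<and> f x) ys)"
  unfolding wedge_def by (intro linear_compose_sum ballI linear_cmult) (use assms in auto)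

lemma wedge_0_left [simp]: "0 \<^bold>\<and> \<beta> = 0" and wedge_0_right [simp]: "\<beta> \<^bold>\<and> 0 = 0"
  by (auto simp: wedge_def)

lemma interior_prod_wedge:
  assumes "homogeneous p \<alpha>"
  shows "interior_prod x (\<alpha> \<^bold>\<and> \<beta>) = (interior_prod x \<alpha> \<^bold>\<and> \<beta>) + (-1) ^ p \<cdot> (\<alpha> \<^bold>\<and> interior_prod x \<beta>)"
  by (rule ext) (simp add: interior_prod_def[of x "\<alpha> \<^bold>\<and> \<beta>"] wedge_Cons[OF assms] scale_form_def)

lemma interior_prod_add: "interior_prod x (\<alpha> + \<beta>) = interior_prod x \<alpha> + interior_prod x \<beta>"
  and interior_prod_scale: "interior_prod x (c \<cdot> \<alpha>) = c \<cdot> interior_prod x \<alpha>"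
  by (auto simp: interior_prod_def scale_form_def)

text \<open>Induction on the total degree by the Leibniz rule. The mixed terms of \<open>i\<^sub>x i\<^sub>x (\<alpha> \<and> \<beta>)\<close> carry opposite
  signs and cancel.\<close>

lemma wedge_Forms:
  assumes "\<alpha> \<in> Forms p" "\<beta> \<in> Forms q"
  shows "\<alpha> \<^bold>\<and> \<beta> \<in> Forms (p + q)"
  using assms
proof (induction "p + q" arbitrary: p q \<alpha> \<beta>)
  case 0
  then show ?case
    by (auto simp: Forms_def[of 0] intro!: wedge_length[of 0 _ 0] Forms_homogeneous)
next
  case (Suc n)
  have ia: "interior_prod x \<alpha> \<^bold>\<and> \<beta> \<in> Forms n" for x
  proof (cases p)
    case 0
    then show ?thesis
      using Suc.prems by (simp add: interior_prod_Forms_0 Forms_zero)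
  next
    case (Suc p')
    then show ?thesis
      using Suc.hyps(1)[of p' q] Suc.hyps(2) Suc.prems by (simp add: interior_prod_Forms)
  qed
  have ib: "\<alpha> \<^bold>\<and> interior_prod x \<beta> \<in> Forms n" for x
  proof (cases q)
    case 0
    then show ?thesis
      using Suc.prems by (simp add: interior_prod_Forms_0 Forms_zero)
  next
    case (Suc q')
    then show ?thesis
      using Suc.hyps(1)[of p q'] Suc.hyps(2) Suc.prems by (simp add: interior_prod_Forms)
  qed
  note h = Forms_homogeneous[OF Suc.prems(1)]
  have "\<alpha> \<^bold>\<and> \<beta> \<in> Forms (Suc n)"
  proof (rule Forms_SucI)
    fix ys
    show "linear (\<lambda>x. (\<alpha> \<^bold>\<and> \<beta>) (x # ys))"
      unfolding wedge_Cons[OF h]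
      by (intro linear_compose_add linear_cmult linear_wedge_left linear_wedge_right)
        (simp_all only: interior_prod_def Forms_linear_hd[OF Suc.prems(1)] Forms_linear_hd[OF Suc.prems(2)])
  next
    fix x
    show "interior_prod x (\<alpha> \<^bold>\<and> \<beta>) \<in> Forms n"
      unfolding interior_prod_wedge[OF h] by (intro Forms_add Forms_scale ia ib)
    show "interior_prod x (interior_prod x (\<alpha> \<^bold>\<and> \<beta>)) = 0"
    proof (cases p)
      case 0
      then show ?thesis
        using Suc.prems
        by (simp add: interior_prod_wedge[OF h] interior_prod_add interior_prod_scale interior_prod_Forms_0
            interior_prod_twice scale_form_def) (simp add: fun_eq_iff)
    next
      case (Suc p')
      then have h': "homogeneous p' (interior_prod x \<alpha>)"
        using Suc.prems by (simp add: interior_prod_Forms Forms_homogeneous)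
      show ?thesis
        unfolding interior_prod_wedge[OF h] interior_prod_add interior_prod_scale interior_prod_wedge[OF h']
          interior_prod_twice[OF Suc.prems(1)] interior_prod_twice[OF Suc.prems(2)]
        by (simp add: scale_form_def fun_eq_iff \<open>p = Suc p'\<close>)
    qed
  next
    show "(\<alpha> \<^bold>\<and> \<beta>) [] = 0"
      using Suc.hyps(2) by (intro wedge_length[of p _ q] Forms_homogeneous Suc.prems) auto
  qed
  then show ?case
    using Suc.hyps(2) by simp
qed

section \<open>Forms are determined by their values on a basis\<close>

text \<open>Sorting is a sequence of adjacent swaps and each of them changes only the sign. Only the vanishing
  is recorded, which avoids signs of permutations.\<close>

lemma Forms_sort_zero_iff:
  fixes b :: "nat \<Rightarrow> vec6"
  assumes "\<alpha> \<in> Forms k"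
  shows "\<alpha> (us @ map b (sort is)) = 0 \<longleftrightarrow> \<alpha> (us @ map b is) = 0"
proof -
  have ins: "\<alpha> (us @ map b (insort i js)) = 0 \<longleftrightarrow> \<alpha> (us @ map b (i # js)) = 0" for us i js
  proof (induction js arbitrary: us)
    case (Cons j js)
    show ?case
      using Cons.IH[of "us @ [b j]"] Forms_swap[OF assms, of us "b j" "b i" "map b js"] by auto
  qed simp
  show ?thesis
  proof (induction "is" arbitrary: us)
    case (Cons i "is")
    show ?case
      using ins[of us i "sort is"] Cons.IH[of "us @ [b i]"] by simp
  qed simp
qed

text \<open>By multilinearity it is enough to insert spanning vectors, and by alternation these may be taken
  in increasing order.\<close>

lemma Forms_eq_0I:
  fixes b :: "nat \<Rightarrow> vec6"
  assumes \<alpha>: "\<alpha> \<in> Forms k" and span: "span (b ` {..<n}) = UNIV"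
    and zero: "\<And>S. S \<subseteq> {..<n} \<Longrightarrow> card S = k \<Longrightarrow> \<alpha> (map b (sorted_list_of_set S)) = 0"
  shows "\<alpha> = 0"
proof -
  have idx: "\<alpha> (map b is) = 0" if "set is \<subseteq> {..<n}" for "is"
  proof (cases "length is = k \<and> distinct is")
    case True
    then have "\<alpha> (map b (sorted_list_of_set (set is))) = 0"
      using that by (intro zero) (auto simp: distinct_card)
    then have "\<alpha> (map b (sort is)) = 0"
      using True by (simp add: sorted_list_of_set_sort_remdups distinct_remdups_id)
    then show ?thesis
      using Forms_sort_zero_iff[OF \<alpha>, of "[]" b "is"] by simp
  next
    case False
    then show ?thesis
      using Forms_length[OF \<alpha>] Forms_alternating[OF \<alpha>] by (metis distinct_map length_map)
  qed
  have "\<alpha> (xs @ map b is) = 0" if "set is \<subseteq> {..<n}" for xs "is"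
    using that
  proof (induction xs arbitrary: "is" rule: rev_induct)
    case Nil
    then show ?case
      by (simp add: idx)
  next
    case (snoc x xs)
    have "\<alpha> (xs @ x # map b is) = 0"
    proof (rule linear_eq_0_on_span[of "\<lambda>x. \<alpha> (xs @ x # map b is)" "b ` {..<n}"])
      show "linear (\<lambda>x. \<alpha> (xs @ x # map b is))"
        by (rule Forms_linear[OF \<alpha>])
      fix y assume "y \<in> b ` {..<n}"
      then obtain i where "i < n" "y = b i" by auto
      then show "\<alpha> (xs @ y # map b is) = 0"
        using snoc.IH[of "i # is"] snoc.prems by simp
    qed (simp add: span)
    then show ?case by simp
  qed
  from this[of "[]"] show ?thesis
    by (auto simp: fun_eq_iff)
qed

lemma Forms_6_basis_nonzero:
  fixes b :: "nat \<Rightarrow> vec6"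
  assumes "\<mu> \<in> Forms 6" "\<mu> \<noteq> 0" "span (b ` {..<6}) = UNIV"
  shows "\<mu> (map b [0..<6]) \<noteq> 0"
proof
  assume z: "\<mu> (map b [0..<6]) = 0"
  have "\<mu> = 0"
  proof (rule Forms_eq_0I[OF assms(1,3)])
    fix S :: "nat set" assume S: "S \<subseteq> {..<6}" "card S = 6"
    then have "S = {..<6}"
      by (intro card_subset_eq) auto
    then show "\<mu> (map b (sorted_list_of_set S)) = 0"
      using z by (simp add: lessThan_atLeast0)
  qed
  with assms(2) show False ..
qed

text \<open>Extend the given vectors to a basis; a nonzero volume form does not vanish on it.\<close>

lemma Forms_6_extend_nonzero:
  assumes \<mu>: "\<mu> \<in> Forms 6" "\<mu> \<noteq> 0" and vs: "distinct vs" "independent (set vs)"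
  obtains ys where "length vs + length ys = 6" "\<mu> (vs @ ys) \<noteq> 0"
proof -
  obtain B where B: "set vs \<subseteq> B" "independent B" "UNIV \<subseteq> span B"
    using maximal_independent_subset_extend[of "set vs" UNIV] vs(2) by auto
  have fin: "finite B"
    using B(2) by (rule independent_imp_finite)
  have card: "card B = 6"
    using B dim_eq_card[of B "UNIV :: vec6 set"] by (simp add: subset_antisym[OF subset_UNIV])
  obtain ys where ys: "set ys = B - set vs" "distinct ys"
    using finite_distinct_list[of "B - set vs"] fin by auto
  have l: "length (vs @ ys) = 6"
    using vs(1) ys B(1) card distinct_card[of "vs @ ys"] by (auto simp: Un_absorb1)
  have "map (nth (vs @ ys)) [0..<6] = vs @ ys"
    using map_nth[of "vs @ ys"] l by simp
  moreover have "nth (vs @ ys) ` {..<6} = B"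
    using l ys B(1) nth_image[of 6 "vs @ ys"] by (auto simp: lessThan_atLeast0)
  ultimately have "\<mu> (vs @ ys) \<noteq> 0"
    using Forms_6_basis_nonzero[OF \<mu>, of "nth (vs @ ys)"] B(3) by auto
  with l that show thesis by auto
qed

lemma ex_basis_family:
  obtains b :: "nat \<Rightarrow> vec6" where "span (b ` {..<6}) = UNIV"
proof -
  obtain xs :: "vec6 list" where xs: "set xs = Basis" "distinct xs"
    using finite_distinct_list[of "Basis :: vec6 set"] by auto
  have "length xs = 6"
    using distinct_card[OF xs(2)] xs(1) by simp
  then have "nth xs ` {..<6} = Basis"
    using xs nth_image[of 6 xs] by (auto simp: lessThan_atLeast0)
  then show thesis
    using that[of "nth xs"] span_Basis by simp
qed

lemma Forms_6_one_dimensional: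
  assumes "\<mu> \<in> Forms 6" "\<nu> \<in> Forms 6" "\<nu> \<noteq> 0"
  obtains c where "\<mu> = c \<cdot> \<nu>"
proof -
  obtain b :: "nat \<Rightarrow> vec6" where b: "span (b ` {..<6}) = UNIV"
    by (rule ex_basis_family)
  define c where "c = \<mu> (map b [0..<6]) / \<nu> (map b [0..<6])"
  have nz: "\<nu> (map b [0..<6]) \<noteq> 0"
    by (rule Forms_6_basis_nonzero[OF assms(2,3) b])
  have "(\<lambda>xs. \<mu> xs - c * \<nu> xs) = 0"
    using Forms_6_basis_nonzero[OF Forms_diff_scale[OF assms(1,2)] _ b, of c] nz
    by (auto simp: c_def)
  then have "\<mu> = c \<cdot> \<nu>"
    by (auto simp: fun_eq_iff scale_form_def)
  then show thesis ..
qed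

lemma interior_prod_linear: "\<mu> \<in> Forms k \<Longrightarrow> linear (\<lambda>v. interior_prod v \<mu> xs)"
  unfolding interior_prod_def by (rule Forms_linear_hd)

lemma interior_prod_Forms_6_inj:
  assumes "\<mu> \<in> Forms 6" "\<mu> \<noteq> 0" "interior_prod v \<mu> = interior_prod w \<mu>"
  shows "v = w"
proof (rule ccontr)
  assume "v \<noteq> w"
  then have "independent (set [v - w])" "distinct [v - w]"
    by (auto simp: dependent_single)
  then obtain ys where "\<mu> ([v - w] @ ys) \<noteq> 0"
    by (metis Forms_6_extend_nonzero[OF assms(1,2)])
  moreover have "\<mu> ([v - w] @ ys) = interior_prod v \<mu> ys - interior_prod w \<mu> ys"
    using linear_diff[OF interior_prod_linear[OF assms(1), where xs = ys], of v w] by (simp add: interior_prod_def)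
  ultimately show False
    using assms(3) by simp
qed

text \<open>The coordinates of \<open>v\<close> can be prescribed one at a time: inserting all basis vectors but \<open>b\<^sub>i\<close> into
  \<open>i\<^sub>v \<mu>\<close> picks out the \<open>i\<close>-th coordinate of \<open>v\<close>.\<close>

lemma Forms_5_interior_prod:
  assumes \<gamma>: "\<gamma> \<in> Forms 5" and \<mu>: "\<mu> \<in> Forms 6" "\<mu> \<noteq> 0"
  obtains v where "interior_prod v \<mu> = \<gamma>"
proof -
  obtain b :: "nat \<Rightarrow> vec6" where b: "span (b ` {..<6}) = UNIV"
    by (rule ex_basis_family)
  define L where "L i = sorted_list_of_set ({..<6} - {i})" for i :: nat
  \<comment> \<open>\<open>L i\<close> lists all basis vectors except \<open>b i\<close>\<close>
  define v where "v = (\<Sum>i<6. (\<gamma> (map b (L i)) / \<mu> (b i # map b (L i))) *\<^sub>R b i)"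
  have nz: "\<mu> (b i # map b (L i)) \<noteq> 0" if "i < 6" for i
  proof -
    have "sort (i # L i) = sorted_list_of_set (insert i ({..<6} - {i}))"
      by (subst sorted_list_of_set_insert) (auto simp: L_def sort_key_id_if_sorted sorted_sort_id)
    also have "insert i ({..<6} - {i}) = {0..<6}"
      using that by auto
    finally have "sort (i # L i) = [0..<6]" by simp
    then show ?thesis
      using Forms_6_basis_nonzero[OF \<mu> b] Forms_sort_zero_iff[OF \<mu>(1), of "[]" b "i # L i"] by simp
  qed
  have "(\<lambda>xs. interior_prod v \<mu> xs - 1 * \<gamma> xs) = 0"
  proof (rule Forms_eq_0I[OF Forms_diff_scale b])
    show "interior_prod v \<mu> \<in> Forms 5"
      using \<mu>(1) by (intro interior_prod_Forms) (simp add: eval_nat_numeral)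
    fix S :: "nat set" assume S: "S \<subseteq> {..<6}" "card S = 5"
    have "card ({..<6} - S) = 1"
      using S by (simp add: card_Diff_subset finite_subset)
    then obtain i where i: "{..<6} - S = {i}"
      by (auto simp: card_1_singleton_iff)
    then have Si: "S = {..<6} - {i}" and "i < 6"
      using S by auto
    have fin: "finite S"
      using S by (auto intro: finite_subset)
    have "interior_prod v \<mu> (map b (L i)) =
        (\<Sum>j<6. \<gamma> (map b (L j)) / \<mu> (b j # map b (L j)) * interior_prod (b j) \<mu> (map b (L i)))"
      unfolding v_def by (simp add: linear_sum[OF interior_prod_linear[OF \<mu>(1)]]
          linear_scale[OF interior_prod_linear[OF \<mu>(1)]])
    also have "\<dots> = (\<Sum>j\<in>{i}. \<gamma> (map b (L j)) / \<mu> (b j # map b (L j)) * interior_prod (b j) \<mu> (map b (L i)))"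
    proof (rule sum.mono_neutral_right)
      show "\<forall>j\<in>{..<6} - {i}. \<gamma> (map b (L j)) / \<mu> (b j # map b (L j)) * interior_prod (b j) \<mu> (map b (L i)) = 0"
        by (auto simp: interior_prod_def L_def intro!: Forms_alternating[OF \<mu>(1)])
    qed (use \<open>i < 6\<close> in auto)
    also have "\<dots> = \<gamma> (map b (L i))"
      using nz[OF \<open>i < 6\<close>] by (simp add: interior_prod_def)
    finally show "interior_prod v \<mu> (map b (sorted_list_of_set S)) - 1 * \<gamma> (map b (sorted_list_of_set S)) = 0"
      by (simp add: Si L_def)
  qed (rule \<gamma>)
  then have "interior_prod v \<mu> = \<gamma>"
    by (auto simp: fun_eq_iff)
  then show thesis ..
qed

section \<open>The endomorphism of a stable 3-form\<close>

text \<open>Rescaling the volume form is compensated by the vector, so the tensor \<open>v \<otimes> \<mu>\<close> does not depend on the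
  choice.\<close>

lemma isoA_interior_prod:
  assumes \<mu>: "\<mu> \<in> Forms 6" "\<mu> \<noteq> 0"
  shows "isoA (interior_prod v \<mu>) = vtensor v \<mu>"
  unfolding isoA_def
proof (rule the_equality)
  show "\<exists>w. \<exists>\<Omega>\<in>Forms 6. \<Omega> \<noteq> 0 \<and> interior_prod w \<Omega> = interior_prod v \<mu> \<and> vtensor v \<mu> = vtensor w \<Omega>"
    using \<mu> by blast
  fix T assume "\<exists>w. \<exists>\<Omega>\<in>Forms 6. \<Omega> \<noteq> 0 \<and> interior_prod w \<Omega> = interior_prod v \<mu> \<and> T = vtensor w \<Omega>"
  then obtain w \<Omega> where w: "\<Omega> \<in> Forms 6" "interior_prod w \<Omega> = interior_prod v \<mu>" "T = vtensor w \<Omega>"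
    by blast
  obtain c where c: "\<Omega> = c \<cdot> \<mu>"
    using Forms_6_one_dimensional[OF w(1) \<mu>] by blast
  have "interior_prod (c *\<^sub>R w) \<mu> = interior_prod w \<Omega>"
    by (rule ext) (simp add: c interior_prod_def scale_form_def linear_scale[OF Forms_linear_hd[OF \<mu>(1)]])
  then have "c *\<^sub>R w = v"
    using interior_prod_Forms_6_inj[OF \<mu>] w(2) by simp
  then show "T = vtensor v \<mu>"
    by (auto simp: w(3) c vtensor_def scale_form_def mult.commute)
qed

text \<open>Negativity of \<open>\<lambda>(\<psi>)\<close> provides a square root up to sign, and the orientation fixes the sign. The
  other alternative \<open>\<lambda>(\<psi>) = \<mu> \<otimes> \<mu>\<close> is excluded by evaluating on a list twice.\<close>

lemma sqrt_abs_lam_properties: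
  assumes \<tau>: "\<tau> \<in> Forms 6" "\<tau> \<noteq> 0" and \<psi>: "lam_neg \<psi>"
  defines "\<mu> \<equiv> sqrt_abs_lam \<tau> \<psi>"
  shows "\<mu> \<in> Forms 6" "\<mu> \<noteq> 0" "lam \<psi> = - tensor2 \<mu> \<mu>"
proof -
  let ?P = "\<lambda>\<mu>. \<mu> \<in> Forms 6 \<and> (\<exists>c>0. \<mu> = c \<cdot> \<tau>) \<and> (lam \<psi> = tensor2 \<mu> \<mu> \<or> lam \<psi> = - tensor2 \<mu> \<mu>)"
  obtain \<Omega> where \<Omega>: "\<Omega> \<in> Forms 6" "\<Omega> \<noteq> 0" "lam \<psi> = - tensor2 \<Omega> \<Omega>"
    using \<psi> unfolding lam_neg_def by blast
  obtain d where d: "\<Omega> = d \<cdot> \<tau>"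
    using Forms_6_one_dimensional[OF \<Omega>(1) \<tau>] by blast
  have "d \<noteq> 0"
    using \<Omega>(2) d by (auto simp: scale_form_def fun_eq_iff)
  obtain xs where xs: "\<tau> xs \<noteq> 0"
    using \<tau>(2) by (auto simp: fun_eq_iff)
  have lam: "lam \<psi> = (\<lambda>xs ys. - (d\<^sup>2 * \<tau> xs * \<tau> ys))"
    by (auto simp: \<Omega>(3) d tensor2_def scale_form_def fun_eq_iff power2_eq_square)
  have ex: "?P (\<bar>d\<bar> \<cdot> \<tau>)"
    using \<open>d \<noteq> 0\<close> Forms_scale[OF \<tau>(1)]
    by (auto simp: lam tensor2_def scale_form_def fun_eq_iff power2_eq_square)
      (metis abs_mult_self_eq zero_less_abs_iff)+
  have uniq: "\<mu>' = \<bar>d\<bar> \<cdot> \<tau>" and neg: "lam \<psi> = - tensor2 \<mu>' \<mu>'" if P: "?P \<mu>'" for \<mu>'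
  proof -
    obtain c where c: "c > 0" "\<mu>' = c \<cdot> \<tau>"
      using P by blast
    have *: "lam \<psi> xs xs = tensor2 \<mu>' \<mu>' xs xs \<or> lam \<psi> xs xs = - tensor2 \<mu>' \<mu>' xs xs"
      using P by auto
    have "tensor2 \<mu>' \<mu>' xs xs = c\<^sup>2 * (\<tau> xs)\<^sup>2" "lam \<psi> xs xs = - (d\<^sup>2 * (\<tau> xs)\<^sup>2)"
      by (simp_all add: c tensor2_def scale_form_def lam power2_eq_square)
    moreover have "c\<^sup>2 * (\<tau> xs)\<^sup>2 > 0" "d\<^sup>2 * (\<tau> xs)\<^sup>2 > 0"
      using c(1) \<open>d \<noteq> 0\<close> xs by simp_all
    ultimately have eq: "c\<^sup>2 * (\<tau> xs)\<^sup>2 = d\<^sup>2 * (\<tau> xs)\<^sup>2" and ne: "lam \<psi> \<noteq> tensor2 \<mu>' \<mu>'"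
      using * by (force simp: fun_eq_iff)+
    have "c\<^sup>2 = \<bar>d\<bar>\<^sup>2"
      using eq xs by simp
    then have "c = \<bar>d\<bar>"
      by (rule power2_eq_imp_eq) (use c(1) in auto)
    then show "\<mu>' = \<bar>d\<bar> \<cdot> \<tau>" "lam \<psi> = - tensor2 \<mu>' \<mu>'"
      using c(2) ne P by auto
  qed
  have "\<mu> = \<bar>d\<bar> \<cdot> \<tau>"
    unfolding \<mu>_def sqrt_abs_lam_def by (rule the_equality[where P = ?P]) (fact ex, fact uniq)
  then have "?P \<mu>"
    using ex by simp
  then show "\<mu> \<in> Forms 6" "lam \<psi> = - tensor2 \<mu> \<mu>"
    using neg by auto
  show "\<mu> \<noteq> 0"
    using \<open>\<mu> = _\<close> \<open>d \<noteq> 0\<close> xs by (auto simp: scale_form_def fun_eq_iff)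
qed

lemma Kmap_eq:
  assumes \<psi>: "\<psi> \<in> Forms 3" and \<mu>: "\<mu> \<in> Forms 6" "\<mu> \<noteq> 0"
  obtains w where "interior_prod w \<mu> = interior_prod v \<psi> \<^bold>\<and> \<psi>" "Kmap \<psi> v = vtensor w \<mu>"
proof -
  have "interior_prod v \<psi> \<in> Forms 2"
    using interior_prod_Forms[of \<psi> 2 v] \<psi> by simp
  then have "interior_prod v \<psi> \<^bold>\<and> \<psi> \<in> Forms 5"
    using wedge_Forms[of "interior_prod v \<psi>" 2 \<psi> 3] \<psi> by simp
  then obtain w where "interior_prod w \<mu> = interior_prod v \<psi> \<^bold>\<and> \<psi>"
    by (rule Forms_5_interior_prod[OF _ \<mu>])
  then show thesis
    using that isoA_interior_prod[OF \<mu>, of w] by (simp add: Kmap_def)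
qed

lemma Jmap_properties:
  assumes \<tau>: "\<tau> \<in> Forms 6" "\<tau> \<noteq> 0" and \<psi>: "\<psi> \<in> Forms 3" "lam_neg \<psi>"
  defines "\<mu> \<equiv> sqrt_abs_lam \<tau> \<psi>" and "J \<equiv> Jmap \<tau> \<psi>"
  shows "interior_prod (- J v) \<mu> = interior_prod v \<psi> \<^bold>\<and> \<psi>" "Kmap \<psi> v = vtensor (- J v) \<mu>"
proof -
  note \<mu> = sqrt_abs_lam_properties[OF \<tau> \<psi>(2), folded \<mu>_def]
  obtain w where w: "interior_prod w \<mu> = interior_prod v \<psi> \<^bold>\<and> \<psi>" "Kmap \<psi> v = vtensor w \<mu>"
    by (rule Kmap_eq[OF \<psi>(1) \<mu>(1,2)])
  obtain xs where xs: "\<mu> xs \<noteq> 0"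
    using \<mu>(2) by (auto simp: fun_eq_iff)
  have "J v = - w"
    unfolding J_def Jmap_def \<mu>_def[symmetric]
  proof (rule the_equality)
    show "Kmap \<psi> v = - vtensor (- w) \<mu>"
      by (auto simp: w(2) vtensor_def)
    fix u assume "Kmap \<psi> v = - vtensor u \<mu>"
    then have "vtensor w \<mu> xs = - vtensor u \<mu> xs"
      by (simp add: w(2))
    then have "\<mu> xs *\<^sub>R (u + w) = 0"
      by (simp add: vtensor_def algebra_simps)
    then show "u = - w"
      using xs by (simp add: add_eq_0_iff2)
  qed
  then show "interior_prod (- J v) \<mu> = interior_prod v \<psi> \<^bold>\<and> \<psi>" "Kmap \<psi> v = vtensor (- J v) \<mu>"
    using w by simp_all
qed

text \<open>With \<open>x\<close> also among the arguments only the products of two values of \<open>i\<^sub>x \<psi>\<close> survive, and the sum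
  is twice the Pfaffian of \<open>i\<^sub>x \<psi>\<close> on \<open>a, b, c, d\<close>.\<close>

lemma wedge_2_3_repeated:
  assumes \<psi>: "\<psi> \<in> Forms 3"
  shows "(interior_prod x \<psi> \<^bold>\<and> \<psi>) [x, a, b, c, d] =
    2 * (\<psi> [x, a, b] * \<psi> [x, c, d] - \<psi> [x, a, c] * \<psi> [x, b, d] + \<psi> [x, a, d] * \<psi> [x, b, c])"
proof -
  let ?i = interior_prod
  have i2: "?i x \<psi> \<in> Forms 2" for x
    using interior_prod_Forms[of \<psi> 2 x] \<psi> by simp
  have i1: "?i y (?i x \<psi>) \<in> Forms 1" for x y
    using interior_prod_Forms[of "?i x \<psi>" 1 y] i2 by (simp add: numeral_2_eq_2)
  have i0: "?i z (?i y (?i x \<psi>)) \<in> Forms 0" for x y z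
    using interior_prod_Forms[of "?i y (?i x \<psi>)" 0 z] i1 by simp
  have z: "?i w (?i z (?i y (?i x \<psi>))) = 0" for x y z w
    by (rule interior_prod_Forms_0[OF i0])
  have dist: "?i x (?i x \<psi>) = 0" for x
    by (rule interior_prod_twice[OF \<psi>])
  note ws = wedge_Cons[OF Forms_homogeneous[OF i2]] wedge_Cons[OF Forms_homogeneous[OF i1]]
    wedge_Cons[OF Forms_homogeneous[OF i0]]
  show ?thesis
    by (simp add: ws z dist wedge_Nil) (simp add: interior_prod_def Forms_length[OF \<psi>])
qed

section \<open>The almost complex structure of an SU(3)-structure\<close>

text \<open>What is needed of an SU(3)-structure inducing the Euclidean metric, with \<open>\<mu> = \<surd>|\<lambda>(\<psi>)|\<close> and
  \<open>J = J\<^sub>\<psi>\<close>. That \<open>J\<close> is linear and squares to \<open>-1\<close> is a consequence.\<close>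

locale metric_su3 =
  fixes \<omega> \<psi> \<mu> :: form and J :: "vec6 \<Rightarrow> vec6"
  assumes \<omega>: "\<omega> \<in> Forms 2" and \<psi>: "\<psi> \<in> Forms 3" and \<mu>: "\<mu> \<in> Forms 6" "\<mu> \<noteq> 0"
    and metric: "\<omega> [x, J y] = x \<bullet> y"
    and wedge_eq: "interior_prod x \<psi> \<^bold>\<and> \<psi> = interior_prod (- J x) \<mu>"
    and Kmap_vtensor: "Kmap \<psi> x = vtensor (- J x) \<mu>"
    and lam_eq: "lam \<psi> = - tensor2 \<mu> \<mu>"
begin

lemma \<omega>_linear: "linear (\<lambda>x. \<omega> [x, y])" "linear (\<lambda>y. \<omega> [x, y])"
  using Forms_linear[OF \<omega>, of "[]" "[y]"] Forms_linear[OF \<omega>, of "[x]" "[]"] by simp_all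

lemma \<omega>_skew: "\<omega> [y, x] = - \<omega> [x, y]"
  using Forms_swap[OF \<omega>, of "[]" y x "[]"] by simp

lemma \<psi>_linear:
  "linear (\<lambda>x. \<psi> [x, y, z])" "linear (\<lambda>y. \<psi> [x, y, z])" "linear (\<lambda>z. \<psi> [x, y, z])"
  using Forms_linear[OF \<psi>, of "[]" "[y, z]"] Forms_linear[OF \<psi>, of "[x]" "[z]"]
    Forms_linear[OF \<psi>, of "[x, y]" "[]"] by simp_all

lemma \<psi>_swap: "\<psi> [y, x, z] = - \<psi> [x, y, z]" "\<psi> [x, z, y] = - \<psi> [x, y, z]"
  using Forms_swap[OF \<psi>, of "[]" y x "[z]"] Forms_swap[OF \<psi>, of "[x]" z y "[]"] by simp_all

lemma \<psi>_repeated [simp]: "\<psi> [x, x, z] = 0" "\<psi> [x, z, z] = 0" "\<psi> [x, z, x] = 0"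
  by (auto intro: Forms_alternating[OF \<psi>])

text \<open>The identity \<open>\<omega>(x, J y) = \<langle>x, y\<rangle>\<close> makes \<open>J\<close> a right inverse of the linear map that represents \<open>\<omega>\<close>; in
  finite dimension that map is invertible and \<open>J\<close> is its inverse.\<close>

lemma J_linear: "linear J"
proof -
  define A where "A y = (\<Sum>b\<in>Basis. \<omega> [b, y] *\<^sub>R b)" for y
  have A: "linear A"
    unfolding A_def
    by (intro linear_compose_sum ballI) (use \<omega>_linear in \<open>simp add: linear_iff scaleR_add_left\<close>)
  have AJ: "A (J y) = y" for y
    by (simp add: A_def metric inner_commute[of _ y] euclidean_representation)
  have "surj A"
    using AJ by (metis surjI)
  then have "inj A"
    using A by (simp add: linear_surjective_imp_injective)
  then show ?thesis
    by (intro linearI; elim injD) (simp_all add: linear_add[OF A] linear_scale[OF A] AJ)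
qed

lemma trace_J2: "trace (matrix (\<lambda>x. J (J x))) = - 6"
proof -
  obtain xs where xs: "\<mu> xs \<noteq> 0"
    using \<mu>(2) by (auto simp: fun_eq_iff)
  have "Kmap \<psi> (Kmap \<psi> x xs) xs = (\<mu> xs)\<^sup>2 *\<^sub>R J (J x)" for x
    by (simp add: Kmap_vtensor vtensor_def linear_neg[OF J_linear] linear_scale[OF J_linear] power2_eq_square)
  then have "trace (matrix (\<lambda>x. Kmap \<psi> (Kmap \<psi> x xs) xs)) = (\<mu> xs)\<^sup>2 * trace (matrix (\<lambda>x. J (J x)))"
    by (simp add: trace_def matrix_def sum_distrib_left)
  then have "(\<mu> xs)\<^sup>2 * trace (matrix (\<lambda>x. J (J x))) = (\<mu> xs)\<^sup>2 * (- 6)"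
    using fun_cong[OF fun_cong[OF lam_eq, of xs], of xs]
    by (simp add: lam_def tensor2_def power2_eq_square)
  then show ?thesis
    using xs by (simp only: mult_cancel_left power_eq_0_iff) simp
qed

lemma J_skew: "J x \<bullet> y = - (x \<bullet> J y)"
  using \<omega>_skew[of "J x" "J y"] by (simp add: metric inner_commute)

lemma J_orth [simp]: "x \<bullet> J x = 0" "J x \<bullet> x = 0"
  using J_skew[of x x] by (simp_all add: inner_commute)

lemma J_eq_0_iff: "J x = 0 \<longleftrightarrow> x = 0"
  using metric[of x x] linear_0[OF \<omega>_linear(2)] linear_0[OF J_linear] by force

text \<open>The key identity: \<open>i\<^sub>x \<psi>\<close> is nondegenerate on every complement of the plane of \<open>x\<close> and \<open>J x\<close>, and its
  Pfaffian vanishes as soon as that plane is met.\<close>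

lemma Pfaffian_interior_prod:
  "\<psi> [x, a, b] * \<psi> [x, c, d] - \<psi> [x, a, c] * \<psi> [x, b, d] + \<psi> [x, a, d] * \<psi> [x, b, c] =
    - \<mu> [J x, x, a, b, c, d] / 2"
proof -
  have "\<mu> [- J x, x, a, b, c, d] = - \<mu> [J x, x, a, b, c, d]"
    by (rule linear_neg[OF Forms_linear_hd[OF \<mu>(1)]])
  then show ?thesis
    using fun_cong[OF wedge_eq, of x "[x, a, b, c, d]"]
    by (simp add: wedge_2_3_repeated[OF \<psi>]) (simp add: interior_prod_def)
qed

lemma independent_J: "x \<noteq> 0 \<Longrightarrow> independent {J x, x}" "x \<noteq> 0 \<Longrightarrow> J x \<noteq> x"
proof -
  assume x: "x \<noteq> 0"
  then show ne: "J x \<noteq> x"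
    using J_orth(1)[of x] by (metis inner_eq_zero_iff)
  have "pairwise orthogonal {J x, x}"
    by (auto simp: pairwise_insert orthogonal_def)
  then show "independent {J x, x}"
    using x by (intro pairwise_orthogonal_independent) (auto simp: J_eq_0_iff)
qed

text \<open>Let \<open>\<beta> = i\<^sub>x \<psi>\<close> and \<open>\<theta> = i\<^bsub>J x\<^esub> \<beta>\<close>. Since \<open>i\<^sub>x i\<^bsub>J x\<^esub> \<mu>\<close> vanishes on \<open>J x\<close>, the 4-form \<open>\<beta> \<and> \<beta>\<close> does
  too, that is \<open>\<theta> \<and> \<beta> = 0\<close>. Then \<open>0 = i\<^sub>z (\<theta> \<and> \<beta> \<and> \<beta>) = \<theta>(z) \<beta> \<and> \<beta>\<close>, and \<open>\<beta> \<and> \<beta> \<noteq> 0\<close>.\<close>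

lemma \<psi>_J_kernel [simp]: "\<psi> [x, J x, z] = 0"
proof (cases "x = 0")
  case True
  then show ?thesis
    using linear_0[OF \<psi>_linear(1)] by simp
next
  case False
  then obtain ys where ys: "length [J x, x] + length ys = 6" "\<mu> ([J x, x] @ ys) \<noteq> 0"
    using Forms_6_extend_nonzero[OF \<mu>, of "[J x, x]"] independent_J by auto
  then obtain a b c d where "ys = [a, b, c, d]"
    by (auto simp: length_Suc_conv eval_nat_numeral)
  define \<theta> where "\<theta> y = \<psi> [x, J x, y]" for y
  define \<beta> where "\<beta> y z = \<psi> [x, y, z]" for y z
  have nz: "\<beta> a b * \<beta> c d - \<beta> a c * \<beta> b d + \<beta> a d * \<beta> b c \<noteq> 0"
    using ys(2) by (simp add: \<beta>_def Pfaffian_interior_prod \<open>ys = _\<close>)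
  have "\<mu> [J x, x, J x, p, q, r] = 0" for p q r
    by (rule Forms_alternating[OF \<mu>(1)]) simp
  then have E: "\<theta> p * \<beta> q r - \<theta> q * \<beta> p r + \<theta> r * \<beta> p q = 0" for p q r
    using Pfaffian_interior_prod[of x "J x" p q r] by (simp add: \<theta>_def \<beta>_def)
  have sk: "\<beta> q p = - \<beta> p q" for p q
    by (simp add: \<beta>_def \<psi>_swap(2)[of x p q])
  have "\<theta> z * (\<beta> a b * \<beta> c d - \<beta> a c * \<beta> b d + \<beta> a d * \<beta> b c) = 0"
    using E[of z c d] E[of z b d] E[of z b c] E[of b c d] E[of a c d] E[of a b d] E[of a b c]
      E[of z a b] E[of z a c] E[of z a d] 
    by algebra
  then show ?thesis
    using nz by (simp add: \<theta>_def)
qed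

text \<open>The kernel of \<open>i\<^sub>x \<psi>\<close> contains \<open>x\<close>, \<open>J x\<close> and \<open>J\<^sup>2 x\<close>. If they were independent, they would extend
  to a basis on which the Pfaffian identity has a zero left and a nonzero right side.\<close>

lemma J2_in_span: "J (J x) \<in> span {J x, x}"
proof (rule ccontr)
  assume nin: "J (J x) \<notin> span {J x, x}"
  then have x: "x \<noteq> 0"
    using linear_0[OF J_linear] by (metis span_zero)
  have "independent {J (J x), J x, x}"
    using nin independent_J[OF x] by (simp add: independent_insertI)
  moreover have "{J (J x), J x, x} = set [J x, x, J (J x)]"
    by auto
  moreover have "distinct [J x, x, J (J x)]"
    using nin independent_J[OF x] span_base[of _ "{J x, x}"] by auto
  ultimately obtain ys where ys: "length [J x, x, J (J x)] + length ys = 6" "\<mu> ([J x, x, J (J x)] @ ys) \<noteq> 0"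
    using Forms_6_extend_nonzero[OF \<mu>, of "[J x, x, J (J x)]"] by metis
  then obtain a b c where abc: "ys = [a, b, c]"
    by (auto simp: length_Suc_conv eval_nat_numeral)
  have "\<psi> [x, J (J x), z] = 0" for z
  proof -
    have "\<psi> [x + J x, J x + J (J x), z] = 0"
      using \<psi>_J_kernel[of "x + J x" z] by (simp add: linear_add[OF J_linear])
    then show ?thesis
      by (simp add: linear_add[OF \<psi>_linear(1)] linear_add[OF \<psi>_linear(2)])
  qed
  then show False
    using ys(2) Pfaffian_interior_prod[of x "J (J x)" a b c] by (simp add: abc)
qed

text \<open>As \<open>J\<close> is skew, \<open>J\<^sup>2 x\<close> has no component along \<open>J x\<close>.\<close>

lemma J2_multiple: "\<exists>a. J (J x) = a *\<^sub>R x"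
proof -
  obtain b where "J (J x) - b *\<^sub>R J x \<in> span {x}"
    using J2_in_span[of x] by (auto simp: span_breakdown_eq)
  then obtain a where a: "J (J x) - b *\<^sub>R J x = a *\<^sub>R x"
    by (auto simp: span_singleton)
  have "J (J x) \<bullet> J x = 0"
    by simp
  moreover have "J (J x) = a *\<^sub>R x + b *\<^sub>R J x"
    using a by (simp add: algebra_simps)
  ultimately have "b * (J x \<bullet> J x) = 0"
    by (simp add: inner_add_left)
  then have "b *\<^sub>R J x = 0"
    by auto
  then show ?thesis
    using a by auto
qed

text \<open>Every vector is an eigenvector of \<open>J\<^sup>2\<close>, so \<open>J\<^sup>2\<close> is a multiple of the identity; the trace, which is
  prescribed by \<open>\<lambda>(\<psi>)\<close>, shows that the factor is \<open>-1\<close>.\<close>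

lemma J_squared [simp]: "J (J x) = - x"
proof -
  have lin: "linear (\<lambda>x. J (J x))"
    using linear_compose[OF J_linear J_linear] by (simp add: o_def)
  obtain a where a: "J (J x) = a x *\<^sub>R x" for x
    using J2_multiple by metis
  have eq: "a (axis i 1) = a (axis j 1)" for i j
  proof (cases "i = j")
    case False
    have "J (J (axis i 1 + axis j 1)) = J (J (axis i 1)) + J (J (axis j 1))"
      by (rule linear_add[OF lin])
    then have *: "a (axis i 1 + axis j 1) *\<^sub>R (axis i 1 + axis j 1) = a (axis i 1) *\<^sub>R axis i 1 + a (axis j 1) *\<^sub>R (axis j 1 :: vec6)"
      by (simp only: a)
    from arg_cong[OF *, of "\<lambda>v. v $ i"] arg_cong[OF *, of "\<lambda>v. v $ j"] False show ?thesis
      by (simp add: axis_def)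
  qed simp
  define c where "c = a (axis 1 1)"
  have J2: "J (J (axis i 1)) = c *\<^sub>R axis i 1" for i
    using a[of "axis i 1"] eq[of i 1] by (simp add: c_def)
  have "trace (matrix (\<lambda>x. J (J x))) = 6 * c"
    by (simp only: trace_def matrix_def J2) (simp add: axis_def)
  then have c: "c = - 1"
    using trace_J2 by simp
  have "J (J x) = - x"
  proof (rule linear_eq_stdbasis[OF lin linear_uminus, THEN fun_cong])
    fix b :: vec6 assume "b \<in> Basis"
    then obtain i where "b = axis i 1"
      by (auto simp: Basis_vec_def)
    then show "J (J b) = - b"
      by (simp add: J2 c)
  qed
  then show ?thesis .
qed

lemma J_isometry: "J x \<bullet> J y = x \<bullet> y"
  using J_skew[of x "J y"] by simp

lemma \<omega>_eq: "\<omega> [x, y] = J x \<bullet> y"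
  using metric[of x "- J y"] linear_neg[OF J_linear, of "J y"] by (simp add: J_skew)

text \<open>Polarization of \<open>\<psi>(x, J x, z) = 0\<close>. This says that \<open>\<psi>\<close> is the real part of a form of type
  \<open>(3, 0)\<close>.\<close>

lemma \<psi>_J_left: "\<psi> [J x, y, z] = \<psi> [x, J y, z]"
proof -
  have "\<psi> [x + y, J x + J y, z] = 0"
    using \<psi>_J_kernel[of "x + y" z] by (simp add: linear_add[OF J_linear])
  then have "\<psi> [x, J y, z] + \<psi> [y, J x, z] = 0"
    by (simp add: linear_add[OF \<psi>_linear(1)] linear_add[OF \<psi>_linear(2)])
  then show ?thesis
    using \<psi>_swap(1)[of y "J x" z] by simp
qed

lemma \<psi>_J_right: "\<psi> [x, y, J z] = \<psi> [x, J y, z]"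
  using \<psi>_J_left[of z y x] \<psi>_swap by metis

end

section \<open>Norms of contractions\<close>

text \<open>Both sides are the squared length of the vector that represents \<open>l\<close>.\<close>

lemma sum_squares_orthonormal_basis:
  fixes l :: "'a::euclidean_space \<Rightarrow> real"
  assumes B: "finite B" "pairwise orthogonal B" "\<And>b. b \<in> B \<Longrightarrow> norm b = 1" "span B = UNIV"
    and l: "linear l"
  shows "(\<Sum>b\<in>Basis. (l b)\<^sup>2) = (\<Sum>b\<in>B. (l b)\<^sup>2)"
proof -
  define v where "v = adjoint l 1"
  have l_eq: "l x = v \<bullet> x" for x
    using adjoint_works[OF l, of x 1] by (simp add: v_def inner_commute)
  have sq: "(\<Sum>b\<in>B. (l b)\<^sup>2) = v \<bullet> v"
    if "finite B" "pairwise orthogonal B" "\<And>b. b \<in> B \<Longrightarrow> norm b = 1" "span B = UNIV" for B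
  proof -
    have "v = (\<Sum>b\<in>B. (v \<bullet> b) *\<^sub>R b)"
      using orthonormal_basis_expand[OF that(2,3) _ that(1), of v] that(4) by auto
    then have "v \<bullet> v = v \<bullet> (\<Sum>b\<in>B. (v \<bullet> b) *\<^sub>R b)"
      by simp
    then show ?thesis
      by (simp add: inner_sum_right l_eq power2_eq_square)
  qed
  have "pairwise orthogonal (Basis :: 'a set)"
    by (auto simp: pairwise_def orthogonal_def inner_Basis)
  then show ?thesis
    using sq[OF B] sq[of "Basis :: 'a set"] by simp
qed

lemma sum_Basis_vec6: "(\<Sum>b\<in>Basis. f b) = (\<Sum>i\<in>UNIV. f (axis i 1 :: vec6))"
proof -
  have "(Basis :: vec6 set) = range (\<lambda>i. axis i 1)"
    by (auto simp: Basis_vec_def)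
  moreover have "inj (\<lambda>i. axis i (1::real) :: vec6)"
    by (auto simp: inj_on_def axis_eq_axis)
  ultimately show ?thesis
    using sum.reindex[of "\<lambda>i. axis i 1 :: vec6" UNIV f] by (simp add: o_def)
qed

context metric_su3
begin

definition \<psi>_norm2 :: "vec6 \<Rightarrow> vec6 \<Rightarrow> real" where
  "\<psi>_norm2 x y = (\<Sum>b\<in>Basis. (\<psi> [x, y, b])\<^sup>2)"

definition gram :: "vec6 \<Rightarrow> real" where
  "gram x = (\<Sum>b\<in>Basis. \<psi>_norm2 x b)"

lemma \<psi>_norm2_sym: "\<psi>_norm2 x y = \<psi>_norm2 y x"
  by (simp add: \<psi>_norm2_def \<psi>_swap(1)[of x y])

lemma ex_unit_orthogonal:
  fixes S :: "vec6 set"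
  assumes "finite S" "card S < 6"
  obtains u where "norm u = 1" "\<forall>s\<in>S. s \<bullet> u = 0"
proof -
  have "dim S < DIM(vec6)"
    using dim_le_card'[OF assms(1)] assms(2) by simp
  then obtain v where v: "v \<noteq> 0" "\<And>y. y \<in> span S \<Longrightarrow> orthogonal v y"
    using orthogonal_to_subspace_exists[of S] by blast
  show thesis
  proof (rule that[of "sgn v"])
    show "norm (sgn v) = 1"
      using v(1) by (simp add: norm_sgn)
    have "v \<bullet> s = 0" if "s \<in> S" for s
      using v(2)[of s] that by (simp add: orthogonal_def span_base)
    then show "\<forall>s\<in>S. s \<bullet> sgn v = 0"
      by (simp add: sgn_div_norm inner_commute)
  qed
qed

text \<open>The frame \<open>x, J x, u, J u, w, J w\<close> is orthonormal for any unit vector \<open>w\<close> orthogonal to the first four.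
  It enters only through sums of squares of a linear form.\<close>

lemma adapted_basis:
  assumes x: "norm x = 1" and u: "norm u = 1" "x \<bullet> u = 0" "J x \<bullet> u = 0"
  obtains w where "\<forall>l :: vec6 \<Rightarrow> real. linear l \<longrightarrow> (\<Sum>b\<in>Basis. (l b)\<^sup>2) =
      (l x)\<^sup>2 + (l (J x))\<^sup>2 + (l u)\<^sup>2 + (l (J u))\<^sup>2 + (l w)\<^sup>2 + (l (J w))\<^sup>2"
proof -
  have "card {x, J x, u, J u} \<le> 4"
    using card_length[of "[x, J x, u, J u]"] by simp
  then obtain w where w: "norm w = 1" "x \<bullet> w = 0" "J x \<bullet> w = 0" "u \<bullet> w = 0" "J u \<bullet> w = 0"
    using ex_unit_orthogonal[of "{x, J x, u, J u}"] by auto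
  have J: "x \<bullet> J u = 0" "x \<bullet> J w = 0" "u \<bullet> J w = 0" "J x \<bullet> J u = 0" "J x \<bullet> J w = 0" "J u \<bullet> J w = 0"
    using u w J_skew[of x u] J_skew[of x w] J_skew[of u w] by (simp_all add: J_isometry)
  have n1: "y \<bullet> y = 1" if "norm y = 1" for y :: vec6
    using that by (simp add: dot_square_norm)
  have J1: "norm (J y) = norm y" for y
    by (simp add: norm_eq_sqrt_inner J_isometry)
  let ?B = "{x, J x, u, J u, w, J w}"
  have ne: "a \<noteq> b" if "a \<bullet> b = 0" "norm a = 1" for a b :: vec6
    using that by auto
  have dist: "distinct [x, J x, u, J u, w, J w]"
    unfolding distinct.simps list.set insert_iff empty_iff de_Morgan_disj
    by (intro conjI ne TrueI not_False_eq_True[THEN iffD2]) (simp_all add: J1 x u w J)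
  have orth: "pairwise orthogonal ?B"
    using u w J by (auto simp: pairwise_insert orthogonal_def inner_commute)
  have unit: "norm b = 1" if "b \<in> ?B" for b
    using that x u w by (auto simp: J1)
  have "0 \<notin> ?B"
    using unit by (metis norm_zero zero_neq_one)
  then have "independent ?B"
    by (rule pairwise_orthogonal_independent[OF orth])
  moreover have card: "card ?B = 6"
    using distinct_card[OF dist] by simp
  ultimately have "span ?B = UNIV"
    using card_ge_dim_independent[of ?B UNIV] by (auto simp: )
  then have "(\<Sum>b\<in>Basis. (l b)\<^sup>2) = (\<Sum>b\<in>?B. (l b)\<^sup>2)" if "linear l" for l :: "vec6 \<Rightarrow> real"
    by (intro sum_squares_orthonormal_basis orth unit that) auto
  moreover have "(\<Sum>b\<in>?B. (l b)\<^sup>2) = (l x)\<^sup>2 + (l (J x))\<^sup>2 + (l u)\<^sup>2 + (l (J u))\<^sup>2 + (l w)\<^sup>2 + (l (J w))\<^sup>2"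
    for l :: "vec6 \<Rightarrow> real"
    using sum_list_distinct_conv_sum_set[OF dist, of "\<lambda>b. (l b)\<^sup>2"] by simp
  ultimately show thesis
    by (intro that[of w]) auto
qed

lemma \<psi>_J_kernel' [simp]: "\<psi> [x, u, J u] = 0" "\<psi> [x, u, J x] = 0" "\<psi> [x, J u, u] = 0"
proof -
  have "\<psi> [x, u, J u] = - \<psi> [u, x, J u]" "\<psi> [u, x, J u] = - \<psi> [u, J u, x]"
    "\<psi> [x, u, J x] = - \<psi> [x, J x, u]" "\<psi> [x, J u, u] = - \<psi> [x, u, J u]"
    by (rule \<psi>_swap)+
  then show "\<psi> [x, u, J u] = 0" "\<psi> [x, u, J x] = 0" "\<psi> [x, J u, u] = 0"
    by simp_all
qed

text \<open>In the adapted frame all values of \<open>\<psi>(x, \<cdot>, \<cdot>)\<close> are \<open>0\<close> or, up to sign, one of \<open>p = \<psi>(x, u, w)\<close> and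
  \<open>q = \<psi>(x, u, J w)\<close>, and each of \<open>u, J u, w, J w\<close> contributes \<open>p\<^sup>2 + q\<^sup>2\<close>.\<close>

lemma gram_eq:
  assumes x: "norm x = 1" and u: "norm u = 1" "x \<bullet> u = 0" "J x \<bullet> u = 0"
  shows "gram x = 4 * \<psi>_norm2 x u"
proof -
  obtain w where "\<forall>l :: vec6 \<Rightarrow> real. linear l \<longrightarrow> (\<Sum>b\<in>Basis. (l b)\<^sup>2) =
      (l x)\<^sup>2 + (l (J x))\<^sup>2 + (l u)\<^sup>2 + (l (J u))\<^sup>2 + (l w)\<^sup>2 + (l (J w))\<^sup>2"
    by (rule adapted_basis[OF assms])
  note w = this[rule_format]
  define p q where "p = \<psi> [x, u, w]" and "q = \<psi> [x, u, J w]"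
  have N: "\<psi>_norm2 a y = (\<psi> [a, y, x])\<^sup>2 + (\<psi> [a, y, J x])\<^sup>2 + (\<psi> [a, y, u])\<^sup>2 + (\<psi> [a, y, J u])\<^sup>2
      + (\<psi> [a, y, w])\<^sup>2 + (\<psi> [a, y, J w])\<^sup>2" for a y
    unfolding \<psi>_norm2_def by (rule w[OF \<psi>_linear(3)])
  have sw: "(\<psi> [a, y, z])\<^sup>2 = (\<psi> [a, z, y])\<^sup>2" for a y z
    by (simp add: \<psi>_swap(2)[of a z y])
  have neg: "\<psi> [x, u, - w] = - \<psi> [x, u, w]"
    by (rule linear_neg[OF \<psi>_linear(3)])
  have neg': "\<psi> [x, - w, u] = - \<psi> [x, w, u]"
    by (rule linear_neg[OF \<psi>_linear(2)])
  have "gram x = (\<Sum>c\<in>Basis. \<Sum>b\<in>Basis. (\<psi> [x, c, b])\<^sup>2)"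
    unfolding gram_def \<psi>_norm2_def ..
  also have "\<dots> = (\<Sum>b\<in>Basis. \<Sum>c\<in>Basis. (\<psi> [x, c, b])\<^sup>2)"
    by (rule sum.swap)
  also have "\<dots> = (\<Sum>b\<in>Basis. (\<psi> [x, x, b])\<^sup>2 + (\<psi> [x, J x, b])\<^sup>2 + (\<psi> [x, u, b])\<^sup>2 + (\<psi> [x, J u, b])\<^sup>2
      + (\<psi> [x, w, b])\<^sup>2 + (\<psi> [x, J w, b])\<^sup>2)"
    by (intro sum.cong refl w[OF \<psi>_linear(2)])
  also have "\<dots> = \<psi>_norm2 x u + \<psi>_norm2 x (J u) + \<psi>_norm2 x w + \<psi>_norm2 x (J w)"
    by (simp add: sum.distrib \<psi>_norm2_def)
  also have "\<psi>_norm2 x u = p\<^sup>2 + q\<^sup>2"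
    by (simp add: N p_def q_def)
  also have "\<psi>_norm2 x (J u) = p\<^sup>2 + q\<^sup>2"
    by (simp add: N p_def q_def \<psi>_J_right[symmetric] neg)
  also have "\<psi>_norm2 x w = p\<^sup>2 + q\<^sup>2"
    by (simp add: N p_def q_def sw[of x w u] sw[of x "J w" u] \<psi>_J_right)
  also have "\<psi>_norm2 x (J w) = p\<^sup>2 + q\<^sup>2"
    by (simp add: N p_def q_def sw[of x w u] sw[of x "J w" u] \<psi>_J_right[of x "J w" u] neg')
  finally have "gram x = 4 * (p\<^sup>2 + q\<^sup>2)"
    by simp
  moreover have "\<psi>_norm2 x u = p\<^sup>2 + q\<^sup>2"
    by (simp add: N p_def q_def)
  ultimately show ?thesis
    by simp
qed

text \<open>The right side of \<open>gram_eq\<close> is symmetric in \<open>x\<close> and \<open>u\<close>. Any two unit vectors \<open>x\<close> and \<open>y\<close> have a common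
  partner \<open>u\<close>, because \<open>x, J x, y, J y\<close> do not span.\<close>

lemma gram_constant:
  assumes "norm x = 1" "norm y = 1"
  shows "gram x = gram y"
proof -
  have "card {x, J x, y, J y} \<le> 4"
    using card_length[of "[x, J x, y, J y]"] by simp
  then obtain u where u: "norm u = 1" "x \<bullet> u = 0" "J x \<bullet> u = 0" "y \<bullet> u = 0" "J y \<bullet> u = 0"
    using ex_unit_orthogonal[of "{x, J x, y, J y}"] by auto
  have "gram z = gram u" if "norm z = 1" "z \<bullet> u = 0" "J z \<bullet> u = 0" for z
    using gram_eq[of z u] gram_eq[of u z] that u(1) J_skew[of z u]
    by (simp add: \<psi>_norm2_sym[of z u] inner_commute)
  then show ?thesis
    using assms u by simp
qed

definition \<kappa> :: real where "\<kappa> = gram (axis 1 1) / 4"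

text \<open>Only the component of \<open>y\<close> orthogonal to \<open>x\<close> and \<open>J x\<close> matters, because the other two are in the
  kernel of \<open>\<psi>(x, \<cdot>, \<cdot>)\<close>.\<close>

lemma \<psi>_norm2_eq:
  assumes x: "norm x = 1"
  shows "\<psi>_norm2 x y = \<kappa> * (y \<bullet> y - (x \<bullet> y)\<^sup>2 - (J x \<bullet> y)\<^sup>2)"
proof -
  define a b where "a = x \<bullet> y" and "b = J x \<bullet> y"
  define z where "z = y - a *\<^sub>R x - b *\<^sub>R J x"
  have xx: "x \<bullet> x = 1"
    using x by (simp add: dot_square_norm)
  then have JJ: "J x \<bullet> J x = 1"
    by (simp add: J_isometry)
  have z: "x \<bullet> z = 0" "J x \<bullet> z = 0"
    by (simp_all add: z_def inner_diff_right a_def b_def xx JJ)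
  have y: "y = z + a *\<^sub>R x + b *\<^sub>R J x"
    by (simp add: z_def)
  have "z \<bullet> z = z \<bullet> y"
    using z by (simp add: y inner_add_right inner_commute[of z x] inner_commute[of z "J x"])
  also have "\<dots> = y \<bullet> y - a\<^sup>2 - b\<^sup>2"
    unfolding z_def inner_diff_left by (simp add: a_def b_def power2_eq_square)
  finally have zz: "z \<bullet> z = y \<bullet> y - a\<^sup>2 - b\<^sup>2" .
  have "\<psi> [x, y, c] = \<psi> [x, z, c]" for c
    unfolding y by (simp add: linear_add[OF \<psi>_linear(2)] linear_scale[OF \<psi>_linear(2)])
  then have "\<psi>_norm2 x y = \<psi>_norm2 x z"
    by (simp add: \<psi>_norm2_def)
  also have "\<dots> = \<kappa> * (z \<bullet> z)"
  proof (cases "z = 0")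
    case True
    then show ?thesis
      using linear_0[OF \<psi>_linear(2)] by (simp add: \<psi>_norm2_def)
  next
    case False
    define u where "u = sgn z"
    have zu: "z = norm z *\<^sub>R u"
      using False by (simp add: u_def sgn_div_norm)
    have u: "norm u = 1" "x \<bullet> u = 0" "J x \<bullet> u = 0"
      using False z by (simp_all add: u_def norm_sgn) (simp_all add: sgn_div_norm)
    have "\<psi>_norm2 x z = (norm z)\<^sup>2 * \<psi>_norm2 x u"
      by (subst zu) (simp add: \<psi>_norm2_def linear_scale[OF \<psi>_linear(2)] power_mult_distrib sum_distrib_left)
    also have "\<psi>_norm2 x u = \<kappa>"
      using gram_eq[OF x u] gram_constant[OF x, of "axis 1 1"] by (simp add: \<kappa>_def norm_axis_1)
    finally show ?thesis
      by (simp add: dot_square_norm mult.commute)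
  qed
  finally show ?thesis
    by (simp add: zz a_def b_def)
qed

text \<open>Otherwise \<open>i\<^sub>x \<psi> = 0\<close>, although its Pfaffian is not identically zero.\<close>

lemma \<kappa>_pos: "\<kappa> > 0"
proof -
  define x :: vec6 where "x = axis 1 1"
  have x: "norm x = 1"
    by (simp add: x_def norm_axis_1)
  have "\<kappa> \<ge> 0"
    unfolding \<kappa>_def gram_def \<psi>_norm2_def by (simp add: sum_nonneg)
  moreover have "\<kappa> \<noteq> 0"
  proof
    assume "\<kappa> = 0"
    then have "\<psi>_norm2 x y = 0" for y
      using \<psi>_norm2_eq[OF x, of y] by simp
    then have z: "\<psi> [x, y, b] = 0" if "b \<in> Basis" for y b
      using that unfolding \<psi>_norm2_def by (simp add: sum_nonneg_eq_0_iff)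
    have "\<psi> [x, y, c] = 0" for y c
      using linear_eq_stdbasis[OF \<psi>_linear(3)[of x y] linear_zero] z by (simp add: fun_eq_iff)
    moreover have "x \<noteq> 0"
      using x by auto
    then obtain ys where ys: "length [J x, x] + length ys = 6" "\<mu> ([J x, x] @ ys) \<noteq> 0"
      using Forms_6_extend_nonzero[OF \<mu>, of "[J x, x]"] independent_J by auto
    then obtain a b c d where "ys = [a, b, c, d]"
      by (auto simp: length_Suc_conv eval_nat_numeral)
    ultimately show False
      using ys(2) Pfaffian_interior_prod[of x a b c d] by simp
  qed
  ultimately show ?thesis
    by simp
qed

lemma pair_identity:
  assumes "i \<noteq> j"
  shows "(\<Sum>k\<in>UNIV. (\<psi> [axis i 1, axis j 1, axis k 1])\<^sup>2) = \<kappa> * (1 - (\<omega> [axis i 1, axis j 1])\<^sup>2)"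
  using \<psi>_norm2_eq[of "axis i 1" "axis j 1"] assms
  by (simp add: \<psi>_norm2_def sum_Basis_vec6 norm_axis_1 \<omega>_eq inner_axis_axis)

lemma \<omega>_orthogonal:
  "(\<Sum>k\<in>UNIV. \<omega> [axis i 1, axis k 1] * \<omega> [axis j 1, axis k 1]) = (if i = j then 1 else 0)"
proof -
  have "(\<Sum>b\<in>Basis. \<omega> [axis i 1, b] * \<omega> [axis j 1, b]) = J (axis i 1) \<bullet> J (axis j 1)"
    unfolding \<omega>_eq by (rule euclidean_inner[symmetric])
  then show ?thesis
    by (simp add: sum_Basis_vec6 J_isometry inner_axis_axis)
qed

end

lemma su3_structure_metric_su3:
  assumes su3: "su3_structure \<omega> \<psi>" and metric: "induced_metric \<omega> \<psi> = std_metric"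
  shows "metric_su3 \<omega> \<psi> (sqrt_abs_lam (\<omega> \<^bold>\<and> \<omega> \<^bold>\<and> \<omega>) \<psi>) (su3_J \<omega> \<psi>)"
proof -
  define \<tau> where "\<tau> = \<omega> \<^bold>\<and> \<omega> \<^bold>\<and> \<omega>"
  define \<mu> where "\<mu> = sqrt_abs_lam \<tau> \<psi>"
  define J where "J = su3_J \<omega> \<psi>"
  have \<omega>: "\<omega> \<in> Forms 2" and \<psi>: "\<psi> \<in> Forms 3" and neg: "lam_neg \<psi>" and "\<tau> \<noteq> 0"
    using su3 by (auto simp: su3_structure_def stable2_def stable3_def \<tau>_def)
  have "\<tau> \<in> Forms (2 + (2 + 2))"
    unfolding \<tau>_def by (intro wedge_Forms \<omega>)
  then have \<tau>: "\<tau> \<in> Forms 6" "\<tau> \<noteq> 0"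
    using \<open>\<tau> \<noteq> 0\<close> by simp_all
  note \<mu> = sqrt_abs_lam_properties[OF \<tau> neg, folded \<mu>_def]
  have "J = Jmap \<tau> \<psi>"
    by (simp add: J_def su3_J_def \<tau>_def)
  note Jm = Jmap_properties[OF \<tau> \<psi> neg, folded \<mu>_def this]
  have m: "\<omega> [x, J y] = x \<bullet> y" for x y
    using fun_cong[OF fun_cong[OF metric], of x y]
    by (simp add: induced_metric_def std_metric_eq_inner J_def)
  show ?thesis
    unfolding \<tau>_def[symmetric] \<mu>_def[symmetric] J_def[symmetric]
    by unfold_locales (use \<omega> \<psi> \<mu> m Jm in simp_all)
qed

section \<open>Forms and differentials in the standard basis\<close>

text \<open>Basis vectors are indexed by natural numbers, so that the simplifier can compare indices and sort the
  arguments of forms. The type \<^typ>\<open>6\<close> is less suitable, since there \<open>6 = 0\<close> is the smallest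
  element.\<close>

definition e :: "nat \<Rightarrow> vec6" where
  "e n = axis (of_nat n) 1"

lemma UNIV_6: "(UNIV :: 6 set) = {1, 2, 3, 4, 5, 6}"
proof -
  have "card {1, 2, 3, 4, 5, 6 :: 6} = 6"
    by simp
  then show ?thesis
    by (intro card_subset_eq[symmetric]) auto
qed

lemma sum_6: "(\<Sum>i\<in>UNIV. f (i::6)) = f 1 + f 2 + f 3 + f 4 + f 5 + f 6"
  unfolding UNIV_6 by (simp add: add.assoc)

lemma sum_axis_6: "(\<Sum>i\<in>UNIV. f (axis (i::6) 1)) = f (e 1) + f (e 2) + f (e 3) + f (e 4) + f (e 5) + f (e 6)"
  by (simp add: sum_6 e_def)

lemma e_nth: "e n $ i = (if of_nat n = i then 1 else 0)"
  by (auto simp: e_def axis_def)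

lemma linear_bracket:
  assumes "linear f"
  shows "f (bracket D x y) = - (D 1 [x, y] * f (e 1) + D 2 [x, y] * f (e 2) + D 3 [x, y] * f (e 3)
      + D 4 [x, y] * f (e 4) + D 5 [x, y] * f (e 5) + D 6 [x, y] * (f (e 6) :: real))"
proof -
  have "bracket D x y = (\<Sum>i\<in>UNIV. (- D i [x, y]) *\<^sub>R axis i 1)"
    by (simp add: bracket_def vec_eq_iff axis_def if_distrib sum.delta' flip: if_distrib[of uminus] cong: if_cong)
  then have "f (bracket D x y) = (\<Sum>i\<in>UNIV. - D i [x, y] * f (axis i 1))"
    by (simp add: linear_sum[OF assms] linear_neg[OF assms] linear_scale[OF assms] sum_negf)
  then show ?thesis
    by (simp add: sum_6 e_def)
qed

lemma Forms_2_sort: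
  assumes "\<alpha> \<in> Forms 2"
  shows "i < j \<Longrightarrow> \<alpha> [e j, e i] = - \<alpha> [e i, e j]" "\<alpha> [x, x] = 0"
  using Forms_swap[OF assms, of "[]" "e j" "e i" "[]"] Forms_alternating[OF assms, of "[x, x]"] by simp_all

lemma Forms_3_sort:
  assumes "\<alpha> \<in> Forms 3"
  shows "i < j \<Longrightarrow> \<alpha> [e j, e i, z] = - \<alpha> [e i, e j, z]"
    "i < j \<Longrightarrow> \<alpha> [z, e j, e i] = - \<alpha> [z, e i, e j]"
    "\<alpha> [x, x, z] = 0" "\<alpha> [z, x, x] = 0"
  using Forms_swap[OF assms, of "[]" "e j" "e i" "[z]"] Forms_swap[OF assms, of "[z]" "e j" "e i" "[]"]
    Forms_alternating[OF assms, of "[x, x, z]"] Forms_alternating[OF assms, of "[z, x, x]"] by simp_all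

lemma ce_diff_sum:
  "ce_diff br \<alpha> xs =
    (\<Sum>j<length xs. \<Sum>i<j. (-1) ^ (i + j) * \<alpha> (br (xs ! i) (xs ! j) # nths xs (- {i, j})))"
proof -
  have "{(i, j). i < j \<and> j < length xs} = prod.swap ` (SIGMA j:{..<length xs}. {..<j})"
    by (auto simp: image_iff)
  then have "ce_diff br \<alpha> xs = (\<Sum>(j, i)\<in>(SIGMA j:{..<length xs}. {..<j}).
      (-1) ^ (i + j) * \<alpha> (br (xs ! i) (xs ! j) # nths xs (- {i, j})))"
    unfolding ce_diff_def by (simp add: sum.reindex case_prod_unfold)
  then show ?thesis
    by (simp add: sum.Sigma)
qed

lemma ce_diff_3:
  "ce_diff br \<alpha> [x, y, z] = - \<alpha> [br x y, z] + \<alpha> [br x z, y] - \<alpha> [br y z, x]"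
  by (simp add: ce_diff_sum nths_Cons)

lemma ce_diff_4:
  "ce_diff br \<alpha> [w, x, y, z] = - \<alpha> [br w x, y, z] + \<alpha> [br w y, x, z] - \<alpha> [br w z, x, y]
     - \<alpha> [br x y, w, z] + \<alpha> [br x z, w, y] - \<alpha> [br y z, w, x]"
  by (simp add: ce_diff_sum nths_Cons)

lemma ce_diff_5:
  "ce_diff br \<alpha> [v, w, x, y, z] = - \<alpha> [br v w, x, y, z] + \<alpha> [br v x, w, y, z] - \<alpha> [br v y, w, x, z]
     + \<alpha> [br v z, w, x, y] - \<alpha> [br w x, v, y, z] + \<alpha> [br w y, v, x, z] - \<alpha> [br w z, v, x, y]
     - \<alpha> [br x y, v, w, z] + \<alpha> [br x z, v, w, y] - \<alpha> [br y z, v, w, x]"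
  by (simp add: ce_diff_sum nths_Cons)

section \<open>The norm identities in coordinates\<close>

lemma sum_1_6: "(\<Sum>k\<in>{1..6::nat}. f k) = f 1 + f 2 + f 3 + f 4 + f 5 + f 6"
proof -
  have "{1..6::nat} = {1, 2, 3, 4, 5, 6}"
    unfolding set_eq_iff atLeastAtMost_iff insert_iff empty_iff by presburger
  then show ?thesis
    by (simp only:) (simp add: add.assoc)
qed

lemma su3_coordinates:
  assumes "su3_structure \<omega> \<psi>" "induced_metric \<omega> \<psi> = std_metric"
  obtains \<kappa> where "\<kappa> > 0"
    and "\<And>i j. i \<in> {1..6} \<Longrightarrow> j \<in> {1..6} \<Longrightarrow> i \<noteq> j \<Longrightarrow>
      (\<Sum>k\<in>{1..6}. (\<psi> [e i, e j, e k])\<^sup>2) = \<kappa> * (1 - (\<omega> [e i, e j])\<^sup>2)"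
    and "\<And>i j. i \<in> {1..6} \<Longrightarrow> j \<in> {1..6} \<Longrightarrow>
      (\<Sum>k\<in>{1..6}. \<omega> [e i, e k] * \<omega> [e j, e k]) = (if i = j then 1 else 0)"
proof -
  interpret metric_su3 \<omega> \<psi> "sqrt_abs_lam (\<omega> \<^bold>\<and> \<omega> \<^bold>\<and> \<omega>) \<psi>" "su3_J \<omega> \<psi>"
    by (rule su3_structure_metric_su3[OF assms])
  have sum_e: "(\<Sum>k\<in>{1..6}. f (e k)) = (\<Sum>k\<in>UNIV. f (axis k 1))" for f :: "vec6 \<Rightarrow> real"
    unfolding sum_1_6 sum_axis_6 ..
  have inj: "of_nat i = (of_nat j :: 6) \<longleftrightarrow> i = j" if "i \<in> {1..6}" "j \<in> {1..6}" for i j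
  proof -
    have "i \<in> {1, 2, 3, 4, 5, 6}" "j \<in> {1, 2, 3, 4, 5, 6}"
      using that by auto
    then show ?thesis
      by (elim insertE emptyE) (simp_all only:, simp_all)
  qed
  show thesis
  proof (rule that[OF \<kappa>_pos])
    fix i j :: nat assume ij: "i \<in> {1..6}" "j \<in> {1..6}"
    show "(\<Sum>k\<in>{1..6}. \<omega> [e i, e k] * \<omega> [e j, e k]) = (if i = j then 1 else 0)"
      unfolding sum_e[of "\<lambda>x. \<omega> [e i, x] * \<omega> [e j, x]"]
      unfolding e_def \<omega>_orthogonal inj[OF ij] ..
    assume "i \<noteq> j"
    then show "(\<Sum>k\<in>{1..6}. (\<psi> [e i, e j, e k])\<^sup>2) = \<kappa> * (1 - (\<omega> [e i, e j])\<^sup>2)"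
      unfolding sum_e[of "\<lambda>x. (\<psi> [e i, e j, x])\<^sup>2"]
      unfolding e_def by (intro pair_identity) (simp add: inj[OF ij])
  qed
qed

text \<open>Sum the pair identity over \<open>j \<noteq> i\<close>: the \<open>i\<close>-th row of \<open>\<omega>\<close> is a unit vector, so the five terms add up
  to \<open>\<kappa> (5 - 1)\<close>.\<close>

lemma su3_gram:
  assumes su3: "su3_structure \<omega> \<psi>" "induced_metric \<omega> \<psi> = std_metric"
  obtains \<kappa> where "\<kappa> > 0"
    and "\<And>i. i \<in> {1..6} \<Longrightarrow> (\<Sum>j\<in>{1..6}. \<Sum>k\<in>{1..6}. (\<psi> [e i, e j, e k])\<^sup>2) = 4 * \<kappa>"
    and "\<And>i j. i \<in> {1..6} \<Longrightarrow> j \<in> {1..6} \<Longrightarrow> i \<noteq> j \<Longrightarrow> (\<Sum>k\<in>{1..6}. (\<psi> [e i, e j, e k])\<^sup>2) \<le> \<kappa>"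
proof -
  obtain \<kappa> where \<kappa>: "\<kappa> > 0"
    and pair: "\<And>i j. i \<in> {1..6} \<Longrightarrow> j \<in> {1..6} \<Longrightarrow> i \<noteq> j \<Longrightarrow>
      (\<Sum>k\<in>{1..6}. (\<psi> [e i, e j, e k])\<^sup>2) = \<kappa> * (1 - (\<omega> [e i, e j])\<^sup>2)"
    and orth: "\<And>i j. i \<in> {1..6} \<Longrightarrow> j \<in> {1..6} \<Longrightarrow>
      (\<Sum>k\<in>{1..6}. \<omega> [e i, e k] * \<omega> [e j, e k]) = (if i = j then 1 else 0)"
    by (rule su3_coordinates[OF su3]) blast
  have \<psi>: "\<psi> \<in> Forms 3" and \<omega>: "\<omega> \<in> Forms 2"
    using su3 by (simp_all add: su3_structure_def stable3_def stable2_def)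
  show thesis
  proof (rule that[OF \<kappa>])
    fix i :: nat assume i: "i \<in> {1..6}"
    have "(\<Sum>j\<in>{1..6}. \<Sum>k\<in>{1..6}. (\<psi> [e i, e j, e k])\<^sup>2) =
        (\<Sum>j\<in>{1..6} - {i}. \<Sum>k\<in>{1..6}. (\<psi> [e i, e j, e k])\<^sup>2)"
      using i by (intro sum.mono_neutral_right) (auto simp: Forms_3_sort[OF \<psi>])
    also have "\<dots> = (\<Sum>j\<in>{1..6} - {i}. \<kappa> * (1 - (\<omega> [e i, e j])\<^sup>2))"
      using i pair by (intro sum.cong) auto
    also have "\<dots> = \<kappa> * (5 - (\<Sum>j\<in>{1..6} - {i}. (\<omega> [e i, e j])\<^sup>2))"
      using i by (simp add: sum_distrib_left[symmetric] sum_subtractf)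
    also have "(\<Sum>j\<in>{1..6} - {i}. (\<omega> [e i, e j])\<^sup>2) = (\<Sum>j\<in>{1..6}. \<omega> [e i, e j] * \<omega> [e i, e j])"
      unfolding power2_eq_square by (intro sum.mono_neutral_left) (auto simp: Forms_2_sort[OF \<omega>])
    also have "\<dots> = 1"
      using orth[OF i i] by simp
    finally show "(\<Sum>j\<in>{1..6}. \<Sum>k\<in>{1..6}. (\<psi> [e i, e j, e k])\<^sup>2) = 4 * \<kappa>"
      by simp
  next
    fix i j :: nat assume "i \<in> {1..6}" "j \<in> {1..6}" "i \<noteq> j"
    then show "(\<Sum>k\<in>{1..6}. (\<psi> [e i, e j, e k])\<^sup>2) \<le> \<kappa>"
      using pair \<kappa> by simp
  qed
qed

text \<open>The combination with weights \<open>p\<^sub>i\<close> of the norms \<open>\<Sum>\<^sub>j\<^sub><\<^sub>k \<psi>\<^sub>i\<^sub>j\<^sub>k\<^sup>2\<close> of the six contractions, sorted by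
  coefficients.\<close>

definition weighted_norm2 :: "form \<Rightarrow> real \<Rightarrow> real \<Rightarrow> real \<Rightarrow> real \<Rightarrow> real \<Rightarrow> real \<Rightarrow> real" where
  "weighted_norm2 \<psi> p1 p2 p3 p4 p5 p6 =
     (p1 + p2 + p3) * (\<psi> [e 1, e 2, e 3])\<^sup>2 + (p1 + p2 + p4) * (\<psi> [e 1, e 2, e 4])\<^sup>2
      + (p1 + p2 + p5) * (\<psi> [e 1, e 2, e 5])\<^sup>2 + (p1 + p2 + p6) * (\<psi> [e 1, e 2, e 6])\<^sup>2
      + (p1 + p3 + p4) * (\<psi> [e 1, e 3, e 4])\<^sup>2 + (p1 + p3 + p5) * (\<psi> [e 1, e 3, e 5])\<^sup>2
      + (p1 + p3 + p6) * (\<psi> [e 1, e 3, e 6])\<^sup>2 + (p1 + p4 + p5) * (\<psi> [e 1, e 4, e 5])\<^sup>2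
      + (p1 + p4 + p6) * (\<psi> [e 1, e 4, e 6])\<^sup>2 + (p1 + p5 + p6) * (\<psi> [e 1, e 5, e 6])\<^sup>2
      + (p2 + p3 + p4) * (\<psi> [e 2, e 3, e 4])\<^sup>2 + (p2 + p3 + p5) * (\<psi> [e 2, e 3, e 5])\<^sup>2
      + (p2 + p3 + p6) * (\<psi> [e 2, e 3, e 6])\<^sup>2 + (p2 + p4 + p5) * (\<psi> [e 2, e 4, e 5])\<^sup>2
      + (p2 + p4 + p6) * (\<psi> [e 2, e 4, e 6])\<^sup>2 + (p2 + p5 + p6) * (\<psi> [e 2, e 5, e 6])\<^sup>2
      + (p3 + p4 + p5) * (\<psi> [e 3, e 4, e 5])\<^sup>2 + (p3 + p4 + p6) * (\<psi> [e 3, e 4, e 6])\<^sup>2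
      + (p3 + p5 + p6) * (\<psi> [e 3, e 5, e 6])\<^sup>2 + (p4 + p5 + p6) * (\<psi> [e 4, e 5, e 6])\<^sup>2"

lemma su3_weighted_gram:
  assumes su3: "su3_structure \<omega> \<psi>" "induced_metric \<omega> \<psi> = std_metric"
  obtains \<kappa> where "\<kappa> > 0"
    and "\<And>p1 p2 p3 p4 p5 p6. weighted_norm2 \<psi> p1 p2 p3 p4 p5 p6 = 2 * \<kappa> * (p1 + p2 + p3 + p4 + p5 + p6)"
    and "(\<psi> [e 1, e 2, e 3])\<^sup>2 + (\<psi> [e 1, e 2, e 4])\<^sup>2 + (\<psi> [e 1, e 2, e 5])\<^sup>2 + (\<psi> [e 1, e 2, e 6])\<^sup>2 \<le> \<kappa>"
proof -
  obtain \<kappa> where \<kappa>: "\<kappa> > 0"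
    and gram: "\<And>i. i \<in> {1..6} \<Longrightarrow> (\<Sum>j\<in>{1..6}. \<Sum>k\<in>{1..6}. (\<psi> [e i, e j, e k])\<^sup>2) = 4 * \<kappa>"
    and pair: "\<And>i j. i \<in> {1..6} \<Longrightarrow> j \<in> {1..6} \<Longrightarrow> i \<noteq> j \<Longrightarrow> (\<Sum>k\<in>{1..6}. (\<psi> [e i, e j, e k])\<^sup>2) \<le> \<kappa>"
    by (rule su3_gram[OF su3]) blast
  have \<psi>: "\<psi> \<in> Forms 3"
    using su3 by (simp add: su3_structure_def stable3_def)
  note [simp] = sum_1_6 Forms_3_sort[OF \<psi>] and [simp del] = One_nat_def
  note G = gram[of 1] gram[of 2] gram[of 3] gram[of 4] gram[of 5] gram[of 6]
  show thesis
  proof (rule that[OF \<kappa>])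
    show "(\<psi> [e 1, e 2, e 3])\<^sup>2 + (\<psi> [e 1, e 2, e 4])\<^sup>2 + (\<psi> [e 1, e 2, e 5])\<^sup>2 + (\<psi> [e 1, e 2, e 6])\<^sup>2 \<le> \<kappa>"
      using pair[of 1 2] by simp
    fix p1 p2 p3 p4 p5 p6 :: real
    have "2 * weighted_norm2 \<psi> p1 p2 p3 p4 p5 p6 = 2 * (2 * \<kappa> * (p1 + p2 + p3 + p4 + p5 + p6))"
      using arg_cong[OF G(1)[simplified], of "\<lambda>x. p1 * x"] arg_cong[OF G(2)[simplified], of "\<lambda>x. p2 * x"]
        arg_cong[OF G(3)[simplified], of "\<lambda>x. p3 * x"] arg_cong[OF G(4)[simplified], of "\<lambda>x. p4 * x"]
        arg_cong[OF G(5)[simplified], of "\<lambda>x. p5 * x"] arg_cong[OF G(6)[simplified], of "\<lambda>x. p6 * x"]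
      by (simp add: weighted_norm2_def algebra_simps)
    then show "weighted_norm2 \<psi> p1 p2 p3 p4 p5 p6 = 2 * \<kappa> * (p1 + p2 + p3 + p4 + p5 + p6)"
      by simp
  qed
qed

section \<open>Half-flat structures in rank one\<close>

(* keeps the first basis vector in the form e 1 *)
declare One_nat_def [simp del]

text \<open>One family containing the nine rank one algebras. The \<open>a\<^sub>i\<close> are the weights of the derivation defined by
  \<open>e\<^sub>6\<close>, the \<open>c\<close> are the structure constants of the nilradical (\<open>c412\<close> is the coefficient of
  \<open>e\<^sup>1\<^sup>2\<close> in \<open>de\<^sup>4\<close>), and the common factor \<open>u\<close> is split off so that the \<open>a\<^sub>i\<close> can be integers.\<close>

definition rank_one :: "real \<Rightarrow> real \<Rightarrow> real \<Rightarrow> real \<Rightarrow> real \<Rightarrow> real \<Rightarrow> real \<Rightarrow>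
    real \<Rightarrow> real \<Rightarrow> real \<Rightarrow> real \<Rightarrow> real \<Rightarrow> real \<Rightarrow> real \<Rightarrow> 6 \<Rightarrow> form" where
  "rank_one u a1 a2 a3 a4 a5 c312 c412 c413 c512 c513 c514 c523 c534 = struct_eqs
     ((u * a1) \<cdot> cov2 1 6)
     ((u * a2) \<cdot> cov2 2 6)
     ((u * c312) \<cdot> cov2 1 2 + (u * a3) \<cdot> cov2 3 6)
     ((u * c412) \<cdot> cov2 1 2 + (u * c413) \<cdot> cov2 1 3 + (u * a4) \<cdot> cov2 4 6)
     ((u * c512) \<cdot> cov2 1 2 + (u * c513) \<cdot> cov2 1 3 + (u * c514) \<cdot> cov2 1 4
        + (u * c523) \<cdot> cov2 2 3 + (u * c534) \<cdot> cov2 3 4 + (u * a5) \<cdot> cov2 5 6)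
     0"

text \<open>These are the components of \<open>d\<psi>\<close> that contain \<open>e\<^sup>6\<close>. They determine every coefficient of \<open>\<psi>\<close> on
  the nilradical when the weights are positive.\<close>

lemma rank_one_closed:
  assumes \<psi>: "\<psi> \<in> Forms 3" and u: "u \<noteq> 0"
    and closed: "ce_diff (bracket (rank_one u a1 a2 a3 a4 a5 c312 c412 c413 c512 c513 c514 c523 c534)) \<psi> = 0"
  shows "(a1 + a2 + a3) * \<psi> [e 1, e 2, e 3] = c523 * \<psi> [e 1, e 5, e 6] + c412 * \<psi> [e 3, e 4, e 6] + c512 * \<psi> [e 3, e 5, e 6] - c413 * \<psi> [e 2, e 4, e 6] - c513 * \<psi> [e 2, e 5, e 6]"
    "(a1 + a2 + a4) * \<psi> [e 1, e 2, e 4] = c512 * \<psi> [e 4, e 5, e 6] - c514 * \<psi> [e 2, e 5, e 6] - c312 * \<psi> [e 3, e 4, e 6]"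
    "(a1 + a2 + a5) * \<psi> [e 1, e 2, e 5] = - c312 * \<psi> [e 3, e 5, e 6] - c412 * \<psi> [e 4, e 5, e 6]"
    "(a1 + a3 + a4) * \<psi> [e 1, e 3, e 4] = c534 * \<psi> [e 1, e 5, e 6] + c513 * \<psi> [e 4, e 5, e 6] - c514 * \<psi> [e 3, e 5, e 6]"
    "(a1 + a3 + a5) * \<psi> [e 1, e 3, e 5] = - c413 * \<psi> [e 4, e 5, e 6]"
    "(a1 + a4 + a5) * \<psi> [e 1, e 4, e 5] = 0"
    "(a2 + a3 + a4) * \<psi> [e 2, e 3, e 4] = c534 * \<psi> [e 2, e 5, e 6] + c523 * \<psi> [e 4, e 5, e 6]"
    "(a2 + a3 + a5) * \<psi> [e 2, e 3, e 5] = 0"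
    "(a2 + a4 + a5) * \<psi> [e 2, e 4, e 5] = 0"
    "(a3 + a4 + a5) * \<psi> [e 3, e 4, e 5] = 0"
proof -
  let ?D = "rank_one u a1 a2 a3 a4 a5 c312 c412 c413 c512 c513 c514 c523 c534"
  have *: "x = y" if "ce_diff (bracket ?D) \<psi> [e a, e b, e c, e 6] = u * (x - y)" for a b c x y
    using that u by (simp add: closed)
  have lin: "linear (\<lambda>v. \<psi> [v, x, y])" for x y
    using Forms_linear_hd[OF \<psi>, of "[x, y]"] .
  note [simp] = ce_diff_4 linear_bracket[OF lin] rank_one_def struct_eqs_def
    e_nth scale_form_def Forms_3_sort[OF \<psi>] algebra_simps
  show "(a1 + a2 + a3) * \<psi> [e 1, e 2, e 3] = c523 * \<psi> [e 1, e 5, e 6] + c412 * \<psi> [e 3, e 4, e 6] + c512 * \<psi> [e 3, e 5, e 6] - c413 * \<psi> [e 2, e 4, e 6] - c513 * \<psi> [e 2, e 5, e 6]"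
    by (rule *[of 1 2 3]) simp
  show "(a1 + a2 + a4) * \<psi> [e 1, e 2, e 4] = c512 * \<psi> [e 4, e 5, e 6] - c514 * \<psi> [e 2, e 5, e 6] - c312 * \<psi> [e 3, e 4, e 6]"
    by (rule *[of 1 2 4]) simp
  show "(a1 + a2 + a5) * \<psi> [e 1, e 2, e 5] = - c312 * \<psi> [e 3, e 5, e 6] - c412 * \<psi> [e 4, e 5, e 6]"
    by (rule *[of 1 2 5]) simp
  show "(a1 + a3 + a4) * \<psi> [e 1, e 3, e 4] = c534 * \<psi> [e 1, e 5, e 6] + c513 * \<psi> [e 4, e 5, e 6] - c514 * \<psi> [e 3, e 5, e 6]"
    by (rule *[of 1 3 4]) simp
  show "(a1 + a3 + a5) * \<psi> [e 1, e 3, e 5] = - c413 * \<psi> [e 4, e 5, e 6]"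
    by (rule *[of 1 3 5]) simp
  show "(a1 + a4 + a5) * \<psi> [e 1, e 4, e 5] = 0"
    by (rule *[of 1 4 5]) simp
  show "(a2 + a3 + a4) * \<psi> [e 2, e 3, e 4] = c534 * \<psi> [e 2, e 5, e 6] + c523 * \<psi> [e 4, e 5, e 6]"
    by (rule *[of 2 3 4]) simp
  show "(a2 + a3 + a5) * \<psi> [e 2, e 3, e 5] = 0"
    by (rule *[of 2 3 5]) simp
  show "(a2 + a4 + a5) * \<psi> [e 2, e 4, e 5] = 0"
    by (rule *[of 2 4 5]) simp
  show "(a3 + a4 + a5) * \<psi> [e 3, e 4, e 5] = 0"
    by (rule *[of 3 4 5]) simp
qed

text \<open>Cauchy-Schwarz for the vectors \<open>(c / \<surd>A, d / \<surd>B)\<close> and \<open>(\<surd>A x, \<surd>B y)\<close>. It is used with \<open>A\<close>, \<open>B\<close> equal to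
  the weights of \<open>x\<^sup>2\<close>, \<open>y\<^sup>2\<close> in the target sum, which makes it sharp there.\<close>

lemma weighted_cauchy:
  fixes A B :: real
  assumes "n * s = c * x + d * y" "A > 0" "B > 0"
  shows "n\<^sup>2 * s\<^sup>2 \<le> (c\<^sup>2 / A + d\<^sup>2 / B) * (A * x\<^sup>2 + B * y\<^sup>2)"
proof -
  have "(c\<^sup>2 / A + d\<^sup>2 / B) * (A * x\<^sup>2 + B * y\<^sup>2) - (c * x + d * y)\<^sup>2 = (c * y * B - d * x * A)\<^sup>2 / (A * B)"
    using assms(2,3) by (simp add: field_simps power2_eq_square)
  moreover have "(c * y * B - d * x * A)\<^sup>2 / (A * B) \<ge> 0"
    using assms(2,3) by simp
  moreover have "n\<^sup>2 * s\<^sup>2 = (c * x + d * y)\<^sup>2"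
    unfolding assms(1)[symmetric] by (rule power_mult_distrib[symmetric])
  ultimately show ?thesis
    by linarith
qed

lemma square_eq: "n\<^sup>2 * s\<^sup>2 = c\<^sup>2 * x\<^sup>2" if "n * s = c * x" for n :: real
  by (metis that power_mult_distrib)

text \<open>The coefficients of \<open>\<tau> = i\<^bsub>e\<^sub>6\<^esub> \<psi>\<close>; these remain free for a closed form in rank one, and linear
  arithmetic has to know the sign of their squares.\<close>

lemma tau_squares_nonneg:
  fixes \<psi> :: form
  shows "(\<psi> [e 1, e 2, e 6])\<^sup>2 \<ge> 0" "(\<psi> [e 1, e 3, e 6])\<^sup>2 \<ge> 0" "(\<psi> [e 1, e 4, e 6])\<^sup>2 \<ge> 0"
    "(\<psi> [e 1, e 5, e 6])\<^sup>2 \<ge> 0" "(\<psi> [e 2, e 3, e 6])\<^sup>2 \<ge> 0" "(\<psi> [e 2, e 4, e 6])\<^sup>2 \<ge> 0"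
    "(\<psi> [e 2, e 5, e 6])\<^sup>2 \<ge> 0" "(\<psi> [e 3, e 4, e 6])\<^sup>2 \<ge> 0" "(\<psi> [e 3, e 5, e 6])\<^sup>2 \<ge> 0"
    "(\<psi> [e 4, e 5, e 6])\<^sup>2 \<ge> 0"
  by simp_all

lemma half_flatD:
  assumes "half_flat br \<omega> \<psi>"
  shows "\<psi> \<in> Forms 3" "su3_structure \<omega> \<psi>" "ce_diff br \<psi> = 0"
  using assms by (auto simp: half_flat_def su3_structure_def stable3_def)

lemma scale_form_0 [simp]: "0 \<cdot> \<alpha> = 0"
  by (auto simp: scale_form_def)

lemma s1_rank_one: "s1 r = rank_one (r / (2 * sqrt 2)) 1 1 1 1 2 0 0 0 (- 2) 0 0 0 (- 2)"
  by (simp add: s1_def rank_one_def mult_ac)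

text \<open>The pattern for the rank one algebras other than \<open>\<ss>\<^sub>6\<close>. The six numbers are weights \<open>p\<^sub>i\<close> with sum \<open>-1\<close>, giving the
  positive weight \<open>p\<^sub>i + p\<^sub>j + p\<^sub>6\<close> to each square \<open>\<psi>\<^sub>i\<^sub>j\<^sub>6\<^sup>2\<close>. The squares with negative weight belong to the
  nilradical; closedness bounds them by the others so well that the weighted sum stays nonnegative.
  Such weights are found by maximizing the smallest eigenvalue of the weighted sum on the closed forms
  and rounding.\<close>

lemma s1_not_half_flat:
  assumes "r > 0" "half_flat (bracket (s1 r)) \<omega> \<psi>" "induced_metric \<omega> \<psi> = std_metric"
  shows False
proof -
  have u: "r / (2 * sqrt 2) \<noteq> 0"
    using assms(1) by simp
  note hf = half_flatD[OF assms(2)[unfolded s1_rank_one]]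
  note closed = rank_one_closed[OF hf(1) u hf(3)]
  obtain \<kappa> where \<kappa>: "\<kappa> > 0"
    "\<And>p1 p2 p3 p4 p5 p6. weighted_norm2 \<psi> p1 p2 p3 p4 p5 p6 = 2 * \<kappa> * (p1 + p2 + p3 + p4 + p5 + p6)"
    by (rule su3_weighted_gram[OF hf(2) assms(3)]) blast
  moreover have "(\<psi> [e 1, e 2, e 5])\<^sup>2 = 0" "(\<psi> [e 1, e 3, e 5])\<^sup>2 = 0" "(\<psi> [e 1, e 4, e 5])\<^sup>2 = 0"
      "(\<psi> [e 2, e 3, e 5])\<^sup>2 = 0" "(\<psi> [e 2, e 4, e 5])\<^sup>2 = 0" "(\<psi> [e 3, e 4, e 5])\<^sup>2 = 0"
    using closed by simp_all
  moreover have "9 * (\<psi> [e 1, e 2, e 3])\<^sup>2 = 4 * (\<psi> [e 3, e 5, e 6])\<^sup>2"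
    using square_eq[of 3 "\<psi> [e 1, e 2, e 3]" "- 2" "\<psi> [e 3, e 5, e 6]"] closed by simp
  moreover have "9 * (\<psi> [e 1, e 2, e 4])\<^sup>2 = 4 * (\<psi> [e 4, e 5, e 6])\<^sup>2"
    using square_eq[of 3 "\<psi> [e 1, e 2, e 4]" "- 2" "\<psi> [e 4, e 5, e 6]"] closed by simp
  moreover have "9 * (\<psi> [e 1, e 3, e 4])\<^sup>2 = 4 * (\<psi> [e 1, e 5, e 6])\<^sup>2"
    using square_eq[of 3 "\<psi> [e 1, e 3, e 4]" "- 2" "\<psi> [e 1, e 5, e 6]"] closed by simp
  moreover have "9 * (\<psi> [e 2, e 3, e 4])\<^sup>2 = 4 * (\<psi> [e 2, e 5, e 6])\<^sup>2"
    using square_eq[of 3 "\<psi> [e 2, e 3, e 4]" "- 2" "\<psi> [e 2, e 5, e 6]"] closed by simp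
  ultimately show False
    using \<kappa>(2)[of "-1" "-1" "-1" "-1" 0 3, unfolded weighted_norm2_def, simplified]
      tau_squares_nonneg[of \<psi>]
    by linarith
qed

lemma s2_rank_one: "s2 r = rank_one (r / sqrt 210) 4 3 7 6 10 (- sqrt 120) 0 0 0 0 (- sqrt 60) (- sqrt 120) 0"
proof -
  have ids: "sqrt (2 / 105) = 2 / sqrt 210" "sqrt (3 / 70) = 3 / sqrt 210" "sqrt (7 / 30) = 7 / sqrt 210"
      "sqrt (10 / 21) = 10 / sqrt 210" "sqrt (2 / 7) = sqrt 60 / sqrt 210" "sqrt 7 = 2 * sqrt 210 / sqrt 120"
    by (rule power2_eq_imp_eq; simp add: power_divide power_mult_distrib)+
  show ?thesis
    by (simp add: s2_def rank_one_def ids mult_ac)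
qed

text \<open>Here \<open>\<psi>\<^sub>1\<^sub>2\<^sub>4\<close> depends on two coefficients of \<open>\<tau>\<close>, whose weights are \<open>8\<close> and \<open>9\<close>.\<close>

lemma s2_not_half_flat:
  assumes "r > 0" "half_flat (bracket (s2 r)) \<omega> \<psi>" "induced_metric \<omega> \<psi> = std_metric"
  shows False
proof -
  have u: "r / sqrt 210 \<noteq> 0"
    using assms(1) by simp
  note hf = half_flatD[OF assms(2)[unfolded s2_rank_one]]
  note closed = rank_one_closed[OF hf(1) u hf(3)]
  obtain \<kappa> where \<kappa>: "\<kappa> > 0"
    "\<And>p1 p2 p3 p4 p5 p6. weighted_norm2 \<psi> p1 p2 p3 p4 p5 p6 = 2 * \<kappa> * (p1 + p2 + p3 + p4 + p5 + p6)"
    by (rule su3_weighted_gram[OF hf(2) assms(3)]) blast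
  moreover have "(\<psi> [e 1, e 3, e 5])\<^sup>2 = 0" "(\<psi> [e 1, e 4, e 5])\<^sup>2 = 0" "(\<psi> [e 2, e 3, e 5])\<^sup>2 = 0"
      "(\<psi> [e 2, e 4, e 5])\<^sup>2 = 0" "(\<psi> [e 3, e 4, e 5])\<^sup>2 = 0"
    using closed by simp_all
  moreover have "196 * (\<psi> [e 1, e 2, e 3])\<^sup>2 = 120 * (\<psi> [e 1, e 5, e 6])\<^sup>2"
    using square_eq[of 14 "\<psi> [e 1, e 2, e 3]" "- sqrt 120" "\<psi> [e 1, e 5, e 6]"] closed by simp
  moreover have "1014 * (\<psi> [e 1, e 2, e 4])\<^sup>2 \<le> 1000 * (\<psi> [e 2, e 5, e 6])\<^sup>2
      + 1125 * (\<psi> [e 3, e 4, e 6])\<^sup>2"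
    using weighted_cauchy[of 13 "\<psi> [e 1, e 2, e 4]" "sqrt 60" "\<psi> [e 2, e 5, e 6]"
        "sqrt 120" "\<psi> [e 3, e 4, e 6]" 8 9] closed by simp
  moreover have "289 * (\<psi> [e 1, e 2, e 5])\<^sup>2 = 120 * (\<psi> [e 3, e 5, e 6])\<^sup>2"
    using square_eq[of 17 "\<psi> [e 1, e 2, e 5]" "sqrt 120" "\<psi> [e 3, e 5, e 6]"] closed by simp
  moreover have "289 * (\<psi> [e 1, e 3, e 4])\<^sup>2 = 60 * (\<psi> [e 3, e 5, e 6])\<^sup>2"
    using square_eq[of 17 "\<psi> [e 1, e 3, e 4]" "sqrt 60" "\<psi> [e 3, e 5, e 6]"] closed by simp
  moreover have "256 * (\<psi> [e 2, e 3, e 4])\<^sup>2 = 120 * (\<psi> [e 4, e 5, e 6])\<^sup>2"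
    using square_eq[of 16 "\<psi> [e 2, e 3, e 4]" "- sqrt 120" "\<psi> [e 4, e 5, e 6]"] closed by simp
  ultimately show False
    using \<kappa>(2)[of "-4" "-2" "-3" "-2" "-4" 14, unfolded weighted_norm2_def, simplified]
      tau_squares_nonneg[of \<psi>]
    by linarith
qed

lemma s3_rank_one: "s3 r = rank_one (r / sqrt 55) 1 2 3 4 5 (- sqrt 30) 0 (- sqrt 30) 0 0 (- sqrt 20) (- sqrt 20) 0"
proof -
  have ids: "sqrt (6 / 11) = sqrt 30 / sqrt 55" "sqrt 11 = 2 * sqrt 55 / sqrt 20"
    by (rule power2_eq_imp_eq; simp add: power_divide power_mult_distrib)+
  show ?thesis
    by (simp add: s3_def rank_one_def ids mult_ac)
qed

lemma s3_not_half_flat: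
  assumes "r > 0" "half_flat (bracket (s3 r)) \<omega> \<psi>" "induced_metric \<omega> \<psi> = std_metric"
  shows False
proof -
  have u: "r / sqrt 55 \<noteq> 0"
    using assms(1) by simp
  note hf = half_flatD[OF assms(2)[unfolded s3_rank_one]]
  note closed = rank_one_closed[OF hf(1) u hf(3)]
  obtain \<kappa> where \<kappa>: "\<kappa> > 0"
    "\<And>p1 p2 p3 p4 p5 p6. weighted_norm2 \<psi> p1 p2 p3 p4 p5 p6 = 2 * \<kappa> * (p1 + p2 + p3 + p4 + p5 + p6)"
    by (rule su3_weighted_gram[OF hf(2) assms(3)]) blast
  moreover have "(\<psi> [e 1, e 4, e 5])\<^sup>2 = 0" "(\<psi> [e 2, e 3, e 5])\<^sup>2 = 0" "(\<psi> [e 2, e 4, e 5])\<^sup>2 = 0"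
      "(\<psi> [e 3, e 4, e 5])\<^sup>2 = 0"
    using closed by simp_all
  moreover have "18 * (\<psi> [e 1, e 2, e 3])\<^sup>2 \<le> 25 * (\<psi> [e 1, e 5, e 6])\<^sup>2
      + 25 * (\<psi> [e 2, e 4, e 6])\<^sup>2"
    using weighted_cauchy[of 6 "\<psi> [e 1, e 2, e 3]" "- sqrt 20" "\<psi> [e 1, e 5, e 6]"
        "sqrt 30" "\<psi> [e 2, e 4, e 6]" 21 21] closed by simp
  moreover have "7007 * (\<psi> [e 1, e 2, e 4])\<^sup>2 \<le> 10120 * (\<psi> [e 2, e 5, e 6])\<^sup>2
      + 5980 * (\<psi> [e 3, e 4, e 6])\<^sup>2"
    using weighted_cauchy[of 7 "\<psi> [e 1, e 2, e 4]" "sqrt 20" "\<psi> [e 2, e 5, e 6]"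
        "sqrt 30" "\<psi> [e 3, e 4, e 6]" 22 13] closed by simp
  moreover have "64 * (\<psi> [e 1, e 2, e 5])\<^sup>2 = 30 * (\<psi> [e 3, e 5, e 6])\<^sup>2"
    using square_eq[of 8 "\<psi> [e 1, e 2, e 5]" "sqrt 30" "\<psi> [e 3, e 5, e 6]"] closed by simp
  moreover have "64 * (\<psi> [e 1, e 3, e 4])\<^sup>2 = 20 * (\<psi> [e 3, e 5, e 6])\<^sup>2"
    using square_eq[of 8 "\<psi> [e 1, e 3, e 4]" "sqrt 20" "\<psi> [e 3, e 5, e 6]"] closed by simp
  moreover have "81 * (\<psi> [e 1, e 3, e 5])\<^sup>2 = 30 * (\<psi> [e 4, e 5, e 6])\<^sup>2"
    using square_eq[of 9 "\<psi> [e 1, e 3, e 5]" "sqrt 30" "\<psi> [e 4, e 5, e 6]"] closed by simp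
  moreover have "81 * (\<psi> [e 2, e 3, e 4])\<^sup>2 = 20 * (\<psi> [e 4, e 5, e 6])\<^sup>2"
    using square_eq[of 9 "\<psi> [e 2, e 3, e 4]" "- sqrt 20" "\<psi> [e 4, e 5, e 6]"] closed by simp
  ultimately show False
    using \<kappa>(2)[of "-3" "-2" "-10" "-10" "-9" 33, unfolded weighted_norm2_def, simplified]
      tau_squares_nonneg[of \<psi>]
    by linarith
qed

lemma s4_rank_one: "s4 r = rank_one (r * sqrt 6 / 60) 2 9 11 13 15 (- sqrt 300) 0 (- 20) 0 0 (- sqrt 300) 0 0"
proof -
  have ids: "sqrt 2 = 60 / (sqrt 6 * sqrt 300)" "sqrt (2 / 3) = sqrt 6 / 3"
    by (rule power2_eq_imp_eq; simp add: power_divide power_mult_distrib)+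
  show ?thesis
    by (simp add: s4_def rank_one_def ids mult_ac)
qed

lemma s4_not_half_flat:
  assumes "r > 0" "half_flat (bracket (s4 r)) \<omega> \<psi>" "induced_metric \<omega> \<psi> = std_metric"
  shows False
proof -
  have u: "r * sqrt 6 / 60 \<noteq> 0"
    using assms(1) by simp
  note hf = half_flatD[OF assms(2)[unfolded s4_rank_one]]
  note closed = rank_one_closed[OF hf(1) u hf(3)]
  obtain \<kappa> where \<kappa>: "\<kappa> > 0"
    "\<And>p1 p2 p3 p4 p5 p6. weighted_norm2 \<psi> p1 p2 p3 p4 p5 p6 = 2 * \<kappa> * (p1 + p2 + p3 + p4 + p5 + p6)"
    by (rule su3_weighted_gram[OF hf(2) assms(3)]) blast
  moreover have "(\<psi> [e 1, e 4, e 5])\<^sup>2 = 0" "(\<psi> [e 2, e 3, e 4])\<^sup>2 = 0" "(\<psi> [e 2, e 3, e 5])\<^sup>2 = 0"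
      "(\<psi> [e 2, e 4, e 5])\<^sup>2 = 0" "(\<psi> [e 3, e 4, e 5])\<^sup>2 = 0"
    using closed by simp_all
  moreover have "484 * (\<psi> [e 1, e 2, e 3])\<^sup>2 = 400 * (\<psi> [e 2, e 4, e 6])\<^sup>2"
    using square_eq[of 22 "\<psi> [e 1, e 2, e 3]" "20" "\<psi> [e 2, e 4, e 6]"] closed by simp
  moreover have "24 * (\<psi> [e 1, e 2, e 4])\<^sup>2 \<le> 25 * (\<psi> [e 2, e 5, e 6])\<^sup>2
      + 25 * (\<psi> [e 3, e 4, e 6])\<^sup>2"
    using weighted_cauchy[of 24 "\<psi> [e 1, e 2, e 4]" "sqrt 300" "\<psi> [e 2, e 5, e 6]"
        "sqrt 300" "\<psi> [e 3, e 4, e 6]" 37 37] closed by simp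
  moreover have "676 * (\<psi> [e 1, e 2, e 5])\<^sup>2 = 300 * (\<psi> [e 3, e 5, e 6])\<^sup>2"
    using square_eq[of 26 "\<psi> [e 1, e 2, e 5]" "sqrt 300" "\<psi> [e 3, e 5, e 6]"] closed by simp
  moreover have "676 * (\<psi> [e 1, e 3, e 4])\<^sup>2 = 300 * (\<psi> [e 3, e 5, e 6])\<^sup>2"
    using square_eq[of 26 "\<psi> [e 1, e 3, e 4]" "sqrt 300" "\<psi> [e 3, e 5, e 6]"] closed by simp
  moreover have "784 * (\<psi> [e 1, e 3, e 5])\<^sup>2 = 400 * (\<psi> [e 4, e 5, e 6])\<^sup>2"
    using square_eq[of 28 "\<psi> [e 1, e 3, e 5]" "20" "\<psi> [e 4, e 5, e 6]"] closed by simp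
  ultimately show False
    using \<kappa>(2)[of "-19" "-8" "-11" "-8" "-11" 56, unfolded weighted_norm2_def, simplified]
      tau_squares_nonneg[of \<psi>]
    by linarith
qed

lemma s5_rank_one: "s5 r = rank_one (r / (6 * sqrt 2)) 2 3 3 5 5 0 (- 6) 0 0 (- 6) 0 0 0"
  by (simp add: s5_def rank_one_def mult_ac)

lemma s5_not_half_flat:
  assumes "r > 0" "half_flat (bracket (s5 r)) \<omega> \<psi>" "induced_metric \<omega> \<psi> = std_metric"
  shows False
proof -
  have u: "r / (6 * sqrt 2) \<noteq> 0"
    using assms(1) by simp
  note hf = half_flatD[OF assms(2)[unfolded s5_rank_one]]
  note closed = rank_one_closed[OF hf(1) u hf(3)]
  obtain \<kappa> where \<kappa>: "\<kappa> > 0"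
    "\<And>p1 p2 p3 p4 p5 p6. weighted_norm2 \<psi> p1 p2 p3 p4 p5 p6 = 2 * \<kappa> * (p1 + p2 + p3 + p4 + p5 + p6)"
    by (rule su3_weighted_gram[OF hf(2) assms(3)]) blast
  moreover have "(\<psi> [e 1, e 2, e 4])\<^sup>2 = 0" "(\<psi> [e 1, e 3, e 5])\<^sup>2 = 0" "(\<psi> [e 1, e 4, e 5])\<^sup>2 = 0"
      "(\<psi> [e 2, e 3, e 4])\<^sup>2 = 0" "(\<psi> [e 2, e 3, e 5])\<^sup>2 = 0" "(\<psi> [e 2, e 4, e 5])\<^sup>2 = 0"
      "(\<psi> [e 3, e 4, e 5])\<^sup>2 = 0"
    using closed by simp_all
  moreover have "8 * (\<psi> [e 1, e 2, e 3])\<^sup>2 \<le> 9 * (\<psi> [e 2, e 5, e 6])\<^sup>2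
      + 9 * (\<psi> [e 3, e 4, e 6])\<^sup>2"
    using weighted_cauchy[of 8 "\<psi> [e 1, e 2, e 3]" "6" "\<psi> [e 2, e 5, e 6]"
        "- 6" "\<psi> [e 3, e 4, e 6]" 17 17] closed by simp
  moreover have "100 * (\<psi> [e 1, e 2, e 5])\<^sup>2 = 36 * (\<psi> [e 4, e 5, e 6])\<^sup>2"
    using square_eq[of 10 "\<psi> [e 1, e 2, e 5]" "6" "\<psi> [e 4, e 5, e 6]"] closed by simp
  moreover have "100 * (\<psi> [e 1, e 3, e 4])\<^sup>2 = 36 * (\<psi> [e 4, e 5, e 6])\<^sup>2"
    using square_eq[of 10 "\<psi> [e 1, e 3, e 4]" "- 6" "\<psi> [e 4, e 5, e 6]"] closed by simp
  ultimately show False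
    using \<kappa>(2)[of "-9" "-3" "-3" "-6" "-6" 26, unfolded weighted_norm2_def, simplified]
      tau_squares_nonneg[of \<psi>]
    by linarith
qed

lemma s6_rank_one: "s6 r = rank_one (r / (2 * sqrt 6)) 1 1 2 3 3 (- 4) 0 (- sqrt 12) 0 0 0 (- sqrt 12) 0"
proof -
  have ids: "sqrt (2 / 3) = 2 / sqrt 6" "sqrt 2 = 2 * sqrt 6 / sqrt 12"
    by (rule power2_eq_imp_eq; simp add: power_divide power_mult_distrib)+
  have id: "r * sqrt 6 / 4 = r * 3 / (2 * sqrt 6)"
    by (simp add: field_simps)
  show ?thesis
    by (simp add: s6_def rank_one_def ids id mult_ac)
qed

text \<open>Equality of the six norms alone does not suffice: it is compatible with the closed form in which
  \<open>\<psi>\<^sub>2\<^sub>4\<^sub>6 = - \<psi>\<^sub>1\<^sub>5\<^sub>6 = 1\<close>, \<open>\<psi>\<^sub>1\<^sub>2\<^sub>3 = \<psi>\<^sub>4\<^sub>5\<^sub>6 = \<surd>3\<close> and \<open>\<psi>\<^sub>1\<^sub>3\<^sub>5 = - \<psi>\<^sub>2\<^sub>3\<^sub>4 = 1\<close>. For it \<open>2 \<kappa> = 5\<close> and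
  \<open>|\<psi>(e\<^sub>1, e\<^sub>2, \<cdot>)|\<^sup>2 = 3 > \<kappa>\<close>. So the bound for this pair is added with multiplicity \<open>14\<close>, and
  \<open>2 \<Sum> p\<^sub>i + 14 = -2\<close> is still negative.\<close>

lemma s6_not_half_flat:
  assumes "r > 0" "half_flat (bracket (s6 r)) \<omega> \<psi>" "induced_metric \<omega> \<psi> = std_metric"
  shows False
proof -
  have u: "r / (2 * sqrt 6) \<noteq> 0"
    using assms(1) by simp
  note hf = half_flatD[OF assms(2)[unfolded s6_rank_one]]
  note closed = rank_one_closed[OF hf(1) u hf(3)]
  obtain \<kappa> where \<kappa>: "\<kappa> > 0"
    "\<And>p1 p2 p3 p4 p5 p6. weighted_norm2 \<psi> p1 p2 p3 p4 p5 p6 = 2 * \<kappa> * (p1 + p2 + p3 + p4 + p5 + p6)"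
    "(\<psi> [e 1, e 2, e 3])\<^sup>2 + (\<psi> [e 1, e 2, e 4])\<^sup>2 + (\<psi> [e 1, e 2, e 5])\<^sup>2 + (\<psi> [e 1, e 2, e 6])\<^sup>2 \<le> \<kappa>"
    by (rule su3_weighted_gram[OF hf(2) assms(3)]) blast
  moreover have "(\<psi> [e 1, e 3, e 4])\<^sup>2 = 0" "(\<psi> [e 1, e 4, e 5])\<^sup>2 = 0" "(\<psi> [e 2, e 3, e 5])\<^sup>2 = 0"
      "(\<psi> [e 2, e 4, e 5])\<^sup>2 = 0" "(\<psi> [e 3, e 4, e 5])\<^sup>2 = 0"
    using closed by simp_all
  moreover have "36 * (\<psi> [e 1, e 3, e 5])\<^sup>2 = 12 * (\<psi> [e 4, e 5, e 6])\<^sup>2"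
    using square_eq[of 6 "\<psi> [e 1, e 3, e 5]" "sqrt 12" "\<psi> [e 4, e 5, e 6]"] closed by simp
  moreover have "36 * (\<psi> [e 2, e 3, e 4])\<^sup>2 = 12 * (\<psi> [e 4, e 5, e 6])\<^sup>2"
    using square_eq[of 6 "\<psi> [e 2, e 3, e 4]" "- sqrt 12" "\<psi> [e 4, e 5, e 6]"] closed by simp
  ultimately show False
    using \<kappa>(2)[of "-6" "-6" "-2" "-1" "-1" 8, unfolded weighted_norm2_def, simplified]
      tau_squares_nonneg[of \<psi>]
      zero_le_power2[of "\<psi> [e 1, e 2, e 4]"] zero_le_power2[of "\<psi> [e 1, e 2, e 5]"]
    by linarith
qed

lemma s7_rank_one: "s7 r = rank_one (r / sqrt 39) 1 2 3 4 3 (- sqrt 26) 0 (- sqrt 26) 0 0 0 0 0"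
proof -
  have ids: "sqrt (2 / 3) = sqrt 26 / sqrt 39"
    by (rule power2_eq_imp_eq; simp add: power_divide power_mult_distrib)+
  show ?thesis
    by (simp add: s7_def rank_one_def ids mult_ac)
qed

lemma s7_not_half_flat:
  assumes "r > 0" "half_flat (bracket (s7 r)) \<omega> \<psi>" "induced_metric \<omega> \<psi> = std_metric"
  shows False
proof -
  have u: "r / sqrt 39 \<noteq> 0"
    using assms(1) by simp
  note hf = half_flatD[OF assms(2)[unfolded s7_rank_one]]
  note closed = rank_one_closed[OF hf(1) u hf(3)]
  obtain \<kappa> where \<kappa>: "\<kappa> > 0"
    "\<And>p1 p2 p3 p4 p5 p6. weighted_norm2 \<psi> p1 p2 p3 p4 p5 p6 = 2 * \<kappa> * (p1 + p2 + p3 + p4 + p5 + p6)"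
    by (rule su3_weighted_gram[OF hf(2) assms(3)]) blast
  moreover have "(\<psi> [e 1, e 3, e 4])\<^sup>2 = 0" "(\<psi> [e 1, e 4, e 5])\<^sup>2 = 0" "(\<psi> [e 2, e 3, e 4])\<^sup>2 = 0"
      "(\<psi> [e 2, e 3, e 5])\<^sup>2 = 0" "(\<psi> [e 2, e 4, e 5])\<^sup>2 = 0" "(\<psi> [e 3, e 4, e 5])\<^sup>2 = 0"
    using closed by simp_all
  moreover have "36 * (\<psi> [e 1, e 2, e 3])\<^sup>2 = 26 * (\<psi> [e 2, e 4, e 6])\<^sup>2"
    using square_eq[of 6 "\<psi> [e 1, e 2, e 3]" "sqrt 26" "\<psi> [e 2, e 4, e 6]"] closed by simp
  moreover have "49 * (\<psi> [e 1, e 2, e 4])\<^sup>2 = 26 * (\<psi> [e 3, e 4, e 6])\<^sup>2"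
    using square_eq[of 7 "\<psi> [e 1, e 2, e 4]" "sqrt 26" "\<psi> [e 3, e 4, e 6]"] closed by simp
  moreover have "36 * (\<psi> [e 1, e 2, e 5])\<^sup>2 = 26 * (\<psi> [e 3, e 5, e 6])\<^sup>2"
    using square_eq[of 6 "\<psi> [e 1, e 2, e 5]" "sqrt 26" "\<psi> [e 3, e 5, e 6]"] closed by simp
  moreover have "49 * (\<psi> [e 1, e 3, e 5])\<^sup>2 = 26 * (\<psi> [e 4, e 5, e 6])\<^sup>2"
    using square_eq[of 7 "\<psi> [e 1, e 3, e 5]" "sqrt 26" "\<psi> [e 4, e 5, e 6]"] closed by simp
  ultimately show False
    using \<kappa>(2)[of "-3" "-1" "-2" "-2" "-2" 9, unfolded weighted_norm2_def, simplified]
      tau_squares_nonneg[of \<psi>]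
    by linarith
qed

lemma s8_rank_one: "s8 r = rank_one (r / sqrt 42) 2 2 4 3 3 (- sqrt 28) 0 0 0 0 0 0 0"
proof -
  have ids: "sqrt (2 / 21) = 2 / sqrt 42" "sqrt (3 / 14) = 3 / sqrt 42" "sqrt (2 / 3) = sqrt 28 / sqrt 42"
    by (rule power2_eq_imp_eq; simp add: power_divide power_mult_distrib)+
  show ?thesis
    by (simp add: s8_def rank_one_def ids mult_ac)
qed

lemma s8_not_half_flat:
  assumes "r > 0" "half_flat (bracket (s8 r)) \<omega> \<psi>" "induced_metric \<omega> \<psi> = std_metric"
  shows False
proof -
  have u: "r / sqrt 42 \<noteq> 0"
    using assms(1) by simp
  note hf = half_flatD[OF assms(2)[unfolded s8_rank_one]]
  note closed = rank_one_closed[OF hf(1) u hf(3)]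
  obtain \<kappa> where \<kappa>: "\<kappa> > 0"
    "\<And>p1 p2 p3 p4 p5 p6. weighted_norm2 \<psi> p1 p2 p3 p4 p5 p6 = 2 * \<kappa> * (p1 + p2 + p3 + p4 + p5 + p6)"
    by (rule su3_weighted_gram[OF hf(2) assms(3)]) blast
  moreover have "(\<psi> [e 1, e 2, e 3])\<^sup>2 = 0" "(\<psi> [e 1, e 3, e 4])\<^sup>2 = 0" "(\<psi> [e 1, e 3, e 5])\<^sup>2 = 0"
      "(\<psi> [e 1, e 4, e 5])\<^sup>2 = 0" "(\<psi> [e 2, e 3, e 4])\<^sup>2 = 0" "(\<psi> [e 2, e 3, e 5])\<^sup>2 = 0"
      "(\<psi> [e 2, e 4, e 5])\<^sup>2 = 0" "(\<psi> [e 3, e 4, e 5])\<^sup>2 = 0"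
    using closed by simp_all
  moreover have "49 * (\<psi> [e 1, e 2, e 4])\<^sup>2 = 28 * (\<psi> [e 3, e 4, e 6])\<^sup>2"
    using square_eq[of 7 "\<psi> [e 1, e 2, e 4]" "sqrt 28" "\<psi> [e 3, e 4, e 6]"] closed by simp
  moreover have "49 * (\<psi> [e 1, e 2, e 5])\<^sup>2 = 28 * (\<psi> [e 3, e 5, e 6])\<^sup>2"
    using square_eq[of 7 "\<psi> [e 1, e 2, e 5]" "sqrt 28" "\<psi> [e 3, e 5, e 6]"] closed by simp
  ultimately show False
    using \<kappa>(2)[of "-1" "-1" 0 "-1" "-1" 3, unfolded weighted_norm2_def, simplified]
      tau_squares_nonneg[of \<psi>]
    by linarith
qed

lemma s9_rank_one: "s9 r = rank_one (r / sqrt 5) 1 1 1 1 1 0 0 0 0 0 0 0 0"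
  by (simp add: s9_def rank_one_def mult_ac)

lemma s9_not_half_flat:
  assumes "r > 0" "half_flat (bracket (s9 r)) \<omega> \<psi>" "induced_metric \<omega> \<psi> = std_metric"
  shows False
proof -
  have u: "r / sqrt 5 \<noteq> 0"
    using assms(1) by simp
  note hf = half_flatD[OF assms(2)[unfolded s9_rank_one]]
  note closed = rank_one_closed[OF hf(1) u hf(3)]
  obtain \<kappa> where \<kappa>: "\<kappa> > 0"
    "\<And>p1 p2 p3 p4 p5 p6. weighted_norm2 \<psi> p1 p2 p3 p4 p5 p6 = 2 * \<kappa> * (p1 + p2 + p3 + p4 + p5 + p6)"
    by (rule su3_weighted_gram[OF hf(2) assms(3)]) blast
  moreover have "(\<psi> [e 1, e 2, e 3])\<^sup>2 = 0" "(\<psi> [e 1, e 2, e 4])\<^sup>2 = 0" "(\<psi> [e 1, e 2, e 5])\<^sup>2 = 0"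
      "(\<psi> [e 1, e 3, e 4])\<^sup>2 = 0" "(\<psi> [e 1, e 3, e 5])\<^sup>2 = 0" "(\<psi> [e 1, e 4, e 5])\<^sup>2 = 0"
      "(\<psi> [e 2, e 3, e 4])\<^sup>2 = 0" "(\<psi> [e 2, e 3, e 5])\<^sup>2 = 0" "(\<psi> [e 2, e 4, e 5])\<^sup>2 = 0"
      "(\<psi> [e 3, e 4, e 5])\<^sup>2 = 0"
    using closed by simp_all
  ultimately show False
    using \<kappa>(2)[of "-1" "-1" "-1" "-1" "-1" 4, unfolded weighted_norm2_def, simplified]
      tau_squares_nonneg[of \<psi>]
    by linarith
qed

section \<open>Half-flat structures on the solvable algebra with four-dimensional abelian nilradical\<close>

text \<open>A family containing the rank two algebras. The \<open>a\<^sub>i\<close> and \<open>b\<^sub>i\<close> are the diagonal entries of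
  the derivations defined by \<open>e\<^sub>5\<close> and \<open>e\<^sub>6\<close>; the constants
  \<open>c112\<close> and \<open>c221\<close> allow \<open>e\<^sub>6\<close> to act on the plane of \<open>e\<^sub>1, e\<^sub>2\<close> by a matrix that is not diagonal.\<close>

definition rank_two :: "real \<Rightarrow> real \<Rightarrow> real \<Rightarrow> real \<Rightarrow> real \<Rightarrow> real \<Rightarrow> real \<Rightarrow>
    real \<Rightarrow> real \<Rightarrow> real \<Rightarrow> real \<Rightarrow> real \<Rightarrow> 6 \<Rightarrow> form" where
  "rank_two a1 a2 a3 a4 b1 b2 b3 b4 c112 c221 k m = struct_eqs
     (a1 \<cdot> cov2 1 5 + b1 \<cdot> cov2 1 6 + c112 \<cdot> cov2 2 6)
     (a2 \<cdot> cov2 2 5 + c221 \<cdot> cov2 1 6 + b2 \<cdot> cov2 2 6)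
     (k \<cdot> cov2 1 2 + a3 \<cdot> cov2 3 5 + b3 \<cdot> cov2 3 6)
     (m \<cdot> cov2 1 3 + a4 \<cdot> cov2 4 5 + b4 \<cdot> cov2 4 6)
     0 0"

lemma rank_two_closed:
  assumes \<psi>: "\<psi> \<in> Forms 3"
    and closed: "ce_diff (bracket (rank_two a1 a2 a3 a4 b1 b2 b3 b4 0 0 0 0)) \<psi> = 0"
  shows "(a1 + a2 + a3) * \<psi> [e 1, e 2, e 3] = 0" "(a1 + a2 + a4) * \<psi> [e 1, e 2, e 4] = 0"
    "(a1 + a3 + a4) * \<psi> [e 1, e 3, e 4] = 0" "(a2 + a3 + a4) * \<psi> [e 2, e 3, e 4] = 0"
    "(a1 + a2) * \<psi> [e 1, e 2, e 6] = (b1 + b2) * \<psi> [e 1, e 2, e 5]"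
    "(a1 + a3) * \<psi> [e 1, e 3, e 6] = (b1 + b3) * \<psi> [e 1, e 3, e 5]"
    "(a1 + a4) * \<psi> [e 1, e 4, e 6] = (b1 + b4) * \<psi> [e 1, e 4, e 5]"
    "(a2 + a3) * \<psi> [e 2, e 3, e 6] = (b2 + b3) * \<psi> [e 2, e 3, e 5]"
    "(a2 + a4) * \<psi> [e 2, e 4, e 6] = (b2 + b4) * \<psi> [e 2, e 4, e 5]"
    "(a3 + a4) * \<psi> [e 3, e 4, e 6] = (b3 + b4) * \<psi> [e 3, e 4, e 5]"
proof -
  let ?D = "rank_two a1 a2 a3 a4 b1 b2 b3 b4 0 0 0 0"
  have c: "ce_diff (bracket ?D) \<psi> xs = 0" for xs
    by (simp add: closed)
  have lin: "linear (\<lambda>v. \<psi> [v, x, y])" for x y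
    using Forms_linear_hd[OF \<psi>, of "[x, y]"] .
  note [simp] = ce_diff_4 linear_bracket[OF lin] rank_two_def struct_eqs_def e_nth scale_form_def
    Forms_3_sort[OF \<psi>]
  note f = c[of "[e 1, e 2, e 3, e 5]"] c[of "[e 1, e 2, e 4, e 5]"] c[of "[e 1, e 3, e 4, e 5]"]
    c[of "[e 2, e 3, e 4, e 5]"] c[of "[e 1, e 2, e 5, e 6]"] c[of "[e 1, e 3, e 5, e 6]"]
    c[of "[e 1, e 4, e 5, e 6]"] c[of "[e 2, e 3, e 5, e 6]"] c[of "[e 2, e 4, e 5, e 6]"]
    c[of "[e 3, e 4, e 5, e 6]"]
  show "(a1 + a2 + a3) * \<psi> [e 1, e 2, e 3] = 0" "(a1 + a2 + a4) * \<psi> [e 1, e 2, e 4] = 0"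
    "(a1 + a3 + a4) * \<psi> [e 1, e 3, e 4] = 0" "(a2 + a3 + a4) * \<psi> [e 2, e 3, e 4] = 0"
    "(a1 + a2) * \<psi> [e 1, e 2, e 6] = (b1 + b2) * \<psi> [e 1, e 2, e 5]"
    "(a1 + a3) * \<psi> [e 1, e 3, e 6] = (b1 + b3) * \<psi> [e 1, e 3, e 5]"
    "(a1 + a4) * \<psi> [e 1, e 4, e 6] = (b1 + b4) * \<psi> [e 1, e 4, e 5]"
    "(a2 + a3) * \<psi> [e 2, e 3, e 6] = (b2 + b3) * \<psi> [e 2, e 3, e 5]"
    "(a2 + a4) * \<psi> [e 2, e 4, e 6] = (b2 + b4) * \<psi> [e 2, e 4, e 5]"
    "(a3 + a4) * \<psi> [e 3, e 4, e 6] = (b3 + b4) * \<psi> [e 3, e 4, e 5]"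
    by (use f(1) in \<open>simp add: algebra_simps\<close>, use f(2) in \<open>simp add: algebra_simps\<close>,
        use f(3) in \<open>simp add: algebra_simps\<close>, use f(4) in \<open>simp add: algebra_simps\<close>,
        use f(5) in \<open>simp add: algebra_simps\<close>, use f(6) in \<open>simp add: algebra_simps\<close>,
        use f(7) in \<open>simp add: algebra_simps\<close>, use f(8) in \<open>simp add: algebra_simps\<close>,
        use f(9) in \<open>simp add: algebra_simps\<close>, use f(10) in \<open>simp add: algebra_simps\<close>)
qed

lemma s12_rank_two:
  "s12 r s t = rank_two (r / 2) (r / 2) (r / 2) (r / 2)
     (r * ((1 + s + t) / (2 * sqrt (1 + t^2 + s^2)))) (r * ((1 - s - t) / (2 * sqrt (1 + t^2 + s^2))))
     (r * ((t - s - 1) / (2 * sqrt (1 + t^2 + s^2)))) (r * ((s - t - 1) / (2 * sqrt (1 + t^2 + s^2)))) 0 0 0 0"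
  by (simp add: s12_def rank_two_def)

text \<open>Closedness kills \<open>\<psi>\<close> on the nilradical and gives \<open>\<psi>\<^sub>i\<^sub>j\<^sub>6 = \<rho>\<^sub>i\<^sub>j \<psi>\<^sub>i\<^sub>j\<^sub>5\<close> with
  \<open>\<rho>\<^sub>i\<^sub>j = \<plusminus>1/q, \<plusminus>t/q, \<plusminus>s/q\<close> and \<open>q\<^sup>2 = 1 + s\<^sup>2 + t\<^sup>2\<close>. The norms for \<open>e\<^sub>5\<close> and \<open>e\<^sub>6\<close> agree, so
  \<open>\<Sum> (1 - \<rho>\<^sub>i\<^sub>j\<^sup>2) \<psi>\<^sub>i\<^sub>j\<^sub>5\<^sup>2 = 0\<close>, and only \<open>\<rho>\<^sub>1\<^sub>2\<close> and \<open>\<rho>\<^sub>3\<^sub>4\<close> can have absolute value \<open>1\<close>.\<close>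

lemma s12_not_half_flat:
  assumes r: "r > 0" and hf: "half_flat (bracket (s12 r s t)) \<omega> \<psi>" and metric: "induced_metric \<omega> \<psi> = std_metric"
  shows False
proof -
  define q where "q = sqrt (1 + t^2 + s^2)"
  have q2: "q\<^sup>2 = 1 + t\<^sup>2 + s\<^sup>2"
    by (simp add: q_def)
  have q: "q > 0"
    by (simp add: q_def add_pos_nonneg)
  note hf' = half_flatD[OF hf[unfolded s12_rank_two, folded q_def]]
  note c = rank_two_closed[OF hf'(1,3)]
  obtain \<kappa> where \<kappa>: "\<kappa> > 0"
    and W: "\<And>p1 p2 p3 p4 p5 p6. weighted_norm2 \<psi> p1 p2 p3 p4 p5 p6 = 2 * \<kappa> * (p1 + p2 + p3 + p4 + p5 + p6)"
    and pair: "(\<psi> [e 1, e 2, e 3])\<^sup>2 + (\<psi> [e 1, e 2, e 4])\<^sup>2 + (\<psi> [e 1, e 2, e 5])\<^sup>2 + (\<psi> [e 1, e 2, e 6])\<^sup>2 \<le> \<kappa>"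
    by (rule su3_weighted_gram[OF hf'(2) metric]) blast
  have n: "\<psi> [e 1, e 2, e 3] = 0" "\<psi> [e 1, e 2, e 4] = 0" "\<psi> [e 1, e 3, e 4] = 0" "\<psi> [e 2, e 3, e 4] = 0"
    using c(1-4) r by simp_all
  define f where "f i j k = (\<psi> [e i, e j, e k])\<^sup>2" for i j k
  have f: "f i j k \<ge> 0" for i j k
    by (simp add: f_def)
  have sq: "q\<^sup>2 * f i j 6 = m\<^sup>2 * f i j 5"
    if "(r / 2 + r / 2) * \<psi> [e i, e j, e 6] = (r * (a / (2 * q)) + r * (b / (2 * q))) * \<psi> [e i, e j, e 5]" "a + b = 2 * m"
    for i j a b m
  proof -
    have "r * (a / (2 * q)) + r * (b / (2 * q)) = r * ((a + b) / (2 * q))"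
      by (simp add: add_divide_distrib distrib_left)
    also have "\<dots> = r * (m / q)"
      by (simp add: that(2))
    finally have "r * (a / (2 * q)) + r * (b / (2 * q)) = r * (m / q)" .
    then have "r * \<psi> [e i, e j, e 6] = r * (m / q) * \<psi> [e i, e j, e 5]"
      using that(1) by simp
    then have "q * \<psi> [e i, e j, e 6] = m * \<psi> [e i, e j, e 5]"
      using r q by (simp add: field_simps)
    then show ?thesis
      by (metis f_def power_mult_distrib)
  qed
  have s: "q\<^sup>2 * f 1 2 6 = 1\<^sup>2 * f 1 2 5" "q\<^sup>2 * f 1 3 6 = t\<^sup>2 * f 1 3 5" "q\<^sup>2 * f 1 4 6 = s\<^sup>2 * f 1 4 5"
    "q\<^sup>2 * f 2 3 6 = (- s)\<^sup>2 * f 2 3 5" "q\<^sup>2 * f 2 4 6 = (- t)\<^sup>2 * f 2 4 5" "q\<^sup>2 * f 3 4 6 = (- 1)\<^sup>2 * f 3 4 5"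
    by (rule sq, rule c(5), simp, rule sq, rule c(6), simp, rule sq, rule c(7), simp,
        rule sq, rule c(8), simp, rule sq, rule c(9), simp, rule sq, rule c(10), simp)
  have "f 1 2 5 + f 1 3 5 + f 1 4 5 + f 2 3 5 + f 2 4 5 + f 3 4 5 =
      f 1 2 6 + f 1 3 6 + f 1 4 6 + f 2 3 6 + f 2 4 6 + f 3 4 6"
    using W[of 0 0 0 0 1 "-1"] by (simp add: weighted_norm2_def n f_def)
  then have "q\<^sup>2 * f 1 2 5 + q\<^sup>2 * f 1 3 5 + q\<^sup>2 * f 1 4 5 + q\<^sup>2 * f 2 3 5 + q\<^sup>2 * f 2 4 5 + q\<^sup>2 * f 3 4 5 =
      q\<^sup>2 * f 1 2 6 + q\<^sup>2 * f 1 3 6 + q\<^sup>2 * f 1 4 6 + q\<^sup>2 * f 2 3 6 + q\<^sup>2 * f 2 4 6 + q\<^sup>2 * f 3 4 6"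
    by (simp only: distrib_left[symmetric])
  also have "\<dots> = f 1 2 5 + t\<^sup>2 * f 1 3 5 + s\<^sup>2 * f 1 4 5 + s\<^sup>2 * f 2 3 5 + t\<^sup>2 * f 2 4 5 + f 3 4 5"
    using s by simp
  finally have "(t\<^sup>2 + s\<^sup>2) * f 1 2 5 + (1 + s\<^sup>2) * f 1 3 5 + (1 + t\<^sup>2) * f 1 4 5 + (1 + t\<^sup>2) * f 2 3 5
      + (1 + s\<^sup>2) * f 2 4 5 + (t\<^sup>2 + s\<^sup>2) * f 3 4 5 = 0"
    unfolding q2 by (simp add: algebra_simps)
  moreover have "(t\<^sup>2 + s\<^sup>2) * f 1 2 5 \<ge> 0" "(1 + s\<^sup>2) * f 1 3 5 \<ge> f 1 3 5" "(1 + t\<^sup>2) * f 1 4 5 \<ge> f 1 4 5"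
    "(1 + t\<^sup>2) * f 2 3 5 \<ge> 0" "(1 + s\<^sup>2) * f 2 4 5 \<ge> 0" "(t\<^sup>2 + s\<^sup>2) * f 3 4 5 \<ge> 0"
    using f by (simp_all add: distrib_right)
  ultimately have "f 1 3 5 \<le> 0" "f 1 4 5 \<le> 0"
    using f[of 1 3 5] f[of 1 4 5] by linarith+
  then have z5: "f 1 3 5 = 0" "f 1 4 5 = 0"
    using f[of 1 3 5] f[of 1 4 5] by simp_all
  then have z6: "f 1 3 6 = 0" "f 1 4 6 = 0"
    using s(2,3) q by simp_all
  \<comment> \<open>weights that cancel every \<open>\<psi>\<^sub>i\<^sub>j\<^sub>5\<close> and \<open>\<psi>\<^sub>i\<^sub>j\<^sub>6\<close> with \<open>i, j \<le> 4\<close> and have sum \<open>0\<close>\<close>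
  have "f 1 5 6 + f 2 5 6 + f 3 5 6 + f 4 5 6 = 0"
    using W[of 1 1 1 1 "-2" "-2"] by (simp add: weighted_norm2_def n f_def)
  then have "f 1 5 6 = 0"
    using f[of 1 5 6] f[of 2 5 6] f[of 3 5 6] f[of 4 5 6] by linarith
  then have "f 1 2 5 + f 1 2 6 = 2 * \<kappa>"
    using W[of 1 0 0 0 0 0] z5 z6 by (simp add: weighted_norm2_def n f_def)
  then show False
    using pair \<kappa> by (simp add: n f_def)
qed

section \<open>Coupled structures in rank two\<close>

lemma rank_two_ce_diff:
  assumes \<omega>: "\<omega> \<in> Forms 2"
    and \<phi>: "\<phi> = ce_diff (bracket (rank_two a1 a2 a3 a4 b1 b2 b3 b4 c112 c221 k m)) \<omega>"
  shows "\<phi> [e 1, e 2, e 3] = m * \<omega> [e 2, e 4]" "\<phi> [e 1, e 2, e 4] = k * \<omega> [e 3, e 4]"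
    "\<phi> [e 1, e 3, e 4] = 0" "\<phi> [e 2, e 3, e 4] = 0"
    "\<phi> [e 3, e 4, e 5] = - (a3 + a4) * \<omega> [e 3, e 4]" "\<phi> [e 3, e 4, e 6] = - (b3 + b4) * \<omega> [e 3, e 4]"
    "\<phi> [e 2, e 4, e 5] = - (a2 + a4) * \<omega> [e 2, e 4]"
    "\<phi> [e 2, e 4, e 6] = - (b2 + b4) * \<omega> [e 2, e 4] - c112 * \<omega> [e 1, e 4]"
proof -
  have lin: "linear (\<lambda>v. \<omega> [v, x])" for x
    using Forms_linear_hd[OF \<omega>, of "[x]"] .
  note [simp] = \<phi> ce_diff_3 linear_bracket[OF lin] rank_two_def struct_eqs_def e_nth scale_form_def
    Forms_2_sort[OF \<omega>]
  show "\<phi> [e 1, e 2, e 3] = m * \<omega> [e 2, e 4]" "\<phi> [e 1, e 2, e 4] = k * \<omega> [e 3, e 4]"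
    "\<phi> [e 1, e 3, e 4] = 0" "\<phi> [e 2, e 3, e 4] = 0"
    "\<phi> [e 3, e 4, e 5] = - (a3 + a4) * \<omega> [e 3, e 4]" "\<phi> [e 3, e 4, e 6] = - (b3 + b4) * \<omega> [e 3, e 4]"
    "\<phi> [e 2, e 4, e 5] = - (a2 + a4) * \<omega> [e 2, e 4]"
    "\<phi> [e 2, e 4, e 6] = - (b2 + b4) * \<omega> [e 2, e 4] - c112 * \<omega> [e 1, e 4]"
    by (simp_all add: algebra_simps)
qed

lemma wedge_square:
  assumes \<omega>: "\<omega> \<in> Forms 2"
  shows "(\<omega> \<^bold>\<and> \<omega>) [a, b, c, d] =
    2 * (\<omega> [a, b] * \<omega> [c, d] - \<omega> [a, c] * \<omega> [b, d] + \<omega> [a, d] * \<omega> [b, c])"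
proof -
  let ?i = interior_prod
  have i1: "?i x \<omega> \<in> Forms 1" for x
    using interior_prod_Forms[of \<omega> 1 x] \<omega> by (simp add: numeral_2_eq_2 One_nat_def)
  have i0: "?i y (?i x \<omega>) \<in> Forms 0" for x y
    using interior_prod_Forms[of "?i x \<omega>" 0 y] i1 by (simp add: One_nat_def)
  have z: "?i z (?i y (?i x \<omega>)) = 0" for x y z
    by (rule interior_prod_Forms_0[OF i0])
  note ws = wedge_Cons[OF Forms_homogeneous[OF \<omega>]] wedge_Cons[OF Forms_homogeneous[OF i1]]
    wedge_Cons[OF Forms_homogeneous[OF i0]]
  show ?thesis
    by (simp add: ws z wedge_Nil) (simp add: interior_prod_def Forms_length[OF \<omega>])
qed

lemma Forms_4_sort:
  assumes "\<alpha> \<in> Forms 4"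
  shows "i < j \<Longrightarrow> \<alpha> [e j, e i, y, z] = - \<alpha> [e i, e j, y, z]"
    "i < j \<Longrightarrow> \<alpha> [x, e j, e i, z] = - \<alpha> [x, e i, e j, z]"
    "i < j \<Longrightarrow> \<alpha> [x, y, e j, e i] = - \<alpha> [x, y, e i, e j]"
    "\<alpha> [x, x, y, z] = 0" "\<alpha> [x, y, y, z] = 0" "\<alpha> [x, y, z, z] = 0"
  using Forms_swap[OF assms, of "[]" "e j" "e i" "[y, z]"] Forms_swap[OF assms, of "[x]" "e j" "e i" "[z]"]
    Forms_swap[OF assms, of "[x, y]" "e j" "e i" "[]"] Forms_alternating[OF assms, of "[x, x, y, z]"]
    Forms_alternating[OF assms, of "[x, y, y, z]"] Forms_alternating[OF assms, of "[x, y, z, z]"]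
  by simp_all

text \<open>On 4-forms of the nilradical \<open>e\<^sub>5\<close> acts by the trace of its weights, so \<open>\<omega> \<and> \<omega>\<close> must vanish on
  \<open>e\<^sub>1, \<dots>, e\<^sub>4\<close>.\<close>

lemma rank_two_ce_diff_square:
  assumes \<omega>: "\<omega> \<in> Forms 2" and a: "a1 + a2 + a3 + a4 \<noteq> 0"
    and closed: "ce_diff (bracket (rank_two a1 a2 a3 a4 b1 b2 b3 b4 c112 c221 k m)) (\<omega> \<^bold>\<and> \<omega>) = 0"
  shows "\<omega> [e 1, e 2] * \<omega> [e 3, e 4] - \<omega> [e 1, e 3] * \<omega> [e 2, e 4] + \<omega> [e 1, e 4] * \<omega> [e 2, e 3] = 0"
proof -
  define \<eta> where "\<eta> = \<omega> \<^bold>\<and> \<omega>"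
  have \<eta>: "\<eta> \<in> Forms 4"
    using wedge_Forms[OF \<omega> \<omega>] by (simp add: \<eta>_def)
  have lin: "linear (\<lambda>v. \<eta> [v, x, y, z])" for x y z
    using Forms_linear_hd[OF \<eta>, of "[x, y, z]"] .
  have "ce_diff (bracket (rank_two a1 a2 a3 a4 b1 b2 b3 b4 c112 c221 k m)) \<eta> [e 1, e 2, e 3, e 4, e 5] = 0"
    unfolding \<eta>_def by (simp add: closed)
  then have "(a1 + a2 + a3 + a4) * \<eta> [e 1, e 2, e 3, e 4] = 0"
    by (simp add: ce_diff_5 linear_bracket[OF lin] rank_two_def struct_eqs_def e_nth scale_form_def
        Forms_4_sort[OF \<eta>] algebra_simps)
  then show ?thesis
    using a by (simp add: \<eta>_def wedge_square[OF \<omega>])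
qed

text \<open>For an orthogonal complex structure the Pfaffian of \<open>\<omega>\<close> on a coordinate 4-plane is, up to sign, the
  value of \<open>\<omega>\<close> on the complementary 2-plane; only its vanishing is treated. Let
  \<open>u = \<omega>\<^sub>2\<^sub>3 e\<^sub>1 - \<omega>\<^sub>1\<^sub>3 e\<^sub>2 + \<omega>\<^sub>1\<^sub>2 e\<^sub>3\<close>. Then \<open>i\<^sub>u \<omega>\<close> vanishes on \<open>e\<^sub>1, e\<^sub>2, e\<^sub>3\<close>, and on \<open>e\<^sub>4\<close> by
  assumption. Orthogonality of the rows of \<open>\<omega>\<close> shows that its components \<open>p\<close>, \<open>q\<close> along \<open>e\<^sub>5, e\<^sub>6\<close> are
  annihilated by \<open>\<omega>\<^sub>5\<^sub>6\<close>. So if \<open>\<omega>\<^sub>5\<^sub>6 \<noteq> 0\<close>, then \<open>u = 0\<close>, and the first two rows are proportional to the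
  same vector, which is impossible for orthonormal rows.\<close>

lemma Pfaffian_zero_imp:
  assumes \<omega>: "\<omega> \<in> Forms 2"
    and orth: "\<And>i j. i \<in> {1..6} \<Longrightarrow> j \<in> {1..6} \<Longrightarrow>
      (\<Sum>k\<in>{1..6}. \<omega> [e i, e k] * \<omega> [e j, e k]) = (if i = j then 1 else 0)"
    and Pf: "\<omega> [e 1, e 2] * \<omega> [e 3, e 4] - \<omega> [e 1, e 3] * \<omega> [e 2, e 4] + \<omega> [e 1, e 4] * \<omega> [e 2, e 3] = 0"
  shows "\<omega> [e 5, e 6] = 0"
proof (rule ccontr)
  assume nz: "\<omega> [e 5, e 6] \<noteq> 0"
  define w where "w i j = \<omega> [e i, e j]" for i j
  have w_sort: "i < j \<Longrightarrow> w j i = - w i j" "w i i = 0" for i j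
    by (simp_all add: w_def Forms_2_sort[OF \<omega>])
  define g where "g i j = w i 1 * w j 1 + w i 2 * w j 2 + w i 3 * w j 3 + w i 4 * w j 4 + w i 5 * w j 5 + w i 6 * w j 6" for i j
  have g: "g i j = (if i = j then 1 else 0)" if "i \<in> {1..6}" "j \<in> {1..6}" for i j
    using orth[OF that] unfolding sum_1_6 g_def w_def .
  define pf where "pf = w 1 2 * w 3 4 - w 1 3 * w 2 4 + w 1 4 * w 2 3"
  define p q where "p = w 2 3 * w 1 5 - w 1 3 * w 2 5 + w 1 2 * w 3 5"
    and "q = w 2 3 * w 1 6 - w 1 3 * w 2 6 + w 1 2 * w 3 6"
  have pf: "pf = 0"
    using Pf by (simp add: pf_def w_def)
  have w56: "w 5 6 \<noteq> 0"
    using nz by (simp add: w_def)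
  have "p * w 5 6 = - (w 2 3 * g 1 6 - w 1 3 * g 2 6 + w 1 2 * g 3 6) - w 4 6 * pf"
    by (simp add: p_def pf_def g_def w_sort algebra_simps)
  then have p: "p = 0"
    using w56 by (simp add: g pf)
  have "q * w 5 6 = w 2 3 * g 1 5 - w 1 3 * g 2 5 + w 1 2 * g 3 5 + w 4 5 * pf"
    by (simp add: q_def pf_def g_def w_sort algebra_simps)
  then have q: "q = 0"
    using w56 by (simp add: g pf)
  \<comment> \<open>the squared length of \<open>i\<^sub>u \<omega>\<close>, computed with the Gram matrix \<open>g\<close> of the rows and by components\<close>
  have "w 2 3 * w 2 3 * g 1 1 + w 1 3 * w 1 3 * g 2 2 + w 1 2 * w 1 2 * g 3 3 - 2 * w 2 3 * w 1 3 * g 1 2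
      + 2 * w 2 3 * w 1 2 * g 1 3 - 2 * w 1 3 * w 1 2 * g 2 3 = pf * pf + p * p + q * q"
    by (simp add: p_def q_def pf_def g_def w_sort algebra_simps)
  then have "w 2 3 * w 2 3 + w 1 3 * w 1 3 + w 1 2 * w 1 2 = 0"
    by (simp add: g pf p q)
  then have z: "w 2 3 = 0" "w 1 3 = 0" "w 1 2 = 0"
    by (simp_all add: add_nonneg_eq_0_iff)
  \<comment> \<open>orthogonality to the last two rows: the first two rows are multiples of one vector\<close>
  have r: "w i 5 * w 5 6 = - (w i 4 * w 4 6)" "w i 6 * w 5 6 = w i 4 * w 4 5" if "i = 1 \<or> i = 2" for i
    using that g[of i 6] g[of i 5] by (auto simp: g_def w_sort z)
  have "w 5 6 * w 5 6 * g 1 2 = w 1 4 * w 2 4 * (w 5 6 * w 5 6)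
      + (w 1 5 * w 5 6) * (w 2 5 * w 5 6) + (w 1 6 * w 5 6) * (w 2 6 * w 5 6)"
    by (simp add: g_def w_sort z algebra_simps)
  also have "\<dots> = w 1 4 * w 2 4 * (w 5 6 * w 5 6 + w 4 6 * w 4 6 + w 4 5 * w 4 5)"
    by (simp add: r) (simp add: algebra_simps)
  finally have "w 1 4 * w 2 4 * (w 5 6 * w 5 6 + w 4 6 * w 4 6 + w 4 5 * w 4 5) = 0"
    by (simp add: g)
  moreover have "w 5 6 * w 5 6 + w 4 6 * w 4 6 + w 4 5 * w 4 5 > 0"
    using w56 by (intro add_pos_nonneg) (auto simp: zero_less_mult_iff linorder_neq_iff)
  ultimately have "w 1 4 = 0 \<or> w 2 4 = 0"
    by simp
  then obtain i where i: "i = 1 \<or> i = 2" "w i 4 = 0"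
    by blast
  have "w i 5 * w 5 6 = 0" "w i 6 * w 5 6 = 0"
    using r[OF i(1)] i(2) by simp_all
  then have "w i 5 = 0" "w i 6 = 0"
    using w56 by simp_all
  moreover from i(1) have "w i 1 = 0" "w i 2 = 0" "w i 3 = 0"
    by (elim disjE; simp add: w_sort z)+
  ultimately have "g i i = 0"
    using i(2) by (simp add: g_def)
  then show False
    using i(1) g[of i i] by (elim disjE) simp_all
qed

text \<open>Add the pair identities so that every coefficient with an index \<open>5\<close> or \<open>6\<close> cancels; each remaining one
  is counted for three pairs inside the 4-plane, with factor \<open>2\<close>.\<close>

lemma four_plane_norm:
  assumes \<psi>: "\<psi> \<in> Forms 3" and \<omega>: "\<omega> \<in> Forms 2"
    and pair: "\<And>i j. i \<in> {1..6} \<Longrightarrow> j \<in> {1..6} \<Longrightarrow> i \<noteq> j \<Longrightarrow>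
      (\<Sum>k\<in>{1..6}. (\<psi> [e i, e j, e k])\<^sup>2) = \<kappa> * (1 - (\<omega> [e i, e j])\<^sup>2)"
    and orth: "\<And>i j. i \<in> {1..6} \<Longrightarrow> j \<in> {1..6} \<Longrightarrow>
      (\<Sum>k\<in>{1..6}. \<omega> [e i, e k] * \<omega> [e j, e k]) = (if i = j then 1 else 0)"
  shows "(\<psi> [e 1, e 2, e 3])\<^sup>2 + (\<psi> [e 1, e 2, e 4])\<^sup>2 + (\<psi> [e 1, e 3, e 4])\<^sup>2 + (\<psi> [e 2, e 3, e 4])\<^sup>2 =
    \<kappa> * (1 - (\<omega> [e 5, e 6])\<^sup>2)"
proof -
  note [simp] = sum_1_6 Forms_2_sort[OF \<omega>] Forms_3_sort[OF \<psi>]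
  define w where "w i j = \<kappa> * (\<omega> [e i, e j])\<^sup>2" for i j
  define P where "P i j = (\<Sum>k\<in>{1..6}. (\<psi> [e i, e j, e k])\<^sup>2)" for i j
  have P: "P i j = \<kappa> - w i j" if "i \<in> {1..6}" "j \<in> {1..6}" "i \<noteq> j" for i j
    using pair[OF that] by (simp only: P_def w_def right_diff_distrib mult_1_right)
  have row: "w i 1 + w i 2 + w i 3 + w i 4 + w i 5 + w i 6 = \<kappa>" if "i \<in> {1..6}" for i
    using arg_cong[OF orth[OF that that], of "(*) \<kappa>"] unfolding w_def power2_eq_square sum_1_6
    by (simp only: distrib_left mult_1_right if_True refl)
  have sym: "w i i = 0" "w 2 1 = w 1 2" "w 3 1 = w 1 3" "w 4 1 = w 1 4" "w 3 2 = w 2 3" "w 4 2 = w 2 4"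
    "w 4 3 = w 3 4" "w 5 1 = w 1 5" "w 5 2 = w 2 5" "w 5 3 = w 3 5" "w 5 4 = w 4 5" "w 6 1 = w 1 6"
    "w 6 2 = w 2 6" "w 6 3 = w 3 6" "w 6 4 = w 4 6" "w 6 5 = w 5 6" for i
    by (simp_all add: w_def)
  let ?S = "(\<psi> [e 1, e 2, e 3])\<^sup>2 + (\<psi> [e 1, e 2, e 4])\<^sup>2 + (\<psi> [e 1, e 3, e 4])\<^sup>2 + (\<psi> [e 2, e 3, e 4])\<^sup>2"
  have "6 * ?S = 2 * (P 1 2 + P 1 3 + P 1 4 + P 2 3 + P 2 4 + P 3 4)
      - (P 1 5 + P 2 5 + P 3 5 + P 4 5) - (P 1 6 + P 2 6 + P 3 6 + P 4 6) + 2 * P 5 6"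
    by (simp add: P_def)
  also have "\<dots> = 6 * \<kappa> - 2 * (w 1 2 + w 1 3 + w 1 4 + w 2 3 + w 2 4 + w 3 4)
      + (w 1 5 + w 2 5 + w 3 5 + w 4 5) + (w 1 6 + w 2 6 + w 3 6 + w 4 6) - 2 * w 5 6"
    by (simp add: P)
  also have "2 * (w 1 2 + w 1 3 + w 1 4 + w 2 3 + w 2 4 + w 3 4)
      = 4 * \<kappa> - (w 1 5 + w 2 5 + w 3 5 + w 4 5) - (w 1 6 + w 2 6 + w 3 6 + w 4 6)"
    using row[of 1] row[of 2] row[of 3] row[of 4] by (simp add: sym)
  also have "w 1 5 + w 2 5 + w 3 5 + w 4 5 = \<kappa> - w 5 6"
    using row[of 5] by (simp add: sym)
  also have "w 1 6 + w 2 6 + w 3 6 + w 4 6 = \<kappa> - w 5 6"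
    using row[of 6] by (simp add: sym)
  finally have "?S = \<kappa> - w 5 6"
    by simp
  then show ?thesis
    by (simp only: w_def right_diff_distrib mult_1_right)
qed

lemma coupled_coordinates:
  assumes coupled: "coupled br \<omega> \<psi>" and metric: "induced_metric \<omega> \<psi> = std_metric"
  obtains K where "\<omega> \<in> Forms 2" "ce_diff br (\<omega> \<^bold>\<and> \<omega>) = 0" "ce_diff br \<omega> \<in> Forms 3" "K > 0"
    and "\<And>i j. i \<in> {1..6} \<Longrightarrow> j \<in> {1..6} \<Longrightarrow> i \<noteq> j \<Longrightarrow>
      (\<Sum>k\<in>{1..6}. (ce_diff br \<omega> [e i, e j, e k])\<^sup>2) = K * (1 - (\<omega> [e i, e j])\<^sup>2)"
    and "\<And>i j. i \<in> {1..6} \<Longrightarrow> j \<in> {1..6} \<Longrightarrow>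
      (\<Sum>k\<in>{1..6}. \<omega> [e i, e k] * \<omega> [e j, e k]) = (if i = j then 1 else 0)"
proof -
  obtain c where hf: "half_flat br \<omega> \<psi>" and c: "c \<noteq> 0" "ce_diff br \<omega> = c \<cdot> \<psi>"
    using coupled by (auto simp: coupled_def)
  have su3: "su3_structure \<omega> \<psi>" and d: "ce_diff br (\<omega> \<^bold>\<and> \<omega>) = 0"
    using hf by (simp_all add: half_flat_def)
  then have \<omega>: "\<omega> \<in> Forms 2" and \<psi>: "\<psi> \<in> Forms 3"
    by (simp_all add: su3_structure_def stable2_def stable3_def)
  obtain \<kappa> where \<kappa>: "\<kappa> > 0"
    and pair: "\<And>i j. i \<in> {1..6} \<Longrightarrow> j \<in> {1..6} \<Longrightarrow> i \<noteq> j \<Longrightarrow>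
      (\<Sum>k\<in>{1..6}. (\<psi> [e i, e j, e k])\<^sup>2) = \<kappa> * (1 - (\<omega> [e i, e j])\<^sup>2)"
    and orth: "\<And>i j. i \<in> {1..6} \<Longrightarrow> j \<in> {1..6} \<Longrightarrow>
      (\<Sum>k\<in>{1..6}. \<omega> [e i, e k] * \<omega> [e j, e k]) = (if i = j then 1 else 0)"
    by (rule su3_coordinates[OF su3 metric]) blast
  show thesis
  proof (rule that[OF \<omega> d _ _ _ orth])
    show "ce_diff br \<omega> \<in> Forms 3"
      unfolding c(2) by (rule Forms_scale[OF \<psi>])
    show "c\<^sup>2 * \<kappa> > 0"
      using c(1) \<kappa> by simp
    fix i j :: nat assume "i \<in> {1..6}" "j \<in> {1..6}" "i \<noteq> j"
    from pair[OF this] show "(\<Sum>k\<in>{1..6}. (ce_diff br \<omega> [e i, e j, e k])\<^sup>2) = c\<^sup>2 * \<kappa> * (1 - (\<omega> [e i, e j])\<^sup>2)"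
      by (simp add: c(2) scale_form_def power_mult_distrib flip: sum_distrib_left)
  qed
qed

text \<open>The pair identities of \<open>d\<omega>\<close> for \<open>(3, 4)\<close> and \<open>(2, 4)\<close>, and the norm of \<open>d\<omega>\<close> on the span of
  \<open>e\<^sub>1, \<dots>, e\<^sub>4\<close>, where only the constants \<open>k\<close> and \<open>m\<close> of the nilradical contribute.\<close>

lemma coupled_rank_two:
  assumes "coupled (bracket (rank_two a1 a2 a3 a4 b1 b2 b3 b4 c112 c221 k m)) \<omega> \<psi>"
    and "induced_metric \<omega> \<psi> = std_metric" and a: "a1 + a2 + a3 + a4 \<noteq> 0"
  obtains K where "K > 0" "K = m\<^sup>2 * (\<omega> [e 2, e 4])\<^sup>2 + k\<^sup>2 * (\<omega> [e 3, e 4])\<^sup>2"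
    "((a3 + a4)\<^sup>2 + (b3 + b4)\<^sup>2) * (\<omega> [e 3, e 4])\<^sup>2 = K * (1 - (\<omega> [e 3, e 4])\<^sup>2)"
    "(a2 + a4)\<^sup>2 * (\<omega> [e 2, e 4])\<^sup>2 + ((b2 + b4) * \<omega> [e 2, e 4] + c112 * \<omega> [e 1, e 4])\<^sup>2
      + k\<^sup>2 * (\<omega> [e 3, e 4])\<^sup>2 = K * (1 - (\<omega> [e 2, e 4])\<^sup>2)"
proof -
  define \<phi> where "\<phi> = ce_diff (bracket (rank_two a1 a2 a3 a4 b1 b2 b3 b4 c112 c221 k m)) \<omega>"
  obtain K where K: "\<omega> \<in> Forms 2" "ce_diff (bracket (rank_two a1 a2 a3 a4 b1 b2 b3 b4 c112 c221 k m)) (\<omega> \<^bold>\<and> \<omega>) = 0"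
      "\<phi> \<in> Forms 3" "K > 0"
    and pair: "\<And>i j. i \<in> {1..6} \<Longrightarrow> j \<in> {1..6} \<Longrightarrow> i \<noteq> j \<Longrightarrow>
      (\<Sum>k\<in>{1..6}. (\<phi> [e i, e j, e k])\<^sup>2) = K * (1 - (\<omega> [e i, e j])\<^sup>2)"
    and orth: "\<And>i j. i \<in> {1..6} \<Longrightarrow> j \<in> {1..6} \<Longrightarrow>
      (\<Sum>k\<in>{1..6}. \<omega> [e i, e k] * \<omega> [e j, e k]) = (if i = j then 1 else 0)"
    unfolding \<phi>_def by (rule coupled_coordinates[OF assms(1,2)]) blast
  note \<phi> = rank_two_ce_diff[OF K(1) \<phi>_def]
  have "\<omega> [e 5, e 6] = 0"
    by (rule Pfaffian_zero_imp[OF K(1) orth rank_two_ce_diff_square[OF K(1) a K(2)]])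
  then have "m\<^sup>2 * (\<omega> [e 2, e 4])\<^sup>2 + k\<^sup>2 * (\<omega> [e 3, e 4])\<^sup>2 = K"
    using four_plane_norm[OF K(3,1) pair orth] by (simp add: \<phi> power_mult_distrib)
  moreover note [simp] = sum_1_6 Forms_3_sort[OF K(3)] \<phi>
  have "((a3 + a4)\<^sup>2 + (b3 + b4)\<^sup>2) * (\<omega> [e 3, e 4])\<^sup>2 = K * (1 - (\<omega> [e 3, e 4])\<^sup>2)"
    using pair[of 3 4, simplified] by (simp add: power2_eq_square algebra_simps)
  moreover have "(a2 + a4)\<^sup>2 * (\<omega> [e 2, e 4])\<^sup>2 + ((b2 + b4) * \<omega> [e 2, e 4] + c112 * \<omega> [e 1, e 4])\<^sup>2
      + k\<^sup>2 * (\<omega> [e 3, e 4])\<^sup>2 = K * (1 - (\<omega> [e 2, e 4])\<^sup>2)"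
    using pair[of 2 4, simplified] by (simp add: power2_eq_square algebra_simps)
  ultimately show thesis
    using that[OF K(4)] by simp
qed

lemma s10_rank_two:
  "s10 r t = rank_two (2 * r / sqrt 33) (2 * r / sqrt 33) (4 * r / sqrt 33) (3 * r / sqrt 33)
     (r * t) (r * t) (2 * r * t) (- (4 * r * t)) (r * sqrt (1/2 - 11 * t^2)) (r * sqrt (1/2 - 11 * t^2))
     (- (r * sqrt (2/3))) 0"
  by (simp add: s10_def rank_two_def)

text \<open>With \<open>x = \<omega>\<^sub>3\<^sub>4\<^sup>2\<close> the norm on the 4-plane is \<open>K = 2/3 r\<^sup>2 x\<close>. The pair \<open>(3, 4)\<close> then requires
  \<open>49/33 + 4 t\<^sup>2 = 2/3 (1 - x)\<close>, but the left side is larger than \<open>2/3\<close>.\<close>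

lemma s10_not_coupled:
  assumes r: "r > 0" and coupled: "coupled (bracket (s10 r t)) \<omega> \<psi>" "induced_metric \<omega> \<psi> = std_metric"
  shows False
proof -
  have "2 * r / sqrt 33 + 2 * r / sqrt 33 + 4 * r / sqrt 33 + 3 * r / sqrt 33 = 11 * r / sqrt 33"
    by (simp add: add_divide_distrib[symmetric])
  then have tr: "2 * r / sqrt 33 + 2 * r / sqrt 33 + 4 * r / sqrt 33 + 3 * r / sqrt 33 \<noteq> 0"
    using r by simp
  have sum: "4 * r / sqrt 33 + 3 * r / sqrt 33 = 7 * r / sqrt 33"
    by (simp add: add_divide_distrib[symmetric])
  obtain K where K: "K > 0" "K = 0\<^sup>2 * (\<omega> [e 2, e 4])\<^sup>2 + (- (r * sqrt (2/3)))\<^sup>2 * (\<omega> [e 3, e 4])\<^sup>2"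
    "((4 * r / sqrt 33 + 3 * r / sqrt 33)\<^sup>2 + (2 * r * t + - (4 * r * t))\<^sup>2) * (\<omega> [e 3, e 4])\<^sup>2
      = K * (1 - (\<omega> [e 3, e 4])\<^sup>2)"
    by (rule coupled_rank_two[OF coupled[unfolded s10_rank_two] tr])
  define x where "x = (\<omega> [e 3, e 4])\<^sup>2"
  have Kx: "K = 2/3 * r\<^sup>2 * x"
    using K(2) by (simp add: x_def power_mult_distrib)
  have x: "x > 0"
    using K(1) Kx r by (simp add: zero_less_mult_iff)
  have "(49/33 * r\<^sup>2 + 4 * r\<^sup>2 * t\<^sup>2) * x = 2/3 * r\<^sup>2 * x * (1 - x)"
    using K(3) unfolding sum Kx x_def[symmetric]
    by (simp add: power_mult_distrib power_divide)
  then have "r\<^sup>2 * x * (49/33 + 4 * t\<^sup>2 - 2/3 * (1 - x)) = 0"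
    by (simp add: algebra_simps)
  moreover have "49/33 + 4 * T - 2/3 * (1 - x) > 0" if "T \<ge> 0" for T
    using x that by (simp add: algebra_simps)
  moreover from this[of "t\<^sup>2"] have "49/33 + 4 * t\<^sup>2 - 2/3 * (1 - x) > 0"
    by simp
  ultimately show False
    using r x by simp
qed

lemma s11_rank_two:
  "s11 r = rank_two (r / sqrt 30) (2 * r / sqrt 30) (3 * r / sqrt 30) (4 * r / sqrt 30)
     (3 * r / sqrt 30) (- (4 * r / sqrt 30)) (- (r / sqrt 30)) (2 * r / sqrt 30) 0 0
     (- (r * sqrt (2/3))) (- (r * sqrt (2/3)))"
  by (simp add: s11_def rank_two_def)

text \<open>With \<open>x = \<omega>\<^sub>3\<^sub>4\<^sup>2\<close> and \<open>y = \<omega>\<^sub>2\<^sub>4\<^sup>2\<close>, in units of \<open>r\<^sup>2/30\<close>, one has \<open>K = 20 (x + y)\<close>, \<open>50 x = K (1 - x)\<close> and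
  \<open>40 y + 20 x = K (1 - y)\<close>. The last equation gives \<open>y = 0\<close>, then the second gives \<open>x = 0\<close>.\<close>

lemma s11_not_coupled:
  assumes r: "r > 0" and coupled: "coupled (bracket (s11 r)) \<omega> \<psi>" "induced_metric \<omega> \<psi> = std_metric"
  shows False
proof -
  have "r / sqrt 30 + 2 * r / sqrt 30 + 3 * r / sqrt 30 + 4 * r / sqrt 30 = 10 * r / sqrt 30"
    by (simp add: add_divide_distrib[symmetric])
  then have tr: "r / sqrt 30 + 2 * r / sqrt 30 + 3 * r / sqrt 30 + 4 * r / sqrt 30 \<noteq> 0"
    using r by simp
  obtain K where K: "K > 0"
    "K = (- (r * sqrt (2/3)))\<^sup>2 * (\<omega> [e 2, e 4])\<^sup>2 + (- (r * sqrt (2/3)))\<^sup>2 * (\<omega> [e 3, e 4])\<^sup>2"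
    "((3 * r / sqrt 30 + 4 * r / sqrt 30)\<^sup>2 + (- (r / sqrt 30) + 2 * r / sqrt 30)\<^sup>2) * (\<omega> [e 3, e 4])\<^sup>2
      = K * (1 - (\<omega> [e 3, e 4])\<^sup>2)"
    "(2 * r / sqrt 30 + 4 * r / sqrt 30)\<^sup>2 * (\<omega> [e 2, e 4])\<^sup>2
      + ((- (4 * r / sqrt 30) + 2 * r / sqrt 30) * \<omega> [e 2, e 4] + 0 * \<omega> [e 1, e 4])\<^sup>2
      + (- (r * sqrt (2/3)))\<^sup>2 * (\<omega> [e 3, e 4])\<^sup>2 = K * (1 - (\<omega> [e 2, e 4])\<^sup>2)"
    by (rule coupled_rank_two[OF coupled[unfolded s11_rank_two] tr])
  define x y where "x = (\<omega> [e 3, e 4])\<^sup>2" and "y = (\<omega> [e 2, e 4])\<^sup>2"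
  have pos: "x \<ge> 0" "y \<ge> 0"
    by (simp_all add: x_def y_def)
  define s where "s = r\<^sup>2 / 30"
  have s: "s > 0"
    using r by (simp add: s_def)
  have sq: "(a * r / sqrt 30)\<^sup>2 = a\<^sup>2 * s" for a
    by (simp add: s_def power_mult_distrib power_divide)
  have k: "(- (r * sqrt (2/3)))\<^sup>2 = 20 * s"
    by (simp add: s_def power_mult_distrib)
  have sums: "3 * r / sqrt 30 + 4 * r / sqrt 30 = 7 * r / sqrt 30" "- (r / sqrt 30) + 2 * r / sqrt 30 = 1 * r / sqrt 30"
    "2 * r / sqrt 30 + 4 * r / sqrt 30 = 6 * r / sqrt 30" "- (4 * r / sqrt 30) + 2 * r / sqrt 30 = (- 2) * r / sqrt 30"
    by (simp_all add: field_simps)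
  have Kxy: "K = 20 * s * (x + y)"
    using K(2) unfolding k x_def y_def by (simp add: algebra_simps)
  have "50 * s * x = K * (1 - x)"
    using K(3) unfolding sums sq x_def by (simp add: algebra_simps)
  moreover have "40 * s * y + 20 * s * x = K * (1 - y)"
    using K(4) unfolding sums power_mult_distrib[of _ "\<omega> [e 2, e 4]"] mult_zero_left add_0_right sq k x_def y_def
    by (simp add: algebra_simps)
  ultimately have e: "50 * s * x = 20 * s * (x + y) * (1 - x)" "40 * s * y + 20 * s * x = 20 * s * (x + y) * (1 - y)"
    by (simp_all add: Kxy)
  have "s * (y * (1 + x + y)) = 0"
    using e(2) by (simp add: algebra_simps)
  then have y: "y = 0"
    using s pos by auto
  have "s * (x * (3 + 2 * x)) = 0"
    using e(1) y by (simp add: algebra_simps)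
  then have "x = 0"
    using s pos by auto
  then show False
    using Kxy y K(1) by simp
qed

section \<open>Coupled structures in rank three\<close>

definition rank_three :: "real \<Rightarrow> real \<Rightarrow> real \<Rightarrow> real \<Rightarrow> real \<Rightarrow> real \<Rightarrow> real \<Rightarrow> real \<Rightarrow> real \<Rightarrow> 6 \<Rightarrow> form" where
  "rank_three a1 a2 a3 b1 b2 b3 c1 c2 c3 = struct_eqs
     (a1 \<cdot> cov2 1 4 + b1 \<cdot> cov2 1 5 + c1 \<cdot> cov2 1 6)
     (a2 \<cdot> cov2 2 4 + b2 \<cdot> cov2 2 5 + c2 \<cdot> cov2 2 6)
     (a3 \<cdot> cov2 3 4 + b3 \<cdot> cov2 3 5 + c3 \<cdot> cov2 3 6)
     0 0 0"

text \<open>The components \<open>(d\<omega>)(e\<^sub>1, \<cdot>, \<cdot>)\<close> on the last three vectors form the cross product of the weight of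
  \<open>e\<^sub>1\<close> and the vector \<open>(\<omega>\<^sub>1\<^sub>4, \<omega>\<^sub>1\<^sub>5, \<omega>\<^sub>1\<^sub>6)\<close>; the inequality is Lagrange's identity with the square of
  the inner product dropped.\<close>

lemma rank_three_ce_diff:
  assumes \<omega>: "\<omega> \<in> Forms 2"
    and \<phi>: "\<phi> = ce_diff (bracket (rank_three a1 a2 a3 b1 b2 b3 c1 c2 c3)) \<omega>"
  shows "\<phi> [e 1, e 2, e 3] = 0" "\<phi> [e 4, e 5, e 6] = 0"
    "(\<phi> [e 1, e 2, e 4])\<^sup>2 + (\<phi> [e 1, e 2, e 5])\<^sup>2 + (\<phi> [e 1, e 2, e 6])\<^sup>2
      = ((a1 + a2)\<^sup>2 + (b1 + b2)\<^sup>2 + (c1 + c2)\<^sup>2) * (\<omega> [e 1, e 2])\<^sup>2"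
    "(\<phi> [e 1, e 3, e 4])\<^sup>2 + (\<phi> [e 1, e 3, e 5])\<^sup>2 + (\<phi> [e 1, e 3, e 6])\<^sup>2
      = ((a1 + a3)\<^sup>2 + (b1 + b3)\<^sup>2 + (c1 + c3)\<^sup>2) * (\<omega> [e 1, e 3])\<^sup>2"
    "(\<phi> [e 2, e 3, e 4])\<^sup>2 + (\<phi> [e 2, e 3, e 5])\<^sup>2 + (\<phi> [e 2, e 3, e 6])\<^sup>2
      = ((a2 + a3)\<^sup>2 + (b2 + b3)\<^sup>2 + (c2 + c3)\<^sup>2) * (\<omega> [e 2, e 3])\<^sup>2"
    "(\<phi> [e 1, e 4, e 5])\<^sup>2 + (\<phi> [e 1, e 4, e 6])\<^sup>2 + (\<phi> [e 1, e 5, e 6])\<^sup>2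
      \<le> (a1\<^sup>2 + b1\<^sup>2 + c1\<^sup>2) * ((\<omega> [e 1, e 4])\<^sup>2 + (\<omega> [e 1, e 5])\<^sup>2 + (\<omega> [e 1, e 6])\<^sup>2)"
proof -
  have lin: "linear (\<lambda>v. \<omega> [v, x])" for x
    using Forms_linear_hd[OF \<omega>, of "[x]"] .
  note [simp] = ce_diff_3 linear_bracket[OF lin] rank_three_def struct_eqs_def e_nth scale_form_def
    Forms_2_sort[OF \<omega>]
  show "\<phi> [e 1, e 2, e 3] = 0" "\<phi> [e 4, e 5, e 6] = 0"
    by (simp_all add: \<phi>)
  have "\<phi> [e 1, e 2, e 4] = - ((a1 + a2) * \<omega> [e 1, e 2])" "\<phi> [e 1, e 2, e 5] = - ((b1 + b2) * \<omega> [e 1, e 2])"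
    "\<phi> [e 1, e 2, e 6] = - ((c1 + c2) * \<omega> [e 1, e 2])"
    "\<phi> [e 1, e 3, e 4] = - ((a1 + a3) * \<omega> [e 1, e 3])" "\<phi> [e 1, e 3, e 5] = - ((b1 + b3) * \<omega> [e 1, e 3])"
    "\<phi> [e 1, e 3, e 6] = - ((c1 + c3) * \<omega> [e 1, e 3])"
    "\<phi> [e 2, e 3, e 4] = - ((a2 + a3) * \<omega> [e 2, e 3])" "\<phi> [e 2, e 3, e 5] = - ((b2 + b3) * \<omega> [e 2, e 3])"
    "\<phi> [e 2, e 3, e 6] = - ((c2 + c3) * \<omega> [e 2, e 3])"
    by (simp_all add: \<phi> algebra_simps)
  note d = this
  show "(\<phi> [e 1, e 2, e 4])\<^sup>2 + (\<phi> [e 1, e 2, e 5])\<^sup>2 + (\<phi> [e 1, e 2, e 6])\<^sup>2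
      = ((a1 + a2)\<^sup>2 + (b1 + b2)\<^sup>2 + (c1 + c2)\<^sup>2) * (\<omega> [e 1, e 2])\<^sup>2"
    "(\<phi> [e 1, e 3, e 4])\<^sup>2 + (\<phi> [e 1, e 3, e 5])\<^sup>2 + (\<phi> [e 1, e 3, e 6])\<^sup>2
      = ((a1 + a3)\<^sup>2 + (b1 + b3)\<^sup>2 + (c1 + c3)\<^sup>2) * (\<omega> [e 1, e 3])\<^sup>2"
    "(\<phi> [e 2, e 3, e 4])\<^sup>2 + (\<phi> [e 2, e 3, e 5])\<^sup>2 + (\<phi> [e 2, e 3, e 6])\<^sup>2
      = ((a2 + a3)\<^sup>2 + (b2 + b3)\<^sup>2 + (c2 + c3)\<^sup>2) * (\<omega> [e 2, e 3])\<^sup>2"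
    by (simp_all only: d power2_minus power_mult_distrib flip: distrib_right)
  define x y z where "x = \<omega> [e 1, e 4]" and "y = \<omega> [e 1, e 5]" and "z = \<omega> [e 1, e 6]"
  have "\<phi> [e 1, e 4, e 5] = a1 * y - b1 * x" "\<phi> [e 1, e 4, e 6] = a1 * z - c1 * x"
    "\<phi> [e 1, e 5, e 6] = b1 * z - c1 * y"
    by (simp_all add: \<phi> x_def y_def z_def)
  then have "(\<phi> [e 1, e 4, e 5])\<^sup>2 + (\<phi> [e 1, e 4, e 6])\<^sup>2 + (\<phi> [e 1, e 5, e 6])\<^sup>2
      = (a1\<^sup>2 + b1\<^sup>2 + c1\<^sup>2) * (x\<^sup>2 + y\<^sup>2 + z\<^sup>2) - (a1 * x + b1 * y + c1 * z)\<^sup>2"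
    by (simp only: power2_eq_square) (simp add: algebra_simps)
  then show "(\<phi> [e 1, e 4, e 5])\<^sup>2 + (\<phi> [e 1, e 4, e 6])\<^sup>2 + (\<phi> [e 1, e 5, e 6])\<^sup>2
      \<le> (a1\<^sup>2 + b1\<^sup>2 + c1\<^sup>2) * ((\<omega> [e 1, e 4])\<^sup>2 + (\<omega> [e 1, e 5])\<^sup>2 + (\<omega> [e 1, e 6])\<^sup>2)"
    by (simp add: x_def y_def z_def)
qed

text \<open>The hypotheses hold when the weights of \<open>e\<^sub>1, e\<^sub>2, e\<^sub>3\<close> are pairwise orthogonal with squared length
  \<open>u\<close>. The pairs inside \<open>{1, 2, 3}\<close> give \<open>\<omega>\<^sub>1\<^sub>2\<^sup>2 = \<omega>\<^sub>1\<^sub>3\<^sup>2 = \<omega>\<^sub>2\<^sub>3\<^sup>2 = x\<close> with \<open>(2 u + K) x = K\<close>.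
  Summing the mixed pairs and the pairs inside \<open>{4, 5, 6}\<close> gives \<open>K = u\<close>, hence \<open>x = 1/3\<close>. Then the
  squared norm \<open>M 1\<close> of the cross product is \<open>2 u / 3\<close>, but the Cauchy-Schwarz bound is \<open>u (1 - 2 x) = u / 3\<close>.\<close>

lemma rank_three_not_coupled:
  assumes u: "u > 0" "a1\<^sup>2 + b1\<^sup>2 + c1\<^sup>2 = u" "(a1 + a2)\<^sup>2 + (b1 + b2)\<^sup>2 + (c1 + c2)\<^sup>2 = 2 * u"
      "(a1 + a3)\<^sup>2 + (b1 + b3)\<^sup>2 + (c1 + c3)\<^sup>2 = 2 * u" "(a2 + a3)\<^sup>2 + (b2 + b3)\<^sup>2 + (c2 + c3)\<^sup>2 = 2 * u"
    and coupled: "coupled (bracket (rank_three a1 a2 a3 b1 b2 b3 c1 c2 c3)) \<omega> \<psi>"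
      "induced_metric \<omega> \<psi> = std_metric"
  shows False
proof -
  define \<phi> where "\<phi> = ce_diff (bracket (rank_three a1 a2 a3 b1 b2 b3 c1 c2 c3)) \<omega>"
  obtain K where \<omega>: "\<omega> \<in> Forms 2" and \<phi>: "\<phi> \<in> Forms 3" and K: "K > 0"
    and pair: "\<And>i j. i \<in> {1..6} \<Longrightarrow> j \<in> {1..6} \<Longrightarrow> i \<noteq> j \<Longrightarrow>
      (\<Sum>k\<in>{1..6}. (\<phi> [e i, e j, e k])\<^sup>2) = K * (1 - (\<omega> [e i, e j])\<^sup>2)"
    and orth: "\<And>i j. i \<in> {1..6} \<Longrightarrow> j \<in> {1..6} \<Longrightarrow>
      (\<Sum>k\<in>{1..6}. \<omega> [e i, e k] * \<omega> [e j, e k]) = (if i = j then 1 else 0)"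
    unfolding \<phi>_def by (rule coupled_coordinates[OF coupled]) blast
  note d = rank_three_ce_diff[OF \<omega> \<phi>_def, unfolded u]
  define f where "f i j k = (\<phi> [e i, e j, e k])\<^sup>2" for i j k
  define w where "w i j = (\<omega> [e i, e j])\<^sup>2" for i j
  note [simp] = sum_1_6 Forms_2_sort[OF \<omega>] Forms_3_sort[OF \<phi>] d(1,2)
  have N: "f 1 2 4 + f 1 2 5 + f 1 2 6 = 2 * u * w 1 2" "f 1 3 4 + f 1 3 5 + f 1 3 6 = 2 * u * w 1 3"
    "f 2 3 4 + f 2 3 5 + f 2 3 6 = 2 * u * w 2 3"
    using d(3-5) by (simp_all add: f_def w_def)
  have P: "f 1 2 4 + f 1 2 5 + f 1 2 6 = K * (1 - w 1 2)" "f 1 3 4 + f 1 3 5 + f 1 3 6 = K * (1 - w 1 3)"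
    "f 2 3 4 + f 2 3 5 + f 2 3 6 = K * (1 - w 2 3)"
    "f 1 2 4 + f 1 3 4 + f 1 4 5 + f 1 4 6 = K * (1 - w 1 4)"
    "f 1 2 5 + f 1 3 5 + f 1 4 5 + f 1 5 6 = K * (1 - w 1 5)"
    "f 1 2 6 + f 1 3 6 + f 1 4 6 + f 1 5 6 = K * (1 - w 1 6)"
    "f 1 2 4 + f 2 3 4 + f 2 4 5 + f 2 4 6 = K * (1 - w 2 4)"
    "f 1 2 5 + f 2 3 5 + f 2 4 5 + f 2 5 6 = K * (1 - w 2 5)"
    "f 1 2 6 + f 2 3 6 + f 2 4 6 + f 2 5 6 = K * (1 - w 2 6)"
    "f 1 3 4 + f 2 3 4 + f 3 4 5 + f 3 4 6 = K * (1 - w 3 4)"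
    "f 1 3 5 + f 2 3 5 + f 3 4 5 + f 3 5 6 = K * (1 - w 3 5)"
    "f 1 3 6 + f 2 3 6 + f 3 4 6 + f 3 5 6 = K * (1 - w 3 6)"
    "f 1 4 5 + f 2 4 5 + f 3 4 5 = K * (1 - w 4 5)"
    "f 1 4 6 + f 2 4 6 + f 3 4 6 = K * (1 - w 4 6)"
    "f 1 5 6 + f 2 5 6 + f 3 5 6 = K * (1 - w 5 6)"
    using pair[of 1 2] pair[of 1 3] pair[of 2 3] pair[of 1 4] pair[of 1 5] pair[of 1 6] pair[of 2 4] pair[of 2 5]
      pair[of 2 6] pair[of 3 4] pair[of 3 5] pair[of 3 6] pair[of 4 5] pair[of 4 6] pair[of 5 6]
    by (simp_all add: f_def w_def)
  have R: "w 1 2 + w 1 3 + w 1 4 + w 1 5 + w 1 6 = 1" "w 1 2 + w 2 3 + w 2 4 + w 2 5 + w 2 6 = 1"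
    "w 1 3 + w 2 3 + w 3 4 + w 3 5 + w 3 6 = 1" "w 1 4 + w 2 4 + w 3 4 + w 4 5 + w 4 6 = 1"
    "w 1 5 + w 2 5 + w 3 5 + w 4 5 + w 5 6 = 1" "w 1 6 + w 2 6 + w 3 6 + w 4 6 + w 5 6 = 1"
    using orth[of 1 1] orth[of 2 2] orth[of 3 3] orth[of 4 4] orth[of 5 5] orth[of 6 6]
    by (simp_all add: w_def power2_eq_square)
  define x where "x = w 1 2"
  have "(2 * u + K) * w 1 2 = K" "(2 * u + K) * w 1 3 = K" "(2 * u + K) * w 2 3 = K"
    using N P(1-3) by (simp_all add: algebra_simps)
  moreover have "2 * u + K > 0"
    using u(1) K by simp
  ultimately have x: "w 1 2 = x" "w 1 3 = x" "w 2 3 = x" "(2 * u + K) * x = K"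
    by (simp_all add: x_def) (metis mult_cancel_left less_irrefl)+
  have "x \<noteq> 0"
    using x(4) K by auto
  define M where "M i = f i 4 5 + f i 4 6 + f i 5 6" for i
  have b: "w 1 4 + w 1 5 + w 1 6 = 1 - 2 * x" "w 2 4 + w 2 5 + w 2 6 = 1 - 2 * x"
    "w 3 4 + w 3 5 + w 3 6 = 1 - 2 * x" "w 4 5 + w 4 6 + w 5 6 = 3 * x"
    using R by (simp_all add: x)
  have "4 * u * x + 2 * M 1 = K * (3 - (w 1 4 + w 1 5 + w 1 6))"
    "4 * u * x + 2 * M 2 = K * (3 - (w 2 4 + w 2 5 + w 2 6))"
    "4 * u * x + 2 * M 3 = K * (3 - (w 3 4 + w 3 5 + w 3 6))"
    "M 1 + M 2 + M 3 = K * (3 - (w 4 5 + w 4 6 + w 5 6))"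
    using N P(4-15) by (simp_all add: M_def x algebra_simps)
  note M = this[unfolded b]
  have "4 * (u * x) + 2 * M 1 = 2 * K + 2 * (K * x)" "4 * (u * x) + 2 * M 2 = 2 * K + 2 * (K * x)"
    "4 * (u * x) + 2 * M 3 = 2 * K + 2 * (K * x)" "M 1 + M 2 + M 3 = 3 * K - 3 * (K * x)"
    using M by (simp_all add: algebra_simps)
  then have "K * x = u * x"
    by linarith
  then have Ku: "K = u"
    using \<open>x \<noteq> 0\<close> by simp
  then have x3: "x = 1 / 3"
    using x(4) u(1) by simp
  have "M 1 \<le> u * (w 1 4 + w 1 5 + w 1 6)"
    using d(6) by (simp add: M_def f_def w_def)
  then show False
    using M(1) u(1) unfolding b Ku x3 by simp
qed

lemma s13_rank_three:
  "s13 r = rank_three (r / sqrt 3) (r / sqrt 3) (r / sqrt 3) 0 (r / sqrt 2) (- (r / sqrt 2))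
     (- (2 * r / sqrt 6)) (r / sqrt 6) (r / sqrt 6)"
  by (simp add: s13_def rank_three_def)

lemma s13_not_coupled:
  assumes r: "r > 0" and coupled: "coupled (bracket (s13 r)) \<omega> \<psi>" "induced_metric \<omega> \<psi> = std_metric"
  shows False
  by (rule rank_three_not_coupled[OF _ _ _ _ _ coupled[unfolded s13_rank_three], of "r\<^sup>2"])
    (use r in \<open>simp_all add: power2_eq_square field_simps\<close>)

section \<open>Nonexistence of half-flat and coupled structures\<close>

theorem theorem4p5:
  fixes r :: real
  assumes "r > 0"
  shows "(\<forall>D \<in> {s1 r, s2 r, s3 r, s4 r, s5 r, s6 r, s7 r, s8 r, s9 r} \<union>
              {s12 r s t | s t. 0 \<le> s \<and> s \<le> t \<and> t \<le> 1}.
            \<not> (\<exists>\<omega> \<psi>. half_flat (bracket D) \<omega> \<psi> \<and> induced_metric \<omega> \<psi> = std_metric)) \<and>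
         (\<forall>D \<in> {s10 r t | t. 0 \<le> t \<and> t \<le> 1 / sqrt 22} \<union> {s11 r, s13 r}.
            \<not> (\<exists>\<omega> \<psi>. coupled (bracket D) \<omega> \<psi> \<and> induced_metric \<omega> \<psi> = std_metric))"
proof (intro conjI ballI notI; elim exE conjE)
  fix D \<omega> \<psi>
  assume D: "D \<in> {s1 r, s2 r, s3 r, s4 r, s5 r, s6 r, s7 r, s8 r, s9 r} \<union>
      {s12 r s t | s t. 0 \<le> s \<and> s \<le> t \<and> t \<le> 1}"
    and half_flat: "half_flat (bracket D) \<omega> \<psi>" and metric: "induced_metric \<omega> \<psi> = std_metric"
  note no = s1_not_half_flat s2_not_half_flat s3_not_half_flat s4_not_half_flat s5_not_half_flat
    s6_not_half_flat s7_not_half_flat s8_not_half_flat s9_not_half_flat s12_not_half_flat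
  show False
    using D half_flat by (auto dest: no[OF assms _ metric])
next
  fix D \<omega> \<psi>
  assume D: "D \<in> {s10 r t | t. 0 \<le> t \<and> t \<le> 1 / sqrt 22} \<union> {s11 r, s13 r}"
    and coupled: "coupled (bracket D) \<omega> \<psi>" and metric: "induced_metric \<omega> \<psi> = std_metric"
  note no = s10_not_coupled s11_not_coupled s13_not_coupled
  show False
    using D coupled by (auto dest: no[OF assms _ metric])
qed

end
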